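(* Let $q\in(-1,1)$. On the domain $\mathcal{P}$ of polynomials, the generators of the $q$-Brownian motion at times $t>0$ are $$A_tf(x)=\Delta_{t;q}f(x)=\int(\partial_x\partial f)(x,y)\,\Gamma_{t;q}(x,dy).$$ More explicitly, $$A_tf(x)=\int\left(\partial_x\frac{f(x)-f(y)}{x-y}\right)\frac{(q^2;q)_\infty}{\left|(qe^{i(\phi+\theta)},qe^{i(\phi-\theta)};q)_\infty\right|^2}\,d\gamma_{t;q}(y)$$ $$=\int\left(\partial_x\frac{f(x)-f(y)}{x-y}\right)(q^2;q)_\infty(q;q)_\infty\frac{\left|(qe^{2i\theta};q)_\infty\right|^2}{\left|(qe^{i(\phi+\theta)},qe^{i(\phi-\theta)};q)_\infty\right|^2}\,d\gamma_t(\sqrt{1-q}\,y),$$ where $x=\frac{2\sqrt t}{\sqrt{1-q}}\cos\phi$, $y=\frac{2\sqrt t}{\sqrt{1-q}}\cos\theta$, $\phi,\theta\in[0,\pi]$.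
   Context: The $q$-Brownian motion is the family of bounded self-adjoint operators $\{X(t):t\ge0\}$ generating a von Neumann algebra with faithful normal tracial state $\mathbb{E}$, with joint moments $\mathbb{E}[X(t_1)\cdots X(t_n)]=\sum_{\pi}q^{\mathrm{cr}(\pi)}\prod_{\{i,j\}\in\pi}\min(t_i,t_j)$, sum over pair partitions $\pi$ of $\{1,\dots,n\}$, $\mathrm{cr}(\pi)$ the number of crossings. It is a Markov process (Bożejko–Kümmerer–Speicher): its transition operators are determined by $\mathbb{E}[f(X(t))\,|\le s]=(\mathcal{K}_{s,t;q}f)(X(s))$, and on polynomials they are determined by $(\mathcal{K}_{s,t;q}H_n(\cdot,t;q))(x)=H_n(x,s;q)$. Here $H_n(x,t;q)$ are the monic continuous $q$-Hermite polynomials: $H_0=1$, $H_1=x$, $xH_n(x,t;q)=H_{n+1}(x,t;q)+[n]_q\,t\,H_{n-1}(x,t;q)$, $[n]_q=1+q+\dots+q^{n-1}$. The generator at time $t$ is $A_tf=\lim_{h\to0^+}\frac1h(\mathcal{K}_{t,t+h;q}f-f)$, the limit being uniform on the support $\left[-\frac{2\sqrt t}{\sqrt{1-q}},\frac{2\sqrt t}{\sqrt{1-q}}\right]$ of the distribution $\gamma_{t;q}$ of $X(t)$. $(a_1,\dots,a_k;q)_\infty=\prod_{j=1}^k\prod_{i=0}^\infty(1-a_jq^i)$. With $y=\frac{2\sqrt t}{\sqrt{1-q}}\cos\theta$, $\theta\in[0,\pi]$, $d\gamma_{t;q}(y)=\frac{\sqrt{1-q}}{\pi\sqrt t}\sin(\theta)\,(q;q)_\infty\left|(qe^{2i\theta};q)_\infty\right|^2dy$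 on the interval $\left[-\frac{2\sqrt t}{\sqrt{1-q}},\frac{2\sqrt t}{\sqrt{1-q}}\right]$; $d\gamma_t(u)=\frac{1}{2\pi t}\sqrt{4t-u^2}\,\mathbf{1}_{[-2\sqrt t,2\sqrt t]}(u)\,du$, and $d\gamma_t(\sqrt{1-q}\,y)=\frac{\sqrt{1-q}}{\pi\sqrt t}\sin\theta\,dy$. $\partial f(x,y)=\frac{f(x)-f(y)}{x-y}$, $\partial_x$ acts on the first variable, and $\Gamma_{t;q}(x,dy)$ is the integral kernel of the operator determined by $\int H_n(y,t;q)\,\Gamma_{t;q}(x,dy)=q^nH_n(x,t;q)$ for all $n\ge 0$. *)

theory Defs
  imports
    "HOL-Analysis.Analysis"
    "HOL-Library.Disjoint_Sets"
    "HOL-Computational_Algebra.Polynomial"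
begin

section \<open>Tracial von Neumann algebras\<close>

definition norm2 :: "('a::real_normed_algebra_1 \<Rightarrow> 'a) \<Rightarrow> ('a \<Rightarrow> complex) \<Rightarrow> 'a \<Rightarrow> real" where
  "norm2 star E a = sqrt (Re (E (star a * a)))"

text \<open>
  The whole type \<^typ>\<open>'a\<close> is the algebra.  A unital C*-algebra with a faithful tracial state
  is a von Neumann algebra on which the trace is normal if and only if its closed unit ball is
  complete in the norm \<^term>\<open>norm2 star E\<close>; this is the form in which the von Neumann property is
  imposed.
\<close>

locale tracial_von_neumann_algebra =
  vector_space scaleC
  for scaleC :: "complex \<Rightarrow> 'a::{real_normed_algebra_1, banach} \<Rightarrow> 'a" +
  fixes star :: "'a \<Rightarrow> 'a"
    and E :: "'a \<Rightarrow> complex"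
  assumes scale_of_real: "scaleC (of_real r) a = r *\<^sub>R a"
    and scale_mult_left: "scaleC c a * b = scaleC c (a * b)"
    and scale_mult_right: "a * scaleC c b = scaleC c (a * b)"
    and star_add: "star (a + b) = star a + star b"
    and star_scale: "star (scaleC c a) = scaleC (cnj c) (star a)"
    and star_mult: "star (a * b) = star b * star a"
    and star_star: "star (star a) = a"
    and C_star_identity: "norm (star a * a) = (norm a)\<^sup>2"
    and E_add: "E (a + b) = E a + E b"
    and E_scale: "E (scaleC c a) = c * E a"
    and E_one: "E 1 = 1"
    and E_positive: "Im (E (star a * a)) = 0 \<and> 0 \<le> Re (E (star a * a))"
    and E_faithful: "E (star a * a) = 0 \<Longrightarrow> a = 0"
    and E_tracial: "E (a * b) = E (b * a)"
    and unit_ball_complete: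
      "\<lbrakk>\<And>n::nat. norm (u n) \<le> 1;
        \<And>e. e > 0 \<Longrightarrow> \<exists>N. \<forall>m\<ge>N. \<forall>n\<ge>N. norm2 star E (u m - u n) < e\<rbrakk>
       \<Longrightarrow> \<exists>b. norm b \<le> 1 \<and> (\<lambda>n. norm2 star E (u n - b)) \<longlonglongrightarrow> 0"

text \<open>
  The von Neumann subalgebra generated by \<open>S\<close> consists of the elements in the closure, with
  respect to \<^term>\<open>norm2 star E\<close>, of the unital *-algebra generated by \<open>S\<close>.
\<close>

definition vN_generated ::
  "(complex \<Rightarrow> 'a::real_normed_algebra_1 \<Rightarrow> 'a) \<Rightarrow> ('a \<Rightarrow> 'a) \<Rightarrow> ('a \<Rightarrow> complex) \<Rightarrow> 'a set \<Rightarrow> 'a set"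
  where
  "vN_generated scaleC star E S =
     {b. \<forall>e>0. \<exists>a \<in> module.span scaleC {prod_list w |w. set w \<subseteq> S \<union> star ` S}.
        norm2 star E (b - a) < e}"

definition is_cond_exp :: "('a::real_normed_algebra_1 \<Rightarrow> complex) \<Rightarrow> 'a set \<Rightarrow> 'a \<Rightarrow> 'a \<Rightarrow> bool" where
  "is_cond_exp E N a c \<longleftrightarrow> c \<in> N \<and> (\<forall>b\<in>N. E (c * b) = E (a * b))"

section \<open>The \<open>q\<close>-Brownian motion, its transition operators and generators\<close>

definition pair_partitions :: "nat \<Rightarrow> nat set set set" where
  "pair_partitions n = {\<pi>. partition_on {..<n} \<pi> \<and> (\<forall>B\<in>\<pi>. card B = 2)}"

definition crossings :: "nat set set \<Rightarrow> nat" where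
  "crossings \<pi> = card {(a, b, c, d). a < b \<and> b < c \<and> c < d \<and> {a, c} \<in> \<pi> \<and> {b, d} \<in> \<pi>}"

text \<open>For a block \<open>B = {i, j}\<close> the factor below is \<open>min (ts ! i) (ts ! j)\<close>.\<close>

definition joint_moment :: "real \<Rightarrow> real list \<Rightarrow> real" where
  "joint_moment q ts =
     (\<Sum>\<pi>\<in>pair_partitions (length ts). q ^ crossings \<pi> * (\<Prod>B\<in>\<pi>. Min ((\<lambda>i. ts ! i) ` B)))"

locale q_brownian_motion =
  tracial_von_neumann_algebra scaleC star E
  for scaleC :: "complex \<Rightarrow> 'a::{real_normed_algebra_1, banach} \<Rightarrow> 'a"
    and star :: "'a \<Rightarrow> 'a"
    and E :: "'a \<Rightarrow> complex" +
  fixes q :: real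
    and X :: "real \<Rightarrow> 'a"
  assumes X_selfadjoint: "t \<ge> 0 \<Longrightarrow> star (X t) = X t"
    and X_generates: "vN_generated scaleC star E (X ` {0..}) = UNIV"
    and X_moments: "set ts \<subseteq> {0..} \<Longrightarrow> E (prod_list (map X ts)) = of_real (joint_moment q ts)"

definition poly_at :: "real poly \<Rightarrow> 'a::real_algebra_1 \<Rightarrow> 'a" where
  "poly_at f a = (\<Sum>i\<le>degree f. coeff f i *\<^sub>R a ^ i)"

text \<open>
  The transition operator on polynomials: the polynomial \<open>g\<close> with \<open>E[f(X(t)) | \<le> s] = g(X(s))\<close>.
  It is unique for \<open>s > 0\<close> and \<open>-1 < q < 1\<close>, as the distribution of \<open>X(s)\<close> then has infinite support.
\<close>

definition transition ::
  "(complex \<Rightarrow> 'a::real_normed_algebra_1 \<Rightarrow> 'a) \<Rightarrow> ('a \<Rightarrow> 'a) \<Rightarrow> ('a \<Rightarrow> complex) \<Rightarrow> (real \<Rightarrow> 'a) \<Rightarrow>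
   real \<Rightarrow> real \<Rightarrow> real poly \<Rightarrow> real poly" where
  "transition scaleC star E X s t f =
     (THE g. is_cond_exp E (vN_generated scaleC star E (X ` {0..s})) (poly_at f (X t)) (poly_at g (X s)))"

definition radius :: "real \<Rightarrow> real \<Rightarrow> real" where
  "radius q t = 2 * sqrt t / sqrt (1 - q)"

text \<open>\<open>A\<^sub>t f = g\<close>, with the limit uniform on the support of the distribution of \<open>X(t)\<close>.\<close>

definition is_generator_value ::
  "(complex \<Rightarrow> 'a::real_normed_algebra_1 \<Rightarrow> 'a) \<Rightarrow> ('a \<Rightarrow> 'a) \<Rightarrow> ('a \<Rightarrow> complex) \<Rightarrow> real \<Rightarrow>
   (real \<Rightarrow> 'a) \<Rightarrow> real \<Rightarrow> real poly \<Rightarrow> (real \<Rightarrow> real) \<Rightarrow> bool" where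
  "is_generator_value scaleC star E q X t f g \<longleftrightarrow>
     uniform_limit {- radius q t .. radius q t}
       (\<lambda>h x. (poly (transition scaleC star E X t (t + h) f) x - poly f x) / h) g (at_right 0)"

section \<open>The operator \<open>\<Delta>\<^bsub>t;q\<^esub>\<close>\<close>

text \<open>The difference quotient, extended to the diagonal by continuity.\<close>

definition diff_quot :: "(real \<Rightarrow> real) \<Rightarrow> real \<Rightarrow> real \<Rightarrow> real" where
  "diff_quot f x y = (if x = y then deriv f x else (f x - f y) / (x - y))"

definition deriv_diff_quot :: "(real \<Rightarrow> real) \<Rightarrow> real \<Rightarrow> real \<Rightarrow> real" where
  "deriv_diff_quot f x y = deriv (\<lambda>z. diff_quot f z y) x"

definition q_number :: "real \<Rightarrow> nat \<Rightarrow> real" where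
  "q_number q n = (\<Sum>i<n. q ^ i)"

fun q_hermite :: "real \<Rightarrow> real \<Rightarrow> nat \<Rightarrow> real poly" where
  "q_hermite q t 0 = 1"
| "q_hermite q t (Suc 0) = [:0, 1:]"
| "q_hermite q t (Suc (Suc n)) =
     [:0, 1:] * q_hermite q t (Suc n) - smult (q_number q (Suc n) * t) (q_hermite q t n)"

text \<open>
  For each \<open>x\<close> in the support, the measure \<open>\<Gamma>\<^bsub>t;q\<^esub>(x, \<cdot>)\<close>.  Being concentrated on a compact
  interval, it is uniquely determined by the integrals of the polynomials, so that the choice
  operator does not leave any freedom.
\<close>

definition is_Gamma :: "real \<Rightarrow> real \<Rightarrow> real \<Rightarrow> real measure \<Rightarrow> bool" where
  "is_Gamma q t x \<mu> \<longleftrightarrow>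
     sets \<mu> = sets borel \<and>
     emeasure \<mu> (- {- radius q t .. radius q t}) = 0 \<and>
     (\<forall>n. integrable \<mu> (poly (q_hermite q t n)) \<and>
          (\<integral>y. poly (q_hermite q t n) y \<partial>\<mu>) = q ^ n * poly (q_hermite q t n) x)"

definition Gamma_kernel :: "real \<Rightarrow> real \<Rightarrow> real \<Rightarrow> real measure" where
  "Gamma_kernel q t x = (SOME \<mu>. is_Gamma q t x \<mu>)"

definition Delta_op :: "real \<Rightarrow> real \<Rightarrow> (real \<Rightarrow> real) \<Rightarrow> real \<Rightarrow> real" where
  "Delta_op q t f x = (\<integral>y. deriv_diff_quot f x y \<partial>Gamma_kernel q t x)"

section \<open>Explicit densities\<close>

definition qpoch_inf :: "'a::real_normed_field \<Rightarrow> 'a \<Rightarrow> 'a" where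
  "qpoch_inf a q = (\<Prod>i. 1 - a * q ^ i)"

text \<open>\<open>y = radius q t * cos \<theta>\<close> with \<open>\<theta> \<in> [0, \<pi>]\<close>.\<close>

definition angle :: "real \<Rightarrow> real \<Rightarrow> real \<Rightarrow> real" where
  "angle q t y = arccos (y / radius q t)"

text \<open>\<open>|(q e\<^bsup>i\<alpha>\<^esup>; q)\<^sub>\<infinity>|\<close>\<close>

definition abs_qpoch_cis :: "real \<Rightarrow> real \<Rightarrow> real" where
  "abs_qpoch_cis q \<alpha> = cmod (qpoch_inf (of_real q * cis \<alpha>) (of_real q))"

definition gamma_q :: "real \<Rightarrow> real \<Rightarrow> real measure" where
  "gamma_q q t = density lborel (\<lambda>y. ennreal
     (indicator {- radius q t .. radius q t} y *
      (sqrt (1 - q) / (pi * sqrt t) * sin (angle q t y) * qpoch_inf q q *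
       (abs_qpoch_cis q (2 * angle q t y))\<^sup>2)))"

definition semicircle :: "real \<Rightarrow> real measure" where
  "semicircle t = density lborel (\<lambda>u. ennreal
     (indicator {- 2 * sqrt t .. 2 * sqrt t} u * (sqrt (4 * t - u\<^sup>2) / (2 * pi * t))))"

text \<open>The measure \<open>d\<gamma>\<^sub>t(\<surd>(1 - q) y)\<close> in the variable \<open>y\<close>.\<close>

definition semicircle_scaled :: "real \<Rightarrow> real \<Rightarrow> real measure" where
  "semicircle_scaled q t = distr (semicircle t) borel (\<lambda>u. u / sqrt (1 - q))"

end

theory Submission imports Defs begin

text \<open>
  Both sides of the statement are linear in \<open>f\<close>, so everything is checked on the polynomials
  \<open>H\<^sub>n(\<cdot>, t)\<close>, and on those both sides turn out to equal \<open>- \<partial>H\<^sub>n/\<partial>t\<close>.  This polynomial,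
  \<open>e\<^sub>n\<close> say, is determined by the recurrence
  \<open>e\<^sub>n\<^sub>+\<^sub>1 = x e\<^sub>n - [n] t e\<^sub>n\<^sub>-\<^sub>1 + [n] H\<^sub>n\<^sub>-\<^sub>1\<close> obtained by differentiating that of \<open>H\<^sub>n\<close>.

  For the generator, read a pair partition from left to right: each point either opens a strand
  or closes one of the open strands, and closing a strand crosses the strands opened after it that
  are still open.  Hence the joint moments are the vacuum amplitudes \<open>fock_amplitude\<close> of a recursion
  on the list of open strands (\<open>joint_moment_eq_fock\<close>).  In this picture
  \<open>H\<^sub>n(X(u), u)\<close> prepares \<open>n\<close> open strands at time \<open>u\<close> (\<open>E_hermite_word\<close>).  Later points, if
  they lie at times up to \<open>s \<le> u\<close>, see a strand only through \<open>min u s'\<close> with \<open>s' \<le> s\<close>, so they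
  cannot distinguish strands at time \<open>u\<close> from strands at time \<open>s\<close>: this is the martingale property
  \<open>K\<^sub>s\<^sub>,\<^sub>u H\<^sub>n(\<cdot>, u) = H\<^sub>n(\<cdot>, s)\<close> (\<open>hermite_cond_exp\<close>, \<open>transition_hermite\<close>).  Consequently
  \<open>K\<^sub>t\<^sub>,\<^sub>t\<^sub>+\<^sub>h H\<^sub>n(\<cdot>, t) - H\<^sub>n(\<cdot>, t)\<close> is the image under \<open>K\<^sub>t\<^sub>,\<^sub>t\<^sub>+\<^sub>h\<close> of
  \<open>H\<^sub>n(\<cdot>, t) - H\<^sub>n(\<cdot>, t + h)\<close>; after division by \<open>h\<close> this tends to \<open>e\<^sub>n\<close>, because
  \<open>K\<^sub>t\<^sub>,\<^sub>t\<^sub>+\<^sub>h\<close> tends to the identity on polynomials of bounded degree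
  (\<open>coeff_lim_generator_hermite\<close>).

  For the operator \<open>\<Delta>\<close>, let \<open>\<mu>\<close> be any measure with \<open>\<integral>H\<^sub>n d\<mu> = q\<^sup>n H\<^sub>n(x)\<close>.  The three-term
  recurrence carries over to the difference quotients, giving first
  \<open>\<integral>\<partial>H\<^sub>n(x, y) d\<mu>(y) = [n] H\<^sub>n\<^sub>-\<^sub>1(x)\<close> and then, after differentiation in \<open>x\<close>, the recurrence of
  \<open>e\<^sub>n\<close> for \<open>\<integral>\<partial>\<^sub>x\<partial>H\<^sub>n(x, y) d\<mu>(y)\<close> (\<open>is_Gamma_integral_deriv_hermite\<close>).

  It remains to see that the two densities define a measure \<open>\<mu>\<close> of this kind.  In the
  angular variable, \<open>H\<^sub>n\<close> is a multiple of \<open>q_trig\<close>, a trigonometric polynomial.  The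
  density with respect to \<open>gamma_q\<close> is \<open>\<Sum>\<^sub>n q\<^sup>n h\<^sub>n(\<theta>) h\<^sub>n(\<phi>) / (q; q)\<^sub>n\<close>: both
  this sum and the infinite product obey the same first-order functional equation under \<open>\<rho> \<mapsto> q \<rho>\<close> (\<open>mehler_functional_equation\<close>,
  \<open>poisson_mehler\<close>).  The polynomials are orthogonal for the weight \<open>q_hermite_weight\<close>
  (\<open>q_trig_orthogonal\<close>), whose Fourier coefficients come from a finite form of the Jacobi triple product
  (\<open>coeff_jacobi_poly\<close>, \<open>integral_cos_even\<close>).  Integrating the series termwise
  gives \<open>is_Gamma_mehler_measure\<close>, and changes of variables give the two densities of the statement.
\<close>

section \<open>Moments as amplitudes on the q-Fock space\<close>

text \<open>
  The points of \<open>A\<close> are strands already opened, none of which may be joined to another one of them: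
  these are the pair partitions seen after the points of \<open>A\<close> have been read as openers.
\<close>

definition open_pairings :: "nat set \<Rightarrow> nat set \<Rightarrow> nat set set set" where
  "open_pairings A B = {\<pi>. partition_on (A \<union> B) \<pi> \<and> (\<forall>P\<in>\<pi>. card P = 2 \<and> \<not> P \<subseteq> A)}"

definition pairing_weight :: "real \<Rightarrow> (nat \<Rightarrow> real) \<Rightarrow> nat set set \<Rightarrow> real" where
  "pairing_weight q \<tau> \<pi> = q ^ crossings \<pi> * (\<Prod>P\<in>\<pi>. Min (\<tau> ` P))"

text \<open>
  The vacuum amplitude of a word of creation-plus-annihilation operators on the q-Fock space.  The
  first list holds the times of the open strands, the most recently opened one first, so that closing the
  strand at position \<open>j\<close> crosses exactly \<open>j\<close> other strands; the second list is the word still to be read.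
\<close>

fun fock_amplitude :: "real \<Rightarrow> real list \<Rightarrow> real list \<Rightarrow> real" where
  "fock_amplitude q [] [] = 1"
| "fock_amplitude q (a # as) [] = 0"
| "fock_amplitude q as (b # bs) = fock_amplitude q (b # as) bs +
     (\<Sum>j<length as. q ^ j * min (as ! j) b * fock_amplitude q (take j as @ drop (Suc j) as) bs)"

lemma fock_step: "fock_amplitude q as (b # bs) = fock_amplitude q (b # as) bs +
     (\<Sum>j<length as. q ^ j * min (as ! j) b * fock_amplitude q (take j as @ drop (Suc j) as) bs)"
  by (cases as) simp_all

lemma finite_open_pairings:
  assumes "finite A" "finite B" shows "finite (open_pairings A B)"
proof -
  have "open_pairings A B \<subseteq> Pow (Pow (A \<union> B))"
    by (auto simp: open_pairings_def partition_on_def)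
  then show ?thesis using assms by (meson finite_Pow_iff finite_UnI finite_subset)
qed

lemma open_pairings_empty_right:
  "open_pairings A {} = (if A = {} then {{}} else {})"
  by (auto simp: open_pairings_def partition_on_def)

lemma pair_partitions_open_pairings: "pair_partitions n = open_pairings {} {..<n}"
  by (auto simp: open_pairings_def pair_partitions_def)

text \<open>
  The disjointness of the new block from the others, on which \<open>partition_on_insert\<close> relies, follows
  from either side of the equivalence.
\<close>

lemma partition_on_insert_pair:
  assumes "a \<notin> S" "b \<notin> S" "{a, b} \<notin> \<pi>"
  shows "partition_on (insert a (insert b S)) (insert {a, b} \<pi>) \<longleftrightarrow> partition_on S \<pi>"
proof
  assume p: "partition_on (insert a (insert b S)) (insert {a, b} \<pi>)"
  then have "disjnt {a, b} (\<Union>\<pi>)"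
    using assms(3) unfolding partition_on_def pairwise_insert by (simp add: disjnt_Union2) metis
  then have "partition_on (insert a (insert b S) - {a, b}) \<pi>" using p partition_on_insert by blast
  moreover have "insert a (insert b S) - {a, b} = S" using assms by blast
  ultimately show "partition_on S \<pi>" by simp
next
  assume p: "partition_on S \<pi>"
  then have "\<Union>\<pi> = S" by (simp add: partition_on_def)
  then have "disjnt {a, b} (\<Union>\<pi>)" using assms by (simp add: disjnt_def)
  moreover have "insert a (insert b S) - {a, b} = S" using assms by blast
  ultimately show "partition_on (insert a (insert b S)) (insert {a, b} \<pi>)"
    using p by (subst partition_on_insert) auto
qed

text \<open>
  The first unread point \<open>b\<close> is joined either to a later point, so that it becomes an open strand,
  or to one of the open strands \<open>a\<close>.
\<close>

lemma open_pairings_step: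
  assumes AB: "\<And>x y. x \<in> A \<Longrightarrow> y \<in> insert b B \<Longrightarrow> x < y" and b: "\<And>y. y \<in> B \<Longrightarrow> b < y"
  shows "open_pairings A (insert b B) =
    open_pairings (insert b A) B \<union> (\<Union>a\<in>A. insert {a, b} ` open_pairings (A - {a}) B)" (is "?L = ?R")
proof (intro equalityI subsetI)
  fix \<pi> assume p: "\<pi> \<in> ?L"
  then have part: "partition_on (A \<union> insert b B) \<pi>" and c: "\<And>P. P \<in> \<pi> \<Longrightarrow> card P = 2 \<and> \<not> P \<subseteq> A"
    by (auto simp: open_pairings_def)
  show "\<pi> \<in> ?R"
  proof (cases "\<exists>a\<in>A. {a, b} \<in> \<pi>")
    case True
    then obtain a where a: "a \<in> A" "{a, b} \<in> \<pi>" by blast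
    \<comment> \<open>Here \<open>b\<close> closes the strand \<open>a\<close>.\<close>
    let ?p = "\<pi> - {{a, b}}"
    have S: "A \<union> insert b B = insert a (insert b ((A - {a}) \<union> B))" using a by auto
    have n: "a \<notin> (A - {a}) \<union> B" "b \<notin> (A - {a}) \<union> B" using AB[of a b] AB b a by fastforce+
    have "partition_on ((A - {a}) \<union> B) ?p"
      using partition_on_insert_pair[OF n, of ?p] part a S by (simp add: insert_absorb)
    then have "?p \<in> open_pairings (A - {a}) B" using c by (auto simp: open_pairings_def)
    moreover have "\<pi> = insert {a, b} ?p" using a by auto
    ultimately show ?thesis using a(1) by blast
  next
    case False
    have "\<not> P \<subseteq> insert b A" if P: "P \<in> \<pi>" for P
    proof
      assume s: "P \<subseteq> insert b A"
      obtain x y where xy: "P = {x, y}" "x \<noteq> y" using c[OF P] by (meson card_2_iff)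
      have "x = b \<or> y = b" using c[OF P] s xy by auto
      then show False using xy s False P by (auto simp: insert_commute)
    qed
    then show ?thesis using part c by (auto simp: open_pairings_def Un_insert_right)
  qed
next
  fix \<pi> assume "\<pi> \<in> ?R"
  then consider "\<pi> \<in> open_pairings (insert b A) B"
    | a \<pi>' where "a \<in> A" "\<pi>' \<in> open_pairings (A - {a}) B" "\<pi> = insert {a, b} \<pi>'" by blast
  then show "\<pi> \<in> ?L"
  proof cases
    case 1
    then show ?thesis by (auto simp: open_pairings_def Un_insert_right)
  next
    case (2 a \<pi>')
    have S: "A \<union> insert b B = insert a (insert b ((A - {a}) \<union> B))" using 2 by auto
    have n: "a \<notin> (A - {a}) \<union> B" "b \<notin> (A - {a}) \<union> B" using AB[of a b] AB b 2 by fastforce+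
    have p: "partition_on ((A - {a}) \<union> B) \<pi>'" and c: "\<And>P. P \<in> \<pi>' \<Longrightarrow> card P = 2 \<and> \<not> P \<subseteq> A - {a}"
      using 2 by (auto simp: open_pairings_def)
    have m: "{a, b} \<notin> \<pi>'" using p n by (auto simp: partition_on_def)
    have "partition_on (A \<union> insert b B) \<pi>"
      using partition_on_insert_pair[OF n m] p S 2(3) by simp
    moreover have "card P = 2 \<and> \<not> P \<subseteq> A" if "P \<in> \<pi>" for P
    proof (cases "P = {a, b}")
      case True
      have "a < b" using AB 2(1) by auto
      then show ?thesis using True AB[of b b] by auto
    next
      case False
      then have P: "P \<in> \<pi>'" using that 2 by auto
      then have "P \<subseteq> (A - {a}) \<union> B" using p by (auto simp: partition_on_def)
      then show ?thesis using c[OF P] n by blast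
    qed
    ultimately show ?thesis by (auto simp: open_pairings_def)
  qed
qed

lemma open_pairing_lower_unique:
  assumes "\<pi> \<in> open_pairings A B" "{x, y} \<in> \<pi>" "{x, z} \<in> \<pi>"
  shows "y = z"
proof -
  have "disjoint \<pi>" using assms(1) by (simp add: open_pairings_def partition_on_def)
  then have "{x, y} = {x, z}"
    using disjointD[of \<pi> "{x, y}" "{x, z}"] assms(2,3) by blast
  then show ?thesis by (auto simp: doubleton_eq_iff)
qed

lemma finite_crossing_set:
  assumes "\<pi> \<in> open_pairings A B" "finite A" "finite B"
  shows "finite {(a, b, c, d). a < b \<and> b < c \<and> c < d \<and> {a, c} \<in> \<pi> \<and> {b, d} \<in> \<pi>}"
proof (rule finite_subset)
  have "P \<subseteq> A \<union> B" if "P \<in> \<pi>" for P using that assms by (auto simp: open_pairings_def partition_on_def)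
  then show "{(a, b, c, d). a < b \<and> b < c \<and> c < d \<and> {a, c} \<in> \<pi> \<and> {b, d} \<in> \<pi>} \<subseteq>
     (A \<union> B) \<times> (A \<union> B) \<times> (A \<union> B) \<times> (A \<union> B)" by fastforce
qed (use assms in auto)

text \<open>
  Every strand opened after \<open>a\<close> ends beyond \<open>b\<close>, since open strands are not joined to each other,
  and so it crosses the pair \<open>{a, b}\<close> exactly once; no other pair crosses it.
\<close>

lemma crossings_insert_pair:
  assumes fin: "finite A" "finite B"
    and AB: "\<And>x y. x \<in> A \<Longrightarrow> y \<in> insert b B \<Longrightarrow> x < y" and b: "\<And>y. y \<in> B \<Longrightarrow> b < y"
    and a: "a \<in> A" and p: "\<pi> \<in> open_pairings (A - {a}) B"
  shows "crossings (insert {a, b} \<pi>) = card {x\<in>A. a < x} + crossings \<pi>"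
proof -
  let ?C = "\<lambda>\<pi>. {(a, b, c, d). a < b \<and> b < c \<and> c < d \<and> {a, c} \<in> \<pi> \<and> {b, d} \<in> \<pi>} :: (nat\<times>nat\<times>nat\<times>nat) set"
  \<comment> \<open>The new crossings: those in which the pair opened first is \<open>{a, b}\<close>.\<close>
  let ?N = "{(a', y, b', w). a' = a \<and> b' = b \<and> a < y \<and> y < b \<and> b < w \<and> {y, w} \<in> \<pi>}"
  have part: "partition_on ((A - {a}) \<union> B) \<pi>" and c: "\<And>P. P \<in> \<pi> \<Longrightarrow> card P = 2 \<and> \<not> P \<subseteq> A - {a}"
    using p by (auto simp: open_pairings_def)
  have ab: "a < b" using AB a by auto
  have mem: "x \<in> (A - {a}) \<union> B" if "{x, y} \<in> \<pi>" for x y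
    using that part by (auto simp: partition_on_def)
  have lt: "x \<in> A - {a}" if "{x, y} \<in> \<pi>" "x < b" for x y
    using mem[OF that(1)] that(2) b by fastforce
  have na: "x \<noteq> a \<and> x \<noteq> b" if "{x, y} \<in> \<pi>" for x y
    using mem[OF that] AB[of b b] AB[of a a] a b[of b] by auto
  have na': "y \<noteq> a \<and> y \<noteq> b" if "{x, y} \<in> \<pi>" for x y
    using na[of y x] that by (simp add: insert_commute)
  have no: "\<not> (x < b \<and> y < b)" if "{x, y} \<in> \<pi>" for x y
    using lt[OF that] lt[of y x] c[OF that] that by (auto simp: insert_commute)
  have split: "?C (insert {a, b} \<pi>) = ?C \<pi> \<union> ?N"
  proof (intro equalityI subsetI)
    fix z assume "z \<in> ?C (insert {a, b} \<pi>)"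
    then obtain x y u w where z: "z = (x, y, u, w)" "x < y" "y < u" "u < w"
      "{x, u} \<in> insert {a, b} \<pi>" "{y, w} \<in> insert {a, b} \<pi>" by auto
    show "z \<in> ?C \<pi> \<union> ?N"
    proof (cases "{x, u} = {a, b}")
      case True
      then have "x = a" "u = b" using z ab by (auto simp: doubleton_eq_iff)
      then show ?thesis using z by (auto simp: doubleton_eq_iff)
    next
      case F: False
      then have xu: "{x, u} \<in> \<pi>" using z by auto
      show ?thesis
      proof (cases "{y, w} = {a, b}")
        case True
        then have "y = a" "w = b" using z ab by (auto simp: doubleton_eq_iff)
        then show ?thesis using no[OF xu] z by auto
      next
        case False
        then show ?thesis using F z by auto
      qed
    qed
  qed (use ab in auto)
  have disj: "?C \<pi> \<inter> ?N = {}" using na by auto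
  have N: "card ?N = card {x\<in>A. a < x}"
  proof (rule bij_betw_same_card[of "\<lambda>(a', y, b', w). y"])
    have "inj_on (\<lambda>(a', y, b', w). y) ?N"
      using open_pairing_lower_unique[OF p] by (auto simp: inj_on_def)
    moreover have "y \<in> (\<lambda>(a', y, b', w). y) ` ?N" if y: "y \<in> A" "a < y" for y
    proof -
      have "y \<in> \<Union>\<pi>" using part y by (auto simp: partition_on_def)
      then obtain P where P: "P \<in> \<pi>" "y \<in> P" by auto
      obtain w where w: "P = {y, w}" using c[OF P(1)] P(2) by (auto simp: card_2_iff insert_commute)
      have yb: "y < b" using AB y by auto
      have "b < w" using no[of y w] na'[of y w] P w yb by auto
      then have "(a, y, b, w) \<in> ?N" using y yb P w by auto
      then show ?thesis by force
    qed
    moreover have "(\<lambda>(a', y, b', w). y) ` ?N \<subseteq> {x\<in>A. a < x}" using lt by auto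
    ultimately show "bij_betw (\<lambda>(a', y, b', w). y) ?N {x\<in>A. a < x}"
      by (auto simp: bij_betw_def)
  qed
  have f: "finite (?C \<pi>)" using finite_crossing_set[OF p] fin by simp
  have fN: "finite ?N"
  proof (rule finite_subset)
    show "?N \<subseteq> {a} \<times> (A \<union> B) \<times> {b} \<times> (A \<union> B)" using mem by (fastforce simp: insert_commute)
  qed (use fin in auto)
  have "crossings (insert {a, b} \<pi>) = card (?C \<pi> \<union> ?N)" unfolding crossings_def split ..
  also have "\<dots> = card (?C \<pi>) + card ?N" by (rule card_Un_disjoint[OF f fN disj])
  finally show ?thesis unfolding N crossings_def by simp
qed

lemma sum_open_pairings_step:
  assumes fin: "finite A" "finite B"
    and AB: "\<And>x y. x \<in> A \<Longrightarrow> y \<in> insert b B \<Longrightarrow> x < y" and b: "\<And>y. y \<in> B \<Longrightarrow> b < y"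
  shows "sum (pairing_weight q \<tau>) (open_pairings A (insert b B)) =
    sum (pairing_weight q \<tau>) (open_pairings (insert b A) B) +
    (\<Sum>a\<in>A. q ^ card {x\<in>A. a < x} * min (\<tau> a) (\<tau> b) * sum (pairing_weight q \<tau>) (open_pairings (A - {a}) B))"
proof -
  let ?U = "\<lambda>a. insert {a, b} ` open_pairings (A - {a}) B"
  have bA: "b \<notin> A" using AB[of b b] by auto
  have bB: "b \<notin> B" using b[of b] by auto
  have ninP: "{a, b} \<notin> \<pi>" if "\<pi> \<in> open_pairings (A - {a}) B" for a \<pi>
    using that bA bB by (auto simp: open_pairings_def partition_on_def)
  have ninP2: "\<pi> \<in> open_pairings (A - {a}) B \<Longrightarrow> {a', b} \<notin> \<pi>" for a a' \<pi>
    using bA bB by (auto simp: open_pairings_def partition_on_def)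
  have "\<not> (\<exists>a\<in>A. {a, b} \<in> \<pi>)" if "\<pi> \<in> open_pairings (insert b A) B" for \<pi>
    using that by (auto simp: open_pairings_def)
  then have d1: "open_pairings (insert b A) B \<inter> (\<Union>a\<in>A. ?U a) = {}"
    by blast
  have d2: "?U a \<inter> ?U a' = {}" if "a \<noteq> a'" for a a'
  proof (rule ccontr)
    assume "?U a \<inter> ?U a' \<noteq> {}"
    then obtain \<pi> \<pi>' where e: "\<pi> \<in> open_pairings (A - {a}) B" "\<pi>' \<in> open_pairings (A - {a'}) B"
      "insert {a, b} \<pi> = insert {a', b} \<pi>'" by auto
    then have "{a, b} \<in> insert {a', b} \<pi>'" by blast
    with ninP2[OF e(2), of a] that show False by (auto simp: doubleton_eq_iff)
  qed
  have inj: "inj_on (insert {a, b}) (open_pairings (A - {a}) B)" for a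
    using ninP by (intro inj_onI) (metis insert_ident)
  have w: "pairing_weight q \<tau> (insert {a, b} \<pi>) =
      q ^ card {x\<in>A. a < x} * min (\<tau> a) (\<tau> b) * pairing_weight q \<tau> \<pi>"
    if "a \<in> A" "\<pi> \<in> open_pairings (A - {a}) B" for a \<pi>
  proof -
    have "finite \<pi>" using that fin finite_elements[of "(A - {a}) \<union> B" \<pi>]
      by (simp add: open_pairings_def)
    then show ?thesis
      using crossings_insert_pair[OF fin AB b that] ninP[OF that(2)]
      by (simp add: pairing_weight_def power_add)
  qed
  have step: "open_pairings A (insert b B) = open_pairings (insert b A) B \<union> (\<Union>a\<in>A. ?U a)"
    by (rule open_pairings_step) (use AB b in auto)
  have f: "finite (open_pairings (A - {a}) B)" for a using fin by (simp add: finite_open_pairings)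
  have "sum (pairing_weight q \<tau>) (open_pairings A (insert b B)) =
    sum (pairing_weight q \<tau>) (open_pairings (insert b A) B) + sum (pairing_weight q \<tau>) (\<Union>a\<in>A. ?U a)"
    unfolding step
    by (rule sum.union_disjoint) (use fin f d1 finite_open_pairings in auto)
  also have "sum (pairing_weight q \<tau>) (\<Union>a\<in>A. ?U a) = (\<Sum>a\<in>A. sum (pairing_weight q \<tau>) (?U a))"
    by (rule sum.UNION_disjoint) (use fin f d2 in auto)
  also have "\<dots> = (\<Sum>a\<in>A. q ^ card {x\<in>A. a < x} * min (\<tau> a) (\<tau> b) *
      sum (pairing_weight q \<tau>) (open_pairings (A - {a}) B))"
    by (intro sum.cong refl) (simp add: sum.reindex[OF inj] w sum_distrib_left)
  finally show ?thesis .
qed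

text \<open>
  Open strands are listed in decreasing order, so that the index of a strand in the list is the
  number of strands opened after it.
\<close>

lemma sum_open_pairings_eq_fock:
  assumes "sorted_wrt (>) as" "sorted_wrt (<) bs" "\<And>x y. x \<in> set as \<Longrightarrow> y \<in> set bs \<Longrightarrow> x < y"
  shows "sum (pairing_weight q \<tau>) (open_pairings (set as) (set bs)) = fock_amplitude q (map \<tau> as) (map \<tau> bs)"
  using assms
proof (induction bs arbitrary: as)
  case Nil
  show ?case
    by (cases as) (auto simp: open_pairings_empty_right pairing_weight_def crossings_def
        case_prod_unfold)
next
  case (Cons b bs)
  let ?f = "\<lambda>j. take j as @ drop (Suc j) as"
  have dist: "distinct as" using Cons.prems(1)
    by (metis distinct_rev sorted_wrt_rev strict_sorted_iff)
  have idx: "(i < j) = (as ! j < as ! i)" if "i < length as" "j < length as" for i j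
    using that Cons.prems(1) dist
    by (metis linorder_neqE_nat not_less_iff_gr_or_eq sorted_wrt_nth_less)
  have setf: "set (?f j) = set as - {as ! j}" if "j < length as" for j
  proof -
    have "as = take j as @ as ! j # drop (Suc j) as" using that by (rule id_take_nth_drop)
    then show ?thesis using dist
      by (metis (no_types, lifting) Diff_insert_absorb Un_insert_right distinct.simps(2) distinct_append
          disjoint_insert(1) insert_iff list.simps(15) set_append Un_iff)
  qed
  have sf: "sorted_wrt (>) (?f j)" for j
  proof (cases "j < length as")
    case True
    have "as = take j as @ as ! j # drop (Suc j) as" using True by (rule id_take_nth_drop)
    then show ?thesis using Cons.prems(1)
      by (metis (no_types, lifting) sorted_wrt.simps(2) sorted_wrt_append list.set_intros(2))
  qed (use Cons.prems(1) in simp)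
  have cj: "card {x \<in> set as. as ! j < x} = j" if "j < length as" for j
  proof -
    have "{x \<in> set as. as ! j < x} = (!) as ` {i. i < length as \<and> as ! j < as ! i}"
      by (auto simp: in_set_conv_nth)
    also have "{i. i < length as \<and> as ! j < as ! i} = {..<j}"
    proof (intro equalityI subsetI)
      fix i assume "i \<in> {..<j}"
      then have "i < length as" "i < j" using that by auto
      then show "i \<in> {i. i < length as \<and> as ! j < as ! i}" using idx[OF _ that, of i] by blast
    qed (use idx[OF _ that] in blast)
    finally have "{x \<in> set as. as ! j < x} = (!) as ` {..<j}" .
    moreover have "inj_on ((!) as) {..<j}" using dist that by (auto simp: inj_on_def nth_eq_iff_index_eq)
    ultimately show ?thesis by (simp add: card_image)
  qed
  have 1: "sum (pairing_weight q \<tau>) (open_pairings (insert b (set as)) (set bs)) =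
      fock_amplitude q (map \<tau> (b # as)) (map \<tau> bs)"
    using Cons.IH[of "b # as"] Cons.prems by fastforce
  have 2: "sum (pairing_weight q \<tau>) (open_pairings (set as - {as ! j}) (set bs)) =
      fock_amplitude q (map \<tau> (?f j)) (map \<tau> bs)" if "j < length as" for j
  proof -
    have "sum (pairing_weight q \<tau>) (open_pairings (set (?f j)) (set bs)) = fock_amplitude q (map \<tau> (?f j)) (map \<tau> bs)"
      using Cons.prems setf[OF that] by (intro Cons.IH sf) auto
    then show ?thesis unfolding setf[OF that] .
  qed
  have "(\<Sum>a\<in>set as. q ^ card {x\<in>set as. a < x} * min (\<tau> a) (\<tau> b) *
      sum (pairing_weight q \<tau>) (open_pairings (set as - {a}) (set bs))) =
    (\<Sum>j<length as. q ^ j * min (\<tau> (as ! j)) (\<tau> b) * fock_amplitude q (map \<tau> (?f j)) (map \<tau> bs))"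
  proof -
    have "bij_betw ((!) as) {..<length as} (set as)" using dist by (simp add: bij_betw_nth)
    then show ?thesis
      by (subst sum.reindex_bij_betw[symmetric]) (auto simp: cj 2 intro!: sum.cong)
  qed
  moreover have "sum (pairing_weight q \<tau>) (open_pairings (set as) (set (b # bs))) =
    sum (pairing_weight q \<tau>) (open_pairings (insert b (set as)) (set bs)) +
    (\<Sum>a\<in>set as. q ^ card {x\<in>set as. a < x} * min (\<tau> a) (\<tau> b) *
      sum (pairing_weight q \<tau>) (open_pairings (set as - {a}) (set bs)))"
    unfolding list.set using Cons.prems by (intro sum_open_pairings_step) auto
  ultimately show ?case
    unfolding 1 by (simp add: fock_step take_map drop_map)
qed

theorem joint_moment_eq_fock: "joint_moment q ts = fock_amplitude q [] ts"
proof -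
  have "joint_moment q ts = sum (pairing_weight q ((!) ts)) (open_pairings (set []) (set [0..<length ts]))"
    by (simp add: joint_moment_def pairing_weight_def pair_partitions_open_pairings atLeast0LessThan)
  also have "\<dots> = fock_amplitude q (map ((!) ts) []) (map ((!) ts) [0..<length ts])"
    by (rule sum_open_pairings_eq_fock) auto
  also have "\<dots> = fock_amplitude q [] ts" by (simp add: map_nth)
  finally show ?thesis .
qed

text \<open>
  The times of open strands enter only through their minima with the times of the word; this is the
  combinatorial source of the martingale property.
\<close>

lemma fock_cong:
  assumes "list_all2 (\<lambda>a b. \<forall>s\<in>set ts. min a s = min b s) as bs"
  shows "fock_amplitude q as ts = fock_amplitude q bs ts"
  using assms
proof (induction ts arbitrary: as bs)
  case Nil
  then show ?case by (cases as; cases bs) auto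
next
  case (Cons t ts)
  have len: "length as = length bs" using Cons.prems by (rule list_all2_lengthD)
  have w: "list_all2 (\<lambda>a b. \<forall>s\<in>set ts. min a s = min b s) as bs"
    using Cons.prems by (rule list_all2_mono) auto
  have "fock_amplitude q (t # as) ts = fock_amplitude q (t # bs) ts" using w by (intro Cons.IH) auto
  moreover have "min (as ! j) t = min (bs ! j) t" if "j < length as" for j
    using list_all2_nthD[OF Cons.prems that] by simp
  moreover have "fock_amplitude q (take j as @ drop (Suc j) as) ts = fock_amplitude q (take j bs @ drop (Suc j) bs) ts" for j
    using w by (intro Cons.IH list_all2_appendI list_all2_takeI list_all2_dropI)
  ultimately show ?case using len by (cases as; cases bs) simp_all
qed

text \<open>
  For equal strands the powers of \<open>q\<close> add up to a q-number.
\<close>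

lemma fock_replicate_step:
  "fock_amplitude q (replicate n u) (b # ts) = fock_amplitude q (b # replicate n u) ts +
     q_number q n * min u b * fock_amplitude q (replicate (n - 1) u) ts"
proof -
  have "take j (replicate n u) @ drop (Suc j) (replicate n u) = replicate (n - 1) u" if "j < n" for j
    using that by (simp add: replicate_add[symmetric])
  then show ?thesis
    by (simp add: fock_step q_number_def sum_distrib_right mult.assoc)
qed

text \<open>
  Each letter of the word closes at most one strand.
\<close>

lemma fock_eq_0: "length ts < length as \<Longrightarrow> fock_amplitude q as ts = 0"
proof (induction ts arbitrary: as)
  case Nil
  then show ?case by (cases as) auto
next
  case (Cons t ts)
  then show ?case by (auto simp: fock_step intro!: sum.neutral)
qed

lemma q_number_pos:
  assumes "-1 < q" "q < 1" "n > 0" shows "q_number q n > 0"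
proof -
  have "q_number q n = (1 - q ^ n) / (1 - q)" using assms by (simp add: q_number_def sum_gp_strict)
  moreover have "\<bar>q ^ n\<bar> < 1" using assms by (simp add: power_abs power_less_one_iff abs_less_iff)
  ultimately show ?thesis using assms by simp
qed

lemma q_number_0 [simp]: "q_number q 0 = 0" by (simp add: q_number_def)

lemma q_number_Suc: "q_number q (Suc n) = q_number q n + q ^ n" by (simp add: q_number_def)

text \<open>
  This is the squared norm \<open>[n]! u\<^sup>n\<close> of \<open>H\<^sub>n(X(u), u)\<close>; its positivity makes the powers of
  \<open>X(u)\<close> linearly independent.
\<close>

lemma fock_replicate_diag_pos:
  assumes "-1 < q" "q < 1" "u > 0"
  shows "fock_amplitude q (replicate n u) (replicate n u) > 0"
proof (induction n)
  case (Suc n)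
  have "fock_amplitude q (replicate (Suc n) u) (replicate (Suc n) u) =
     q_number q (Suc n) * u * fock_amplitude q (replicate n u) (replicate n u)"
    using fock_replicate_step[of q "Suc n" u u "replicate n u"]
    by (simp add: fock_eq_0)
  then show ?case using Suc q_number_pos[OF assms(1,2), of "Suc n"] assms by simp
qed simp

section \<open>Polynomials in an operator and the q-Hermite basis\<close>

lemma poly_at_pCons: "poly_at (pCons c f) a = c *\<^sub>R 1 + a * poly_at f a"
proof (cases "f = 0")
  case False
  then show ?thesis
    by (simp add: poly_at_def sum.atMost_Suc_shift sum_distrib_left del: sum.atMost_Suc)
qed (simp add: poly_at_def)

lemma poly_at_0 [simp]: "poly_at 0 a = 0" by (simp add: poly_at_def)

lemma poly_at_1 [simp]: "poly_at 1 a = 1" by (simp add: poly_at_def)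

lemma poly_at_add: "poly_at (f + g) a = poly_at f a + poly_at g a"
  by (induction f g rule: poly_induct2) (simp_all add: poly_at_pCons algebra_simps)

lemma poly_at_smult: "poly_at (smult c f) a = c *\<^sub>R poly_at f a"
  by (induction f) (simp_all add: poly_at_pCons algebra_simps)

lemma poly_at_diff: "poly_at (f - g) a = poly_at f a - poly_at g a"
  using poly_at_add[of "f - g" g a] by simp

lemma poly_at_commute: "poly_at f a * a = a * poly_at f a"
  by (induction f) (simp_all add: poly_at_pCons algebra_simps)

lemma degree_q_hermite [simp]: "degree (q_hermite q t n) = n"
  and lead_coeff_q_hermite: "coeff (q_hermite q t n) n = 1"
proof -
  have "degree (q_hermite q t n) = n \<and> coeff (q_hermite q t n) n = 1"
  proof (induction n rule: induct_nat_012)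
    case (ge2 n)
    let ?a = "pCons 0 (q_hermite q t (Suc n))" and ?b = "smult (q_number q (Suc n) * t) (q_hermite q t n)"
    have b: "degree ?b \<le> n" using ge2 degree_smult_le[of "q_number q (Suc n) * t" "q_hermite q t n"] by simp
    have a: "degree ?a = Suc (Suc n)" using ge2 by (subst degree_pCons_eq) auto
    have "degree (?a - ?b) = Suc (Suc n)"
      using a b degree_add_eq_left[of "- ?b" ?a] by simp
    moreover have "coeff (?a - ?b) (Suc (Suc n)) = 1"
      using ge2 b by (simp add: coeff_pCons coeff_eq_0)
    ultimately show ?case by simp
  qed simp_all
  then show "degree (q_hermite q t n) = n" "coeff (q_hermite q t n) n = 1" by auto
qed

lemma q_hermite_expansion:
  assumes "degree f \<le> n"
  obtains c where "f = (\<Sum>k\<le>n. smult (c k) (q_hermite q t k))"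
    "c n = coeff f n"
  using assms
proof (induction n arbitrary: f thesis)
  case 0
  then have "degree f = 0" by simp
  then obtain a where "f = [:a:]" by (rule degree_eq_zeroE)
  then show ?case by (intro 0(1)[of "\<lambda>_. a"]) simp_all
next
  case (Suc n)
  let ?g = "f - smult (coeff f (Suc n)) (q_hermite q t (Suc n))"
  have "degree ?g \<le> Suc n" using Suc.prems by (intro degree_diff_le) (simp_all add: degree_smult_le[THEN order_trans])
  moreover have "coeff ?g (Suc n) = 0" using lead_coeff_q_hermite[of q t "Suc n"] by simp
  ultimately have "degree ?g \<le> n"
    by (metis coeff_0 degree_0 leI le_Suc_eq leading_coeff_0_iff zero_le)
  then obtain c where c: "?g = (\<Sum>k\<le>n. smult (c k) (q_hermite q t k))" using Suc.IH by metis
  let ?c = "c(Suc n := coeff f (Suc n))"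
  have "(\<Sum>k\<le>Suc n. smult (?c k) (q_hermite q t k)) = ?g + smult (coeff f (Suc n)) (q_hermite q t (Suc n))"
    unfolding c by simp
  then show ?case using Suc.prems(1)[of ?c] by simp
qed

section \<open>Conditional expectations in the tracial algebra\<close>

context tracial_von_neumann_algebra
begin

lemma E_diff: "E (a - b) = E a - E b"
  using E_add[of "a - b" b] by simp

lemma E_0 [simp]: "E 0 = 0" using E_add[of 0 0] by simp

lemma E_scaleR: "E (r *\<^sub>R a) = of_real r * E a"
  by (metis E_scale scale_of_real)

lemma E_nonneg: "E (star a * a) = of_real ((norm2 star E a)\<^sup>2)"
  using E_positive[of a] by (simp add: norm2_def complex_eq_iff)

text \<open>
  Polarization: \<open>E (v\<^sup>* v)\<close> is real for \<open>v = a + b\<close> and for \<open>v = a + \<i> b\<close>.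
\<close>

lemma E_star_swap: "E (star b * a) = cnj (E (star a * b))"
proof -
  have "Im (E (star (a + b) * (a + b))) = 0" using E_positive by blast
  then have 1: "Im (E (star a * b)) + Im (E (star b * a)) = 0"
    using E_positive[of a] E_positive[of b] by (simp add: star_add E_add algebra_simps)
  have "Im (E (star (a + scaleC \<i> b) * (a + scaleC \<i> b))) = 0" using E_positive by blast
  then have 2: "Re (E (star a * b)) - Re (E (star b * a)) = 0"
    using E_positive[of a] E_positive[of b]
    by (simp add: star_add E_add E_diff E_scale star_scale scale_mult_left scale_mult_right algebra_simps)
  show ?thesis using 1 2 by (simp add: complex_eq_iff)
qed

text \<open>
  The Cauchy--Schwarz inequality in additive form, with a free weight \<open>r\<close>: it follows from
  \<open>E (v\<^sup>* v) \<ge> 0\<close> for \<open>v = \<surd>r a + \<beta> b\<close>, the phase of \<open>\<beta>\<close> being chosen such that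
  \<open>\<beta> E (a\<^sup>* b)\<close> is negative.
\<close>

lemma E_star_mult_bound:
  assumes "r > 0"
  shows "2 * cmod (E (star a * b)) \<le> (norm2 star E a)\<^sup>2 * r + (norm2 star E b)\<^sup>2 / r"
proof -
  define z where "z = E (star a * b)"
  define \<beta> where "\<beta> = - cnj (sgn z) / of_real (sqrt r)"
  let ?v = "scaleC (of_real (sqrt r)) a + scaleC \<beta> b"
  have z: "E (star b * a) = cnj z" unfolding z_def by (rule E_star_swap)
  have "cnj z * z = z * cnj z" by (rule mult.commute)
  also have "\<dots> = of_real ((cmod z)\<^sup>2)" by (rule complex_norm_square[symmetric])
  finally have sz: "cnj (sgn z) * z = of_real (cmod z)"
    by (simp add: sgn_eq power2_eq_square)
  have \<beta>z: "of_real (sqrt r) * (\<beta> * z) = - of_real (cmod z)"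
    using assms sz by (simp add: \<beta>_def)
  have \<beta>z': "cnj \<beta> * (of_real (sqrt r) * cnj z) = - of_real (cmod z)"
    using arg_cong[OF \<beta>z, of cnj] by (simp add: algebra_simps)
  have sq: "complex_of_real (sqrt r) * of_real (sqrt r) = of_real r"
    using assms by (simp flip: of_real_mult)
  have nb: "cmod \<beta> \<le> 1 / sqrt r" using assms by (simp add: \<beta>_def norm_divide norm_sgn)
  have "0 \<le> Re (E (star ?v * ?v))" using E_positive by blast
  also have "E (star ?v * ?v) = of_real (sqrt r) * of_real (sqrt r) * E (star a * a) + of_real (sqrt r) * (\<beta> * z)
     + cnj \<beta> * (of_real (sqrt r) * cnj z) + (\<beta> * cnj \<beta>) * E (star b * b)"
    unfolding z_def by (simp add: star_add E_add E_scale star_scale scale_mult_left scale_mult_right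
        distrib_left distrib_right E_star_swap[of b a])
  also have "\<dots> = of_real (r * (norm2 star E a)\<^sup>2 - 2 * cmod z + (cmod \<beta>)\<^sup>2 * (norm2 star E b)\<^sup>2)"
    unfolding \<beta>z \<beta>z' sq using complex_norm_square[of \<beta>] by (simp add: E_nonneg)
  finally have "2 * cmod z \<le> r * (norm2 star E a)\<^sup>2 + (cmod \<beta>)\<^sup>2 * (norm2 star E b)\<^sup>2" by simp
  also have "(cmod \<beta>)\<^sup>2 \<le> (1 / sqrt r)\<^sup>2" using nb by (intro power_mono) auto
  then have "(cmod \<beta>)\<^sup>2 * (norm2 star E b)\<^sup>2 \<le> (1 / sqrt r)\<^sup>2 * (norm2 star E b)\<^sup>2"
    by (intro mult_right_mono) auto
  finally show ?thesis using assms by (simp add: z_def power_divide mult.commute)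
qed

text \<open>
  Identities between expectations pass from words to the generated algebra, as the
  functional \<open>b \<mapsto> E (d b)\<close> is continuous in the norm \<open>norm2\<close>.
\<close>

lemma E_mult_zero_on_generated:
  assumes words: "\<And>w. set w \<subseteq> S \<union> star ` S \<Longrightarrow> E (d * prod_list w) = 0"
    and b: "b \<in> vN_generated scaleC star E S"
  shows "E (d * b) = 0"
proof -
  have span: "E (d * a) = 0" if "a \<in> span {prod_list w |w. set w \<subseteq> S \<union> star ` S}" for a
    using that
  proof (rule span_induct)
    show "subspace {a. E (d * a) = 0}"
      by (auto simp: subspace_def E_add E_scale scale_mult_right algebra_simps)
  qed (use words in auto)
  let ?D = "norm2 star E (star d)"
  have "2 * cmod (E (d * b)) \<le> 0 + e" if "e > 0" for e
  proof -
    \<comment> \<open>With \<open>b\<close> approximated to within \<open>r\<close>, the bound becomes \<open>?D\<^sup>2 * r + r\<close>, which is to equal \<open>e\<close>.\<close>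
    define r where "r = e / (?D\<^sup>2 + 1)"
    have D: "?D\<^sup>2 + 1 > 0" by (simp add: add_nonneg_pos)
    have r: "r > 0" using that D by (simp add: r_def)
    obtain a where a: "a \<in> span {prod_list w |w. set w \<subseteq> S \<union> star ` S}" "norm2 star E (b - a) < r"
      using b r unfolding vN_generated_def by blast
    have "norm2 star E (b - a) \<ge> 0" using E_positive[of "b - a"] by (simp add: norm2_def)
    then have n: "(norm2 star E (b - a))\<^sup>2 \<le> r\<^sup>2" using a by (intro power_mono) auto
    have "E (d * b) = E (star (star d) * (b - a))" using span[OF a(1)] by (simp add: star_star E_diff right_diff_distrib)
    then have "2 * cmod (E (d * b)) \<le> ?D\<^sup>2 * r + (norm2 star E (b - a))\<^sup>2 / r"
      using E_star_mult_bound[OF r] by simp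
    also have "\<dots> \<le> ?D\<^sup>2 * r + r\<^sup>2 / r" using n r by (intro add_left_mono divide_right_mono) auto
    also have "\<dots> = (?D\<^sup>2 + 1) * r" using r by (simp add: power2_eq_square algebra_simps)
    also have "\<dots> = e" using D by (simp add: r_def)
    finally show ?thesis by simp
  qed
  then have "2 * cmod (E (d * b)) \<le> 0" by (rule field_le_epsilon)
  then show ?thesis by simp
qed

lemma word_in_span: "set w \<subseteq> S \<Longrightarrow> prod_list w \<in> span {prod_list w |w. set w \<subseteq> S \<union> star ` S}"
  by (rule span_base) auto

lemma span_in_generated:
  "a \<in> span {prod_list w |w. set w \<subseteq> S \<union> star ` S} \<Longrightarrow> a \<in> vN_generated scaleC star E S"
  by (auto simp: vN_generated_def norm2_def intro!: bexI[of _ a])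

lemma poly_at_in_generated:
  assumes "a \<in> S"
  shows "poly_at p a \<in> vN_generated scaleC star E S"
proof (rule span_in_generated)
  let ?V = "span {prod_list w |w. set w \<subseteq> S \<union> star ` S}"
  have "a ^ i \<in> ?V" for i
    using word_in_span[of "replicate i a" S] assms by (simp add: set_replicate_conv_if)
  then show "poly_at p a \<in> ?V"
    unfolding poly_at_def scale_of_real[symmetric] by (intro span_sum span_scale)
qed

end

context q_brownian_motion
begin

text \<open>
  \<open>H\<^sub>n(X(u), u)\<close> applied to the vacuum is the state with \<open>n\<close> open strands at time \<open>u\<close>: in
  \<open>x H\<^sub>n = H\<^sub>n\<^sub>+\<^sub>1 + [n] u H\<^sub>n\<^sub>-\<^sub>1\<close> the two terms on the right correspond to opening a strand and
  to closing one.
\<close>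

lemma E_hermite_word:
  assumes "u \<ge> 0" "set ts \<subseteq> {0..}"
  shows "E (poly_at (q_hermite q u n) (X u) * prod_list (map X ts)) = of_real (fock_amplitude q (replicate n u) ts)"
  using assms(2)
proof (induction n arbitrary: ts rule: induct_nat_012)
  case 0
  then show ?case by (simp add: X_moments joint_moment_eq_fock)
next
  case 1
  have "X u * prod_list (map X ts) = prod_list (map X (u # ts))" by simp
  then have "E (X u * prod_list (map X ts)) = of_real (fock_amplitude q [] (u # ts))"
    using X_moments[of "u # ts"] 1 assms(1) by (simp add: joint_moment_eq_fock)
  then show ?case by (simp add: poly_at_pCons)
next
  case (ge2 n)
  let ?H = "\<lambda>n. poly_at (q_hermite q u n) (X u)" and ?w = "prod_list (map X ts)"
  have "?H (Suc (Suc n)) = ?H (Suc n) * X u - (q_number q (Suc n) * u) *\<^sub>R ?H n"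
    by (simp add: poly_at_diff poly_at_smult poly_at_pCons poly_at_commute)
  then have "E (?H (Suc (Suc n)) * ?w) = E (?H (Suc n) * prod_list (map X (u # ts)))
      - of_real (q_number q (Suc n) * u) * E (?H n * ?w)"
    by (simp add: left_diff_distrib E_diff E_scaleR mult.assoc)
  also have "\<dots> = of_real (fock_amplitude q (replicate (Suc n) u) (u # ts) -
      q_number q (Suc n) * u * fock_amplitude q (replicate n u) ts)"
    using ge2.IH(1)[of ts] ge2.IH(2)[of "u # ts"] ge2.prems assms(1) by simp
  also have "fock_amplitude q (replicate (Suc n) u) (u # ts) - q_number q (Suc n) * u * fock_amplitude q (replicate n u) ts
      = fock_amplitude q (replicate (Suc (Suc n)) u) ts"
    by (subst fock_replicate_step) simp
  finally show ?case .
qed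

abbreviation "past s \<equiv> vN_generated scaleC star E (X ` {0..s})"

lemma word_in_past:
  assumes "set w \<subseteq> X ` {0..s} \<union> star ` X ` {0..s}"
  obtains ts where "set ts \<subseteq> {0..s}" "w = map X ts"
proof -
  have "star ` X ` {0..s} = X ` {0..s}" using X_selfadjoint by force
  then have "set w \<subseteq> X ` {0..s}" using assms by simp
  then have "w \<in> lists (X ` {0..s})" by auto
  then show ?thesis using that by (auto simp: lists_image in_lists_conv_set)
qed

text \<open>
  The martingale property.  Against a word with times up to \<open>s\<close>, strands at time \<open>u\<close> and
  strands at time \<open>s\<close> have the same minima.
\<close>

lemma hermite_cond_exp:
  assumes "0 \<le> s" "s \<le> u"
  shows "is_cond_exp E (past s) (poly_at (q_hermite q u n) (X u)) (poly_at (q_hermite q s n) (X s))"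
  unfolding is_cond_exp_def
proof (intro conjI ballI)
  show "poly_at (q_hermite q s n) (X s) \<in> past s" using assms by (intro poly_at_in_generated) auto
  fix b assume b: "b \<in> past s"
  have "E ((poly_at (q_hermite q s n) (X s) - poly_at (q_hermite q u n) (X u)) * b) = 0"
  proof (rule E_mult_zero_on_generated[OF _ b])
    fix w assume "set w \<subseteq> X ` {0..s} \<union> star ` X ` {0..s}"
    then obtain ts where ts: "set ts \<subseteq> {0..s}" "w = map X ts" by (rule word_in_past)
    have "fock_amplitude q (replicate n s) ts = fock_amplitude q (replicate n u) ts"
      using ts assms by (intro fock_cong) (auto simp: list_all2_conv_all_nth min_def subset_iff)
    moreover have "set ts \<subseteq> {0..}" using ts by auto
    ultimately show "E ((poly_at (q_hermite q s n) (X s) - poly_at (q_hermite q u n) (X u)) * prod_list w) = 0"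
      using assms E_hermite_word[of s ts n] E_hermite_word[of u ts n]
      by (simp add: left_diff_distrib E_diff ts)
  qed
  then show "E (poly_at (q_hermite q s n) (X s) * b) = E (poly_at (q_hermite q u n) (X u) * b)"
    by (simp add: left_diff_distrib E_diff)
qed

lemma cond_exp_add:
  assumes "is_cond_exp E (past s) (poly_at f (X u)) (poly_at g (X s))"
    "is_cond_exp E (past s) (poly_at f' (X u)) (poly_at g' (X s))" "s \<ge> 0"
  shows "is_cond_exp E (past s) (poly_at (f + f') (X u)) (poly_at (g + g') (X s))"
  using assms poly_at_in_generated[of "X s" "X ` {0..s}" "g + g'"]
  by (auto simp: is_cond_exp_def poly_at_add E_add distrib_right)

lemma cond_exp_smult:
  assumes "is_cond_exp E (past s) (poly_at f (X u)) (poly_at g (X s))" "s \<ge> 0"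
  shows "is_cond_exp E (past s) (poly_at (smult c f) (X u)) (poly_at (smult c g) (X s))"
  using assms poly_at_in_generated[of "X s" "X ` {0..s}" "smult c g"]
  by (auto simp: is_cond_exp_def poly_at_smult E_scaleR)

text \<open>
  If \<open>d(X(s))\<close> is orthogonal to the past and \<open>n\<close> is the degree of \<open>d\<close>, then pairing it with
  \<open>H\<^sub>n(X(s), s)\<close>, which is orthogonal to all lower powers, isolates the leading coefficient of \<open>d\<close>.
\<close>

lemma cond_exp_unique:
  assumes q: "-1 < q" "q < 1" and s: "s > 0"
    and g: "is_cond_exp E (past s) a (poly_at g (X s))" and g': "is_cond_exp E (past s) a (poly_at g' (X s))"
  shows "g = g'"
proof (rule ccontr)
  assume "g \<noteq> g'"
  define d where "d = g - g'"
  let ?n = "degree d" and ?H = "\<lambda>n. poly_at (q_hermite q s n) (X s)"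
  have "d \<noteq> 0" using \<open>g \<noteq> g'\<close> by (simp add: d_def)
  then have d0: "coeff d ?n \<noteq> 0" by simp
  have "?H ?n \<in> past s" using s by (intro poly_at_in_generated) auto
  then have "E (poly_at d (X s) * ?H ?n) = 0"
    using g g' by (simp add: is_cond_exp_def d_def poly_at_diff left_diff_distrib E_diff)
  then have 0: "E (?H ?n * poly_at d (X s)) = 0" by (simp add: E_tracial)
  have Esum: "E (sum h A) = (\<Sum>i\<in>A. E (h i))" for h and A :: "nat set"
    by (induction A rule: infinite_finite_induct) (simp_all add: E_add)
  have pow: "E (?H ?n * X s ^ i) = of_real (fock_amplitude q (replicate ?n s) (replicate i s))" for i
    using E_hermite_word[of s "replicate i s" ?n] s by (simp add: set_replicate_conv_if)
  have "?H ?n * poly_at d (X s) = (\<Sum>i\<le>?n. coeff d i *\<^sub>R (?H ?n * X s ^ i))"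
    unfolding poly_at_def[of d] by (simp add: sum_distrib_left)
  then have "E (?H ?n * poly_at d (X s)) =
      of_real (\<Sum>i\<le>?n. coeff d i * fock_amplitude q (replicate ?n s) (replicate i s))"
    by (simp add: Esum E_scaleR pow)
  also have "(\<Sum>i\<le>?n. coeff d i * fock_amplitude q (replicate ?n s) (replicate i s)) =
      coeff d ?n * fock_amplitude q (replicate ?n s) (replicate ?n s)"
    by (subst sum.remove[of _ ?n]) (auto simp: fock_eq_0 intro!: sum.neutral)
  finally show False using 0 d0 fock_replicate_diag_pos[OF q s, of ?n] by simp
qed

end

section \<open>Transition operators on polynomials\<close>

text \<open>
  For \<open>-1 < q < 1\<close> all q-numbers \<open>[n]\<close> with \<open>n > 0\<close> are positive, so the polynomial representing a
  conditional expectation is unique and the definite description in \<open>transition\<close> denotes it.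
\<close>

locale q_brownian_motion_nondegenerate = q_brownian_motion +
  assumes q_gt: "-1 < q" and q_lt: "q < 1"
begin

abbreviation "K \<equiv> transition scaleC star E X"

lemma transition_eqI:
  assumes "s > 0" "is_cond_exp E (past s) (poly_at f (X u)) (poly_at g (X s))"
  shows "K s u f = g"
  unfolding transition_def using assms cond_exp_unique[OF q_gt q_lt] by (intro the_equality) auto

text \<open>
  Existence for arbitrary polynomials, by expanding in the q-Hermite basis at the later time.
\<close>

lemma transition_cond_exp:
  assumes "0 < s" "s \<le> u"
  shows "is_cond_exp E (past s) (poly_at f (X u)) (poly_at (K s u f) (X s))"
proof -
  obtain c where c: "f = (\<Sum>k\<le>degree f. smult (c k) (q_hermite q u k))"
    by (rule q_hermite_expansion[of f "degree f" q u]) auto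
  let ?g = "\<lambda>n. \<Sum>k\<le>n. smult (c k) (q_hermite q s k)"
  have "is_cond_exp E (past s) (poly_at (\<Sum>k\<le>n. smult (c k) (q_hermite q u k)) (X u)) (poly_at (?g n) (X s))" for n
  proof (induction n)
    case 0
    show ?case
      using cond_exp_smult[OF hermite_cond_exp[of s u 0], of "c 0"] assms by simp
  next
    case (Suc n)
    show ?case
      unfolding sum.atMost_Suc
      by (intro cond_exp_add cond_exp_smult hermite_cond_exp Suc) (use assms in auto)
  qed
  then have "is_cond_exp E (past s) (poly_at f (X u)) (poly_at (?g (degree f)) (X s))" using c by metis
  then show ?thesis using transition_eqI[OF assms(1)] by metis
qed

lemma transition_add: "0 < s \<Longrightarrow> s \<le> u \<Longrightarrow> K s u (f + g) = K s u f + K s u g"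
  by (intro transition_eqI cond_exp_add transition_cond_exp) auto

lemma transition_smult: "0 < s \<Longrightarrow> s \<le> u \<Longrightarrow> K s u (smult c f) = smult c (K s u f)"
  by (intro transition_eqI cond_exp_smult transition_cond_exp) auto

lemma transition_hermite: "0 < s \<Longrightarrow> s \<le> u \<Longrightarrow> K s u (q_hermite q u n) = q_hermite q s n"
  by (intro transition_eqI hermite_cond_exp) auto

end

section \<open>The generator on q-Hermite polynomials\<close>

text \<open>
  The bound on the degrees, uniform in \<open>h\<close>, turns coefficientwise convergence into locally uniform
  convergence and makes the notion stable under linear operators.
\<close>

definition coeff_lim :: "(real \<Rightarrow> real poly) \<Rightarrow> real poly \<Rightarrow> bool" where
  "coeff_lim F g \<longleftrightarrow> (\<exists>N. \<forall>h>0. \<forall>k\<ge>N. coeff (F h) k = 0) \<and>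
     (\<forall>k. ((\<lambda>h. coeff (F h) k) \<longlongrightarrow> coeff g k) (at_right 0))"

lemma coeff_limI:
  assumes "\<And>h k. h > 0 \<Longrightarrow> k \<ge> N \<Longrightarrow> coeff (F h) k = 0"
    "\<And>k. ((\<lambda>h. coeff (F h) k) \<longlongrightarrow> coeff g k) (at_right 0)"
  shows "coeff_lim F g"
  using assms unfolding coeff_lim_def by blast

lemma coeff_lim_const: "coeff_lim (\<lambda>h. f) f"
  by (rule coeff_limI[of "Suc (degree f)"]) (auto intro: coeff_eq_0)

lemma coeff_lim_add:
  assumes "coeff_lim F f" "coeff_lim G g"
  shows "coeff_lim (\<lambda>h. F h + G h) (f + g)"
proof -
  obtain N M where "\<forall>h>0. \<forall>k\<ge>N. coeff (F h) k = 0" "\<forall>h>0. \<forall>k\<ge>M. coeff (G h) k = 0"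
    using assms unfolding coeff_lim_def by blast
  then show ?thesis using assms[unfolded coeff_lim_def]
    by (intro coeff_limI[of "max N M"]) (auto intro: tendsto_add)
qed

lemma coeff_lim_smult:
  assumes "coeff_lim F f" "(c \<longlongrightarrow> d) (at_right 0)"
  shows "coeff_lim (\<lambda>h. smult (c h) (F h)) (smult d f)"
proof -
  obtain N where "\<forall>h>0. \<forall>k\<ge>N. coeff (F h) k = 0" using assms unfolding coeff_lim_def by blast
  then show ?thesis using assms[unfolded coeff_lim_def]
    by (intro coeff_limI[of N]) (auto intro: tendsto_mult)
qed

lemma coeff_lim_diff:
  assumes "coeff_lim F f" "coeff_lim G g"
  shows "coeff_lim (\<lambda>h. F h - G h) (f - g)"
  using coeff_lim_add[OF assms(1) coeff_lim_smult[OF assms(2) tendsto_const[of "-1"]]] by simp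

lemma coeff_lim_pCons_0:
  assumes "coeff_lim F f"
  shows "coeff_lim (\<lambda>h. pCons 0 (F h)) (pCons 0 f)"
proof -
  obtain N where "\<forall>h>0. \<forall>k\<ge>N. coeff (F h) k = 0" using assms unfolding coeff_lim_def by blast
  then show ?thesis using assms[unfolded coeff_lim_def]
    by (intro coeff_limI[of "Suc N"]) (auto simp: coeff_pCons split: nat.splits)
qed

lemma coeff_lim_sum:
  assumes "\<And>i. i \<in> A \<Longrightarrow> coeff_lim (F i) (f i)"
  shows "coeff_lim (\<lambda>h. \<Sum>i\<in>A. F i h) (\<Sum>i\<in>A. f i)"
  using assms by (induction A rule: infinite_finite_induct) (auto intro: coeff_lim_const coeff_lim_add)

lemma coeff_lim_cong:
  assumes "\<And>h. h > 0 \<Longrightarrow> F h = G h" "coeff_lim G g"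
  shows "coeff_lim F g"
proof -
  obtain N where N: "\<forall>h>0. \<forall>k\<ge>N. coeff (G h) k = 0" using assms unfolding coeff_lim_def by blast
  have ev: "eventually (\<lambda>h. h > (0::real)) (at_right 0)" by (simp add: eventually_at_right_less)
  show ?thesis
  proof (rule coeff_limI[of N])
    fix k
    have "eventually (\<lambda>h. coeff (G h) k = coeff (F h) k) (at_right 0)"
      using ev by eventually_elim (simp add: assms)
    moreover have "((\<lambda>h. coeff (G h) k) \<longlongrightarrow> coeff g k) (at_right 0)"
      using assms(2) by (simp add: coeff_lim_def)
    ultimately show "((\<lambda>h. coeff (F h) k) \<longlongrightarrow> coeff g k) (at_right 0)"
      by (rule Lim_transform_eventually[rotated])
  qed (use N assms in auto)
qed

lemma poly_as_finite_sum:
  fixes p :: "real poly"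
  assumes "\<And>k. k \<ge> N \<Longrightarrow> coeff p k = 0"
  shows "p = (\<Sum>k<N. smult (coeff p k) (monom 1 k))"
proof (rule poly_eqI)
  fix n
  show "coeff p n = coeff (\<Sum>k<N. smult (coeff p k) (monom 1 k)) n"
    using assms[of n] by (auto simp: coeff_sum if_distrib cong: if_cong)
qed

lemma coeff_lim_imp_uniform_limit:
  assumes "coeff_lim F g"
  shows "uniform_limit {a..b} (\<lambda>h x. poly (F h) x) (poly g) (at_right 0)"
proof -
  obtain N where N: "\<forall>h>0. \<forall>k\<ge>N. coeff (F h) k = 0" and
    c: "((\<lambda>h. coeff (F h) k) \<longlongrightarrow> coeff g k) (at_right 0)" for k
    using assms unfolding coeff_lim_def by blast
  have ev: "eventually (\<lambda>h. h > (0::real)) (at_right 0)" by (simp add: eventually_at_right_less)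
  \<comment> \<open>The limit inherits the common degree bound of the family.\<close>
  have g0: "coeff g k = 0" if "k \<ge> N" for k
  proof -
    have "eventually (\<lambda>h. coeff (F h) k = 0) (at_right 0)"
      using ev by eventually_elim (use N that in auto)
    then have "((\<lambda>h. coeff (F h) k) \<longlongrightarrow> 0) (at_right 0)" by (rule tendsto_eventually)
    then show ?thesis using c tendsto_unique trivial_limit_at_right_real by blast
  qed
  have monom: "uniform_limit {a..b} (\<lambda>h x. coeff (F h) k * x ^ k) (\<lambda>x. coeff g k * x ^ k) (at_right 0)" for k
  proof (rule uniform_lim_mult)
    show "uniform_limit {a..b} (\<lambda>h x. coeff (F h) k) (\<lambda>x. coeff g k) (at_right 0)"
      using c by (simp add: uniform_limit_iff tendsto_iff)
    have "compact ((\<lambda>x. x ^ k) ` {a..b})" by (intro compact_continuous_image continuous_intros compact_Icc)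
    then show "bounded ((\<lambda>x. x ^ k) ` {a..b})" by (rule compact_imp_bounded)
    show "bounded ((\<lambda>x. coeff g k) ` {a..b})" by (rule bounded_subset[of "{coeff g k}"]) auto
  qed (rule uniform_limit_const)
  have sum: "uniform_limit {a..b} (\<lambda>h x. \<Sum>k<n. coeff (F h) k * x ^ k) (\<lambda>x. \<Sum>k<n. coeff g k * x ^ k) (at_right 0)" for n
    by (induction n) (auto intro!: uniform_limit_add monom uniform_limit_const)
  have poly_sum: "poly p x = (\<Sum>k<N. coeff p k * x ^ k)" if "\<And>k. k \<ge> N \<Longrightarrow> coeff p k = 0" for p :: "real poly" and x
    by (subst poly_as_finite_sum[OF that]) (auto simp: poly_sum poly_monom)
  show ?thesis
  proof (rule uniform_limit_cong[THEN iffD2, OF _ _ sum[of N]])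
    show "\<forall>\<^sub>F h in at_right 0. \<forall>x\<in>{a..b}. poly (F h) x = (\<Sum>k<N. coeff (F h) k * x ^ k)"
      using ev by eventually_elim (use N poly_sum in blast)
  qed (use g0 poly_sum in blast)
qed

text \<open>
  The polynomials \<open>- \<partial>H\<^sub>n(x, t)/\<partial>t\<close>, through the recurrence obtained by differentiating the one for
  \<open>H\<^sub>n\<close>.
\<close>

fun q_hermite_neg_dt :: "real \<Rightarrow> real \<Rightarrow> nat \<Rightarrow> real poly" where
  "q_hermite_neg_dt q t 0 = 0"
| "q_hermite_neg_dt q t (Suc 0) = 0"
| "q_hermite_neg_dt q t (Suc (Suc n)) = [:0, 1:] * q_hermite_neg_dt q t (Suc n)
     - smult (q_number q (Suc n) * t) (q_hermite_neg_dt q t n) + smult (q_number q (Suc n)) (q_hermite q t n)"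

lemma coeff_lim_q_hermite: "coeff_lim (\<lambda>h. q_hermite q (t + h) n) (q_hermite q t n)"
proof (induction n rule: induct_nat_012)
  case (ge2 n)
  have "((\<lambda>h. q_number q (Suc n) * (t + h)) \<longlongrightarrow> q_number q (Suc n) * (t + 0)) (at_right 0)"
    by (intro tendsto_intros)
  then show ?case using ge2
    by (auto intro!: coeff_lim_diff coeff_lim_pCons_0 coeff_lim_smult)
qed (auto intro: coeff_lim_const)

lemma coeff_lim_q_hermite_neg_dt:
  "coeff_lim (\<lambda>h. smult (1 / h) (q_hermite q t n - q_hermite q (t + h) n)) (q_hermite_neg_dt q t n)"
proof (induction n rule: induct_nat_012)
  case (ge2 n)
  let ?D = "\<lambda>n h. smult (1 / h) (q_hermite q t n - q_hermite q (t + h) n)" and ?c = "q_number q (Suc n)"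
  let ?R = "\<lambda>h. pCons 0 (?D (Suc n) h) - smult (?c * t) (?D n h) + smult ?c (q_hermite q (t + h) n)"
  show ?case
  proof (rule coeff_lim_cong[where G = ?R])
    fix h :: real assume "h > 0"
    then show "?D (Suc (Suc n)) h = ?R h"
      by (intro poly_eqI) (auto simp: coeff_pCons field_simps split: nat.splits)
  next
    show "coeff_lim ?R (q_hermite_neg_dt q t (Suc (Suc n)))"
      using coeff_lim_add[OF coeff_lim_diff[OF coeff_lim_pCons_0[OF ge2(2)]
        coeff_lim_smult[OF ge2(1) tendsto_const[of "?c * t"]]]
        coeff_lim_smult[OF coeff_lim_q_hermite[of q t n] tendsto_const[of ?c]]] by simp
  qed
qed (auto intro: coeff_lim_const)

context q_brownian_motion_nondegenerate
begin

lemma transition_sum: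
  "0 < s \<Longrightarrow> s \<le> u \<Longrightarrow> K s u (\<Sum>i\<in>A. smult (c i) (f i)) = (\<Sum>i\<in>A. smult (c i) (K s u (f i)))"
proof (induction A rule: infinite_finite_induct)
  case (insert x A)
  then show ?case by (simp add: transition_add transition_smult)
qed (use transition_smult[of s u 0 0] in auto)

lemma smult_sum_right: "smult c (\<Sum>i\<in>A. f i) = (\<Sum>i\<in>A. smult c (f i))"
  by (induction A rule: infinite_finite_induct) (simp_all add: smult_add_right)

text \<open>
  Once the transition operators are known to tend to the identity on the monomials of degree below
  \<open>N\<close>, they may be applied to convergent families of polynomials of degree below \<open>N\<close>.
\<close>

lemma coeff_lim_transition_lower:
  assumes t: "t > 0"
    and m: "\<And>k. k < N \<Longrightarrow> coeff_lim (\<lambda>h. K t (t + h) (monom 1 k)) (monom 1 k)"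
    and F: "coeff_lim F f" "\<And>h k. h > 0 \<Longrightarrow> k \<ge> N \<Longrightarrow> coeff (F h) k = 0"
    and f: "\<And>k. k \<ge> N \<Longrightarrow> coeff f k = 0"
  shows "coeff_lim (\<lambda>h. K t (t + h) (F h)) f"
proof (rule coeff_lim_cong)
  fix h :: real assume "h > 0"
  then have "F h = (\<Sum>k<N. smult (coeff (F h) k) (monom 1 k))" using F(2) by (intro poly_as_finite_sum)
  then have "K t (t + h) (F h) = K t (t + h) (\<Sum>k<N. smult (coeff (F h) k) (monom 1 k))" by simp
  then show "K t (t + h) (F h) = (\<Sum>k<N. smult (coeff (F h) k) (K t (t + h) (monom 1 k)))"
    using \<open>h > 0\<close> t by (simp add: transition_sum)
next
  have "coeff_lim (\<lambda>h. \<Sum>k<N. smult (coeff (F h) k) (K t (t + h) (monom 1 k)))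
      (\<Sum>k<N. smult (coeff f k) (monom 1 k))"
    using F(1) by (intro coeff_lim_sum coeff_lim_smult m) (auto simp: coeff_lim_def)
  then show "coeff_lim (\<lambda>h. \<Sum>k<N. smult (coeff (F h) k) (K t (t + h) (monom 1 k))) f"
    using poly_as_finite_sum[OF f] by simp
qed

text \<open>
  Strong continuity at \<open>h = 0\<close>, by induction on the degree: \<open>H\<^sub>n(\<cdot>, t) - H\<^sub>n(\<cdot>, t + h)\<close> and
  \<open>H\<^sub>n(\<cdot>, t) - x\<^sup>n\<close> have degree below \<open>n\<close>, while \<open>H\<^sub>n(\<cdot>, t + h)\<close> is mapped to \<open>H\<^sub>n(\<cdot>, t)\<close>.
\<close>

lemma coeff_lim_transition_monom:
  assumes t: "t > 0"
  shows "coeff_lim (\<lambda>h. K t (t + h) (monom 1 n)) (monom 1 n)"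
proof (induction n rule: less_induct)
  case (less n)
  let ?H = "\<lambda>t. q_hermite q t n"
  define L where "L = ?H t - monom 1 n"
  have Hn: "coeff (?H s) k = (if k = n then 1 else 0)" if "k \<ge> n" for s k
    using that lead_coeff_q_hermite[of q s n] coeff_eq_0[of "?H s" k] by auto
  have "coeff_lim (\<lambda>h. ?H t - ?H (t + h)) (?H t - ?H t)"
    by (intro coeff_lim_diff coeff_lim_const coeff_lim_q_hermite)
  then have D: "coeff_lim (\<lambda>h. ?H t - ?H (t + h)) 0" by (simp only: diff_self)
  have 1: "coeff_lim (\<lambda>h. K t (t + h) (?H t - ?H (t + h))) 0"
  proof (rule coeff_lim_transition_lower[OF t less D])
    fix h :: real and k assume "k \<ge> n"
    then show "coeff (?H t - ?H (t + h)) k = 0" using Hn[of k t] Hn[of k "t + h"] by simp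
  qed simp_all
  have L: "coeff L k = 0" if "k \<ge> n" for k
    using Hn[OF that, of t] by (simp add: L_def)
  have 2: "coeff_lim (\<lambda>h. K t (t + h) L) L"
    by (rule coeff_lim_transition_lower[OF t less coeff_lim_const]) (use L in blast)+
  show ?case
  proof (rule coeff_lim_cong)
    fix h :: real assume h: "h > 0"
    have "K t (t + h) (monom 1 n + L) = K t (t + h) ((?H t - ?H (t + h)) + ?H (t + h))"
      by (simp add: L_def)
    then have "K t (t + h) (monom 1 n) + K t (t + h) L = K t (t + h) (?H t - ?H (t + h)) + ?H t"
      using h t by (simp only: transition_add transition_hermite)
    then show "K t (t + h) (monom 1 n) = K t (t + h) (?H t - ?H (t + h)) + ?H t - K t (t + h) L"
      by (simp add: algebra_simps)
  next
    have "coeff_lim (\<lambda>h. K t (t + h) (?H t - ?H (t + h)) + ?H t - K t (t + h) L) (0 + ?H t - L)"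
      by (intro coeff_lim_diff coeff_lim_add 1 2 coeff_lim_const)
    then show "coeff_lim (\<lambda>h. K t (t + h) (?H t - ?H (t + h)) + ?H t - K t (t + h) L) (monom 1 n)"
      by (simp add: L_def)
  qed
qed

text \<open>
  As \<open>K\<close> maps \<open>H\<^sub>n(\<cdot>, t + h)\<close> to \<open>H\<^sub>n(\<cdot>, t)\<close>, the increment \<open>K H\<^sub>n(\<cdot>, t) - H\<^sub>n(\<cdot>, t)\<close> is
  \<open>K (H\<^sub>n(\<cdot>, t) - H\<^sub>n(\<cdot>, t + h))\<close>.
\<close>

lemma coeff_lim_generator_hermite:
  assumes t: "t > 0"
  shows "coeff_lim (\<lambda>h. smult (1 / h) (K t (t + h) (q_hermite q t n) - q_hermite q t n)) (q_hermite_neg_dt q t n)"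
proof (rule coeff_lim_cong)
  let ?H = "\<lambda>t. q_hermite q t n"
  let ?D = "\<lambda>h. smult (1 / h) (?H t - ?H (t + h))"
  fix h :: real assume h: "h > 0"
  have "?H t = (?H t - ?H (t + h)) + ?H (t + h)" by simp
  then have "K t (t + h) (?H t) = K t (t + h) (?H t - ?H (t + h)) + ?H t"
    using h t by (metis transition_add transition_hermite less_add_same_cancel1 less_imp_le)
  then show "smult (1 / h) (K t (t + h) (?H t) - ?H t) = K t (t + h) (?D h)"
    using h t by (simp add: transition_smult)
next
  let ?D = "\<lambda>h. smult (1 / h) (q_hermite q t n - q_hermite q (t + h) n)"
  obtain N where N: "\<forall>h>0. \<forall>k\<ge>N. coeff (?D h) k = 0"
    using coeff_lim_q_hermite_neg_dt[of q t n] unfolding coeff_lim_def by blast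
  let ?M = "max N (Suc (degree (q_hermite_neg_dt q t n)))"
  show "coeff_lim (\<lambda>h. K t (t + h) (?D h)) (q_hermite_neg_dt q t n)"
  proof (rule coeff_lim_transition_lower[OF t coeff_lim_transition_monom[OF t] coeff_lim_q_hermite_neg_dt])
    fix k assume "?M \<le> k"
    then show "coeff (q_hermite_neg_dt q t n) k = 0" by (intro coeff_eq_0) simp
  qed (use N in auto)
qed

lemma generator_value_hermite_expansion:
  assumes t: "t > 0"
  shows "is_generator_value scaleC star E q X t (\<Sum>k\<le>n. smult (c k) (q_hermite q t k))
    (poly (\<Sum>k\<le>n. smult (c k) (q_hermite_neg_dt q t k)))"
proof -
  let ?f = "\<Sum>k\<le>n. smult (c k) (q_hermite q t k)"
  have "coeff_lim (\<lambda>h. smult (1 / h) (K t (t + h) ?f - ?f)) (\<Sum>k\<le>n. smult (c k) (q_hermite_neg_dt q t k))"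
  proof (rule coeff_lim_cong)
    fix h :: real assume "h > 0"
    then show "smult (1 / h) (K t (t + h) ?f - ?f) =
        (\<Sum>k\<le>n. smult (c k) (smult (1 / h) (K t (t + h) (q_hermite q t k) - q_hermite q t k)))"
      using t by (simp add: transition_sum sum_subtractf[symmetric] smult_diff_right[symmetric]
          smult_sum_right mult.commute)
  qed (intro coeff_lim_sum coeff_lim_smult coeff_lim_generator_hermite t tendsto_const)
  from coeff_lim_imp_uniform_limit[OF this, of "- radius q t" "radius q t"]
  show ?thesis by (simp add: is_generator_value_def)
qed

end

section \<open>Difference quotients and the kernel of the operator Delta\<close>

lemma poly_synthetic_div_diag:
  fixes f :: "real poly"
  shows "poly (synthetic_div f y) y = poly (pderiv f) y"
proof -
  have "poly (pderiv ([:- y, 1:] * p + [:c:])) y = poly p y" for p :: "real poly" and c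
    by (simp add: pderiv_mult pderiv_add pderiv_diff pderiv_smult pderiv_pCons)
  from this[of "synthetic_div f y" "poly f y"] show ?thesis by (simp only: synthetic_div_correct')
qed

text \<open>
  Synthetic division gives the difference quotient as a polynomial in \<open>x\<close>, on the diagonal too, and
  obeys a simple recursion along \<open>pCons\<close>.
\<close>

lemma diff_quot_poly: "diff_quot (poly f) x y = poly (synthetic_div f y) x"
proof (cases "x = y")
  case True
  have "deriv (poly f) y = poly (pderiv f) y" by (rule DERIV_imp_deriv) (rule poly_DERIV)
  then show ?thesis using True by (simp add: diff_quot_def poly_synthetic_div_diag)
next
  case False
  have "poly f x = poly ([:- y, 1:] * synthetic_div f y + [:poly f y:]) x"
    by (simp only: synthetic_div_correct')
  then have "poly f x - poly f y = (x - y) * poly (synthetic_div f y) x" by (simp add: algebra_simps)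
  then show ?thesis using False by (simp add: diff_quot_def)
qed

lemma deriv_diff_quot_poly: "deriv_diff_quot (poly f) x y = poly (pderiv (synthetic_div f y)) x"
  unfolding deriv_diff_quot_def diff_quot_poly by (rule DERIV_imp_deriv) (rule poly_DERIV)

lemma synthetic_div_add: "synthetic_div (f + g) y = synthetic_div f y + synthetic_div g (y::real)"
  by (induction f g rule: poly_induct2) simp_all

lemma synthetic_div_smult: "synthetic_div (smult c f) y = smult c (synthetic_div f (y::real))"
  by (induction f) simp_all

lemma synthetic_div_diff: "synthetic_div (f - g) y = synthetic_div f y - synthetic_div g (y::real)"
  using synthetic_div_add[of "f - g" g y] by simp

text \<open>
  Polynomial dependence on the point \<open>y\<close> makes the integrals against \<open>\<Gamma>\<close> meaningful.
\<close>

lemma synthetic_div_is_poly: "\<exists>p. \<forall>y. poly (synthetic_div f y) x = poly p (y::real)"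
proof (induction f)
  case (pCons a f)
  then obtain p where "\<forall>y. poly (synthetic_div f y) x = poly p y" by blast
  then show ?case by (intro exI[of _ "f + smult x p"]) simp
qed (auto intro: exI[of _ 0])

lemma pderiv_synthetic_div_is_poly: "\<exists>p. \<forall>y. poly (pderiv (synthetic_div f y)) x = poly p (y::real)"
proof (induction f)
  case (pCons a f)
  then obtain p where "\<forall>y. poly (pderiv (synthetic_div f y)) x = poly p y" by blast
  moreover obtain r where "\<forall>y. poly (synthetic_div f y) x = poly r y"
    using synthetic_div_is_poly by blast
  ultimately show ?case by (intro exI[of _ "r + smult x p"]) (simp add: pderiv_pCons)
qed (auto intro: exI[of _ 0])

lemma is_Gamma_integrable_poly:
  assumes "is_Gamma q t x \<mu>"
  shows "integrable \<mu> (poly p)"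
proof -
  obtain c where c: "p = (\<Sum>k\<le>degree p. smult (c k) (q_hermite q t k))"
    by (rule q_hermite_expansion[of p "degree p" q t]) auto
  have "integrable \<mu> (\<lambda>y. \<Sum>k\<le>degree p. c k * poly (q_hermite q t k) y)"
    using assms by (intro Bochner_Integration.integrable_sum integrable_mult_right) (simp add: is_Gamma_def)
  moreover have "poly p = (\<lambda>y. \<Sum>k\<le>degree p. c k * poly (q_hermite q t k) y)"
    by (subst c) (simp add: poly_sum fun_eq_iff)
  ultimately show ?thesis by simp
qed

lemma is_Gamma_integrable_synthetic_div:
  assumes "is_Gamma q t x \<mu>"
  shows "integrable \<mu> (\<lambda>y. poly (synthetic_div f y) z)" "integrable \<mu> (\<lambda>y. poly (pderiv (synthetic_div f y)) z)"
proof -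
  obtain p r where "\<forall>y. poly (synthetic_div f y) z = poly p y" "\<forall>y. poly (pderiv (synthetic_div f y)) z = poly r y"
    using synthetic_div_is_poly pderiv_synthetic_div_is_poly by metis
  then show "integrable \<mu> (\<lambda>y. poly (synthetic_div f y) z)" "integrable \<mu> (\<lambda>y. poly (pderiv (synthetic_div f y)) z)"
    using is_Gamma_integrable_poly[OF assms] by simp_all
qed

lemma synthetic_div_q_hermite:
  "synthetic_div (q_hermite q t (Suc (Suc n))) y = pCons (poly (q_hermite q t (Suc n)) y)
     (synthetic_div (q_hermite q t (Suc n)) y) - smult (q_number q (Suc n) * t) (synthetic_div (q_hermite q t n) y)"
  by (simp add: synthetic_div_smult synthetic_div_diff)

text \<open>
  The q-derivative of \<open>H\<^sub>n\<^sub>+\<^sub>1\<close>.  The recurrence for the difference quotients produces the inhomogeneous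
  term \<open>\<integral>H\<^sub>n d\<mu> = q\<^sup>n H\<^sub>n(x)\<close>, and \<open>[n + 1] = [n] + q\<^sup>n\<close> closes the induction.
\<close>

lemma is_Gamma_integral_diff_quot_hermite:
  assumes G: "is_Gamma q t x \<mu>"
  shows "(\<integral>y. poly (synthetic_div (q_hermite q t (Suc n)) y) x \<partial>\<mu>) =
    q_number q (Suc n) * poly (q_hermite q t n) x"
proof (induction n rule: induct_nat_012)
  case 0
  then show ?case using G by (auto simp: is_Gamma_def q_number_def dest: spec[of _ 0])
next
  case 1
  have "(\<integral>y. poly (q_hermite q t (Suc 0)) y \<partial>\<mu>) = q ^ Suc 0 * poly (q_hermite q t (Suc 0)) x"
    "(\<integral>y. poly (q_hermite q t 0) y \<partial>\<mu>) = q ^ 0 * poly (q_hermite q t 0) x"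
    "integrable \<mu> (poly (q_hermite q t (Suc 0)))" "integrable \<mu> (poly (q_hermite q t 0))"
    using G unfolding is_Gamma_def by blast+
  note H = this
  have "(\<integral>y. poly (q_hermite q t (Suc 0)) y + x * poly (q_hermite q t 0) y \<partial>\<mu>) =
      (\<integral>y. poly (q_hermite q t (Suc 0)) y \<partial>\<mu>) + x * (\<integral>y. poly (q_hermite q t 0) y \<partial>\<mu>)"
    by (simp only: Bochner_Integration.integral_add[OF H(3) integrable_mult_right[OF H(4)]] integral_mult_right_zero)
  also have "\<dots> = q * x + x" unfolding H(1,2) by simp
  finally have "(\<integral>y. poly (q_hermite q t (Suc 0)) y + x * poly (q_hermite q t 0) y \<partial>\<mu>) = q * x + x" .
  then show ?case by (simp add: q_number_def algebra_simps numeral_2_eq_2)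
next
  case (ge2 n)
  let ?H = "\<lambda>n. poly (q_hermite q t n)" and ?r = "\<lambda>n y. poly (synthetic_div (q_hermite q t n) y) x"
  let ?m = "Suc (Suc n)"
  have H: "integrable \<mu> (?H ?m)" "(\<integral>y. ?H ?m y \<partial>\<mu>) = q ^ ?m * ?H ?m x"
    using G unfolding is_Gamma_def by blast+
  have "(\<integral>y. ?r (Suc ?m) y \<partial>\<mu>) = (\<integral>y. ?H ?m y + x * ?r ?m y - q_number q ?m * t * ?r (Suc n) y \<partial>\<mu>)"
    unfolding synthetic_div_q_hermite by simp
  also have "\<dots> = q ^ ?m * ?H ?m x + x * (\<integral>y. ?r ?m y \<partial>\<mu>) - q_number q ?m * t * (\<integral>y. ?r (Suc n) y \<partial>\<mu>)"
    using H is_Gamma_integrable_synthetic_div[OF G] by (simp del: q_hermite.simps)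
  also have "\<dots> = q ^ ?m * ?H ?m x + q_number q ?m * (x * ?H (Suc n) x - q_number q (Suc n) * t * ?H n x)"
    unfolding ge2 by (simp add: algebra_simps)
  also have "x * ?H (Suc n) x - q_number q (Suc n) * t * ?H n x = ?H ?m x" by simp
  finally show ?case by (simp only: q_number_Suc[of q ?m] distrib_right add.commute)
qed

text \<open>
  Differentiating the recurrence of the difference quotients in \<open>x\<close> reproduces the recurrence that
  defines \<open>q_hermite_neg_dt\<close>, the inhomogeneous term being supplied by the preceding lemma.
\<close>

lemma is_Gamma_integral_deriv_hermite:
  assumes G: "is_Gamma q t x \<mu>"
  shows "(\<integral>y. poly (pderiv (synthetic_div (q_hermite q t n) y)) x \<partial>\<mu>) = poly (q_hermite_neg_dt q t n) x"
proof (induction n rule: induct_nat_012)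
  case (ge2 n)
  let ?D = "\<lambda>n y. poly (pderiv (synthetic_div (q_hermite q t n) y)) x"
  let ?r = "\<lambda>n y. poly (synthetic_div (q_hermite q t n) y) x"
  have "(\<integral>y. ?D (Suc (Suc n)) y \<partial>\<mu>) = (\<integral>y. ?r (Suc n) y + x * ?D (Suc n) y - q_number q (Suc n) * t * ?D n y \<partial>\<mu>)"
    unfolding synthetic_div_q_hermite by (simp add: pderiv_diff pderiv_pCons pderiv_smult)
  also have "\<dots> = (\<integral>y. ?r (Suc n) y \<partial>\<mu>) + x * (\<integral>y. ?D (Suc n) y \<partial>\<mu>) - q_number q (Suc n) * t * (\<integral>y. ?D n y \<partial>\<mu>)"
    using is_Gamma_integrable_synthetic_div[OF G] by (simp del: q_hermite.simps)
  also have "\<dots> = poly (q_hermite_neg_dt q t (Suc (Suc n))) x"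
    unfolding is_Gamma_integral_diff_quot_hermite[OF G] ge2 by simp
  finally show ?case .
qed (simp_all add: one_pCons pderiv_pCons)

theorem is_Gamma_integral_deriv_diff_quot:
  assumes G: "is_Gamma q t x \<mu>"
  shows "(\<integral>y. deriv_diff_quot (poly (\<Sum>k\<le>n. smult (c k) (q_hermite q t k))) x y \<partial>\<mu>) =
    poly (\<Sum>k\<le>n. smult (c k) (q_hermite_neg_dt q t k)) x"
proof -
  have "deriv_diff_quot (poly (\<Sum>k\<le>n. smult (c k) (q_hermite q t k))) x y =
      (\<Sum>k\<le>n. c k * poly (pderiv (synthetic_div (q_hermite q t k) y)) x)" for y
    unfolding deriv_diff_quot_poly
    by (induction n) (simp_all add: one_pCons synthetic_div_smult synthetic_div_add pderiv_add pderiv_smult pderiv_pCons)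
  then show ?thesis using is_Gamma_integrable_synthetic_div[OF G]
    by (simp add: is_Gamma_integral_deriv_hermite[OF G] poly_sum)
qed

section \<open>q-factorials and q-Hermite polynomials on the circle\<close>

text \<open>
  The finite product \<open>(q; q)\<^sub>n\<close>.
\<close>

definition q_poch :: "real \<Rightarrow> nat \<Rightarrow> real" where
  "q_poch q n = (\<Prod>i<n. 1 - q ^ Suc i)"

lemma q_poch_0 [simp]: "q_poch q 0 = 1" by (simp add: q_poch_def)

lemma q_poch_Suc: "q_poch q (Suc n) = q_poch q n * (1 - q ^ Suc n)" by (simp add: q_poch_def)

definition q_binom :: "real \<Rightarrow> nat \<Rightarrow> nat \<Rightarrow> real" where
  "q_binom q n k = (if k \<le> n then q_poch q n / (q_poch q k * q_poch q (n - k)) else 0)"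

text \<open>
  The coefficients of the theta series \<open>\<Sum>\<^sub>i (-1)\<^sup>i q\<^bsup>i(i-1)/2\<^esup> u\<^sup>i\<close>.  The exponent is nonnegative for
  every integer \<open>i\<close>, so that \<open>q = 0\<close> needs no separate treatment.
\<close>

definition theta_coeff :: "real \<Rightarrow> int \<Rightarrow> real" where
  "theta_coeff q i = (if even i then 1 else -1) * q ^ nat (i * (i - 1) div 2)"

text \<open>
  The continuous q-Hermite polynomial \<open>h\<^sub>n(cos \<theta> | q)\<close> divided by \<open>(q; q)\<^sub>n\<close>, written as the Fourier sum
  that is the Cauchy product of two Euler series.
\<close>

definition q_trig :: "real \<Rightarrow> nat \<Rightarrow> real \<Rightarrow> real" where
  "q_trig q n \<theta> = (\<Sum>k\<le>n. cos ((2 * real k - real n) * \<theta>) / (q_poch q k * q_poch q (n - k)))"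

lemma qpoch_factors_summable:
  fixes a q :: "'a::real_normed_field"
  assumes "norm q < 1"
  shows "summable (\<lambda>i. norm ((1 - a * q ^ i) - 1))"
  using assms by (simp add: norm_mult norm_power summable_mult summable_geometric)

lemma convergent_qpoch:
  fixes a q :: "'a::{real_normed_field,banach}"
  assumes "norm q < 1"
  shows "convergent_prod (\<lambda>i. 1 - a * q ^ i)"
  by (intro abs_convergent_prod_imp_convergent_prod summable_imp_abs_convergent_prod
      qpoch_factors_summable assms)

lemma qpoch_LIMSEQ:
  fixes a q :: "'a::{real_normed_field,banach}"
  assumes "norm q < 1"
  shows "(\<lambda>n. \<Prod>i<n. 1 - a * q ^ i) \<longlonglongrightarrow> qpoch_inf a q"
  unfolding qpoch_inf_def
  using convergent_prod_LIMSEQ[OF convergent_qpoch[OF assms, of a]]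
  by (simp add: LIMSEQ_lessThan_iff_atMost[where f = "\<lambda>S. \<Prod>i\<in>S. 1 - a * q ^ i"])

lemma qpoch_inf_nonzero:
  fixes a q :: "'a::{real_normed_field,banach}"
  assumes "norm q < 1" "norm a < 1"
  shows "qpoch_inf a q \<noteq> 0"
  unfolding qpoch_inf_def
proof (rule prodinf_nonzero[OF convergent_qpoch[OF assms(1)]])
  fix i
  have "norm (a * q ^ i) \<le> norm a * 1"
    unfolding norm_mult norm_power using assms by (intro mult_left_mono power_le_one) auto
  then show "1 - a * q ^ i \<noteq> 0" using assms by auto
qed

context
  fixes q :: real
  assumes q: "\<bar>q\<bar> < 1"
begin

lemma one_minus_power_pos: "1 - q ^ Suc i > 0"
proof -
  have "\<bar>q ^ Suc i\<bar> < 1" unfolding power_abs using q by (intro power_less_one_iff[THEN iffD2]) auto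
  then show ?thesis by simp
qed

lemma q_poch_pos: "q_poch q n > 0"
  unfolding q_poch_def using one_minus_power_pos by (intro prod_pos) auto

lemma q_poch_nz [simp]: "q_poch q n \<noteq> 0"
  using q_poch_pos[of n] by simp

lemma q_poch_LIMSEQ: "q_poch q \<longlonglongrightarrow> qpoch_inf q q"
proof -
  have "q_poch q = (\<lambda>n. \<Prod>i<n. 1 - q * q ^ i)" by (simp add: q_poch_def fun_eq_iff)
  then show ?thesis using qpoch_LIMSEQ[of q q] q by simp
qed

lemma qpoch_inf_qq_pos: "qpoch_inf q q > 0"
proof -
  have "qpoch_inf q q \<ge> 0"
    using q_poch_LIMSEQ q_poch_pos by (intro LIMSEQ_le_const[of "q_poch q"]) (auto intro: less_imp_le)
  then show ?thesis using qpoch_inf_nonzero[of q q] q by (simp add: less_le)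
qed

lemma inverse_q_poch_bounded:
  obtains C where "C > 0" "\<And>n. 1 / q_poch q n \<le> C"
proof -
  have "(\<lambda>n. 1 / q_poch q n) \<longlonglongrightarrow> 1 / qpoch_inf q q"
    using qpoch_inf_qq_pos by (intro tendsto_intros q_poch_LIMSEQ) simp
  then have "Bseq (\<lambda>n. 1 / q_poch q n)" by (rule convergent_imp_Bseq[OF convergentI])
  then obtain C where "C > 0" "\<forall>n. norm (1 / q_poch q n) \<le> C" by (rule BseqE)
  then show ?thesis using that[of C] q_poch_pos by (auto simp: abs_of_pos)
qed

lemma q_poch_bounded: obtains C where "C > 0" "\<And>n. q_poch q n \<le> C"
proof -
  have "Bseq (q_poch q)" by (rule convergent_imp_Bseq[OF convergentI[OF q_poch_LIMSEQ]])
  then obtain C where "C > 0" "\<forall>n. norm (q_poch q n) \<le> C" by (rule BseqE)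
  then show ?thesis using that[of C] by (auto simp: abs_le_iff)
qed

text \<open>
  The generating function is \<open>A(c) = 1 / ((c z; q)\<^sub>\<infinity> (c / z; q)\<^sub>\<infinity>)\<close> with \<open>z = e\<^bsup>i\<theta>\<^esup>\<close>, and
  \<open>A(q c) = (1 - c z) (1 - c / z) A(c)\<close>; comparing coefficients of \<open>c\<^bsup>n + 2\<^esup>\<close> gives the recurrence.
\<close>

lemma q_trig_recurrence:
  "(1 - q ^ Suc (Suc n)) * q_trig q (Suc (Suc n)) \<theta> = 2 * cos \<theta> * q_trig q (Suc n) \<theta> - q_trig q n \<theta>"
proof -
  \<comment> \<open>\<open>F z\<close> is Euler's series for \<open>1 / (c z; q)\<^sub>\<infinity>\<close> as a power series in \<open>c\<close>, and \<open>Fq z\<close> is the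
    same series at \<open>q c\<close>.\<close>
  define F where "F z = Abs_fps (\<lambda>k. z ^ k / of_real (q_poch q k))" for z :: complex
  define Fq where "Fq z = Abs_fps (\<lambda>k. of_real (q ^ k) * (z ^ k / of_real (q_poch q k)))" for z :: complex
  have Fq: "Fq z = (1 - fps_const z * fps_X) * F z" for z
  proof (rule fps_ext)
    fix n show "fps_nth (Fq z) n = fps_nth ((1 - fps_const z * fps_X) * F z) n"
    proof (cases n)
      case (Suc m)
      define e Q where "e = complex_of_real (q_poch q m)" and "Q = complex_of_real (q ^ Suc m)"
      have "1 - Q = of_real (1 - q ^ Suc m)" by (simp add: Q_def)
      then have nz: "1 - Q \<noteq> 0" using one_minus_power_pos[of m] by (metis less_irrefl of_real_eq_0_iff)
      have "e \<noteq> 0" by (simp add: e_def)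
      then have "Q * (z * z ^ m / (e * (1 - Q))) = z * z ^ m / (e * (1 - Q)) - z * (z ^ m / e)"
        using nz by (simp add: divide_simps) (simp add: algebra_simps)
      moreover have "complex_of_real (q_poch q (Suc m)) = e * (1 - Q)"
        by (simp add: q_poch_Suc e_def Q_def)
      ultimately have "Q * (z ^ Suc m / of_real (q_poch q (Suc m))) =
          z ^ Suc m / of_real (q_poch q (Suc m)) - z * (z ^ m / e)" by simp
      then show ?thesis using Suc
        by (simp add: Fq_def F_def left_diff_distrib mult.assoc e_def Q_def del: power_Suc)
    qed (simp add: Fq_def F_def)
  qed
  define z where "z = cis \<theta>"
  define A where "A = F z * F (cnj z)"
  have "Fq z * Fq (cnj z) = (1 - fps_const z * fps_X) * (1 - fps_const (cnj z) * fps_X) * A"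
    unfolding Fq A_def by (simp add: algebra_simps)
  also have "(1 - fps_const z * fps_X) * (1 - fps_const (cnj z) * fps_X) =
     1 - fps_const (z + cnj z) * fps_X + fps_const (z * cnj z) * fps_X ^ 2"
    by (simp add: algebra_simps power2_eq_square fps_const_add[symmetric] fps_const_mult[symmetric] del: fps_const_add fps_const_mult)
  also have "z * cnj z = 1" by (simp add: z_def cis_cnj cis_mult)
  also have "z + cnj z = of_real (2 * cos \<theta>)" by (simp add: z_def complex_add_cnj)
  finally have eq: "Fq z * Fq (cnj z) = A - fps_const (of_real (2 * cos \<theta>)) * (fps_X * A) + fps_X ^ 2 * A"
    by (simp add: algebra_simps)
  have qA: "fps_nth (Fq z * Fq (cnj z)) n = of_real (q ^ n) * fps_nth A n" for n
    unfolding fps_mult_nth A_def sum_distrib_left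
  proof (rule sum.cong[OF refl])
    fix i assume "i \<in> {0..n}"
    then have "q ^ n = q ^ i * q ^ (n - i)" by (simp add: power_add[symmetric])
    then show "fps_nth (Fq z) i * fps_nth (Fq (cnj z)) (n - i) = of_real (q ^ n) * (fps_nth (F z) i * fps_nth (F (cnj z)) (n - i))"
      by (simp add: Fq_def F_def)
  qed
  have rA: "Re (fps_nth A n) = q_trig q n \<theta>" for n
  proof -
    have "Re (fps_nth (F z) k * fps_nth (F (cnj z)) (n - k)) = cos ((2 * real k - real n) * \<theta>) / (q_poch q k * q_poch q (n - k))"
      if "k \<le> n" for k
    proof -
      have "z ^ k * cnj z ^ (n - k) = cis ((2 * real k - real n) * \<theta>)"
        using that by (simp add: z_def Complex.DeMoivre cis_cnj cis_mult of_nat_diff algebra_simps)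
      then have "fps_nth (F z) k * fps_nth (F (cnj z)) (n - k) =
          cis ((2 * real k - real n) * \<theta>) / of_real (q_poch q k * q_poch q (n - k))"
        by (simp add: F_def)
      then show ?thesis by (simp only: Re_divide_of_real cis.sel)
    qed
    then show ?thesis by (simp add: A_def fps_mult_nth q_trig_def atLeast0AtMost)
  qed
  have "of_real (q ^ Suc (Suc n)) * fps_nth A (Suc (Suc n)) =
      fps_nth A (Suc (Suc n)) - of_real (2 * cos \<theta>) * fps_nth A (Suc n) + fps_nth A n"
    using arg_cong[OF eq, of "\<lambda>f. fps_nth f (Suc (Suc n))"] unfolding qA
    by (simp add: fps_X_power_mult_nth)
  then have "q ^ Suc (Suc n) * q_trig q (Suc (Suc n)) \<theta> =
      q_trig q (Suc (Suc n)) \<theta> - 2 * cos \<theta> * q_trig q (Suc n) \<theta> + q_trig q n \<theta>"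
    by (simp add: complex_eq_iff rA del: power_Suc of_real_power of_real_mult)
  then show ?thesis by (simp add: algebra_simps)
qed

lemma q_trig_0 [simp]: "q_trig q 0 \<theta> = 1"
  by (simp add: q_trig_def)

lemma q_trig_1: "(1 - q) * q_trig q (Suc 0) \<theta> = 2 * cos \<theta>"
  using q by (auto simp: q_trig_def q_poch_Suc divide_simps)

text \<open>
  The coefficients \<open>1 / (q; q)\<^sub>k\<close> stay bounded, so the growth in \<open>n\<close> is at most linear.  This is what
  makes the Mehler series converge geometrically.
\<close>

lemma q_trig_bound:
  obtains C where "C > 0" "\<And>n \<theta>. \<bar>q_trig q n \<theta>\<bar> \<le> C * (real n + 1)"
proof -
  obtain C where C: "C > 0" "\<And>n. 1 / q_poch q n \<le> C" using inverse_q_poch_bounded by blast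
  have "\<bar>q_trig q n \<theta>\<bar> \<le> C * C * (real n + 1)" for n \<theta>
  proof -
    have "\<bar>q_trig q n \<theta>\<bar> \<le> (\<Sum>k\<le>n. \<bar>cos ((2 * real k - real n) * \<theta>) / (q_poch q k * q_poch q (n - k))\<bar>)"
      unfolding q_trig_def by (rule sum_abs)
    also have "\<dots> \<le> (\<Sum>k\<le>n. C * C)"
    proof (rule sum_mono)
      fix k
      have "\<bar>cos ((2 * real k - real n) * \<theta>) / (q_poch q k * q_poch q (n - k))\<bar> =
         \<bar>cos ((2 * real k - real n) * \<theta>)\<bar> * (1 / q_poch q k * (1 / q_poch q (n - k)))"
        using q_poch_pos[of k] q_poch_pos[of "n - k"] by (simp add: abs_mult)
      also have "\<dots> \<le> 1 * (C * C)"
        using C q_poch_pos less_imp_le[OF C(1)] by (intro mult_mono) (auto intro: less_imp_le)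
      finally show "\<bar>cos ((2 * real k - real n) * \<theta>) / (q_poch q k * q_poch q (n - k))\<bar> \<le> C * C" by simp
    qed
    also have "\<dots> = C * C * (real n + 1)" by (simp add: algebra_simps)
    finally show ?thesis .
  qed
  then show ?thesis using C(1) by (intro that[of "C * C"]) auto
qed

lemma q_hermite_eq_q_trig:
  assumes "t > 0"
  shows "poly (q_hermite q t n) (radius q t * cos \<theta>) = sqrt (t / (1 - q)) ^ n * q_poch q n * q_trig q n \<theta>"
proof -
  define c where "c = sqrt (t / (1 - q))"
  have c2: "c * c = t / (1 - q)" using assms q by (simp add: c_def)
  have r: "radius q t = 2 * c" by (simp add: c_def radius_def real_sqrt_divide)
  have "poly (q_hermite q t n) (radius q t * cos \<theta>) = c ^ n * q_poch q n * q_trig q n \<theta>"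
  proof (induction n rule: induct_nat_012)
    case 1
    have "c ^ Suc 0 * q_poch q (Suc 0) * q_trig q (Suc 0) \<theta> = c * ((1 - q) * q_trig q (Suc 0) \<theta>)"
      by (simp add: q_poch_Suc)
    also have "\<dots> = radius q t * cos \<theta>" unfolding q_trig_1 r by simp
    finally show ?case by simp
  next
    case (ge2 n)
    have "q_number q (Suc n) * (1 - q) = 1 - q ^ Suc n"
      unfolding q_number_def by (simp add: one_diff_power_eq mult.commute del: power_Suc)
    moreover have "q_number q (Suc n) * t = q_number q (Suc n) * (1 - q) * (t / (1 - q))" using q by simp
    ultimately have tq: "q_number q (Suc n) * t = c * c * (1 - q ^ Suc n)" unfolding c2 by simp
    have "c ^ Suc (Suc n) * q_poch q (Suc (Suc n)) * q_trig q (Suc (Suc n)) \<theta> =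
        c ^ Suc (Suc n) * q_poch q (Suc n) * ((1 - q ^ Suc (Suc n)) * q_trig q (Suc (Suc n)) \<theta>)"
      by (simp add: q_poch_Suc[of q "Suc n"])
    also have "\<dots> = (2 * c * cos \<theta>) * (c ^ Suc n * q_poch q (Suc n) * q_trig q (Suc n) \<theta>) -
       c * c * (1 - q ^ Suc n) * (c ^ n * q_poch q n * q_trig q n \<theta>)"
      unfolding q_trig_recurrence by (simp add: q_poch_Suc[of q n] algebra_simps)
    also have "\<dots> = poly (q_hermite q t (Suc (Suc n))) (radius q t * cos \<theta>)"
      unfolding ge2[symmetric] tq[symmetric] r by simp
    finally show ?case ..
  qed simp
  then show ?thesis by (simp add: c_def)
qed

end

section \<open>The Poisson-Mehler formula\<close>

text \<open>
  The coefficient of \<open>\<rho>\<^sup>n\<close> in the Mehler series \<open>\<Sum>\<^sub>n h\<^sub>n(\<theta>) h\<^sub>n(\<phi>) \<rho>\<^sup>n / (q; q)\<^sub>n\<close>.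
\<close>

definition mehler_term :: "real \<Rightarrow> real \<Rightarrow> real \<Rightarrow> nat \<Rightarrow> real" where
  "mehler_term q \<theta> \<phi> n = q_poch q n * q_trig q n \<theta> * q_trig q n \<phi>"

definition mehler_sum :: "real \<Rightarrow> real \<Rightarrow> real \<Rightarrow> real \<Rightarrow> real" where
  "mehler_sum q \<theta> \<phi> \<rho> = (\<Sum>n. mehler_term q \<theta> \<phi> n * \<rho> ^ n)"

lemma fps_nth_quartic_mult:
  fixes F :: "real fps"
  shows "fps_nth (fps_of_poly [:a, b, c, d, e:] * F) n = a * fps_nth F n +
    (if n < 1 then 0 else b * fps_nth F (n - 1)) + (if n < 2 then 0 else c * fps_nth F (n - 2)) +
    (if n < 3 then 0 else d * fps_nth F (n - 3)) + (if n < 4 then 0 else e * fps_nth F (n - 4))"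
proof -
  have "fps_of_poly [:a, b, c, d, e:] = fps_const a + fps_const b * fps_X ^ 1 + fps_const c * fps_X ^ 2 +
      fps_const d * fps_X ^ 3 + fps_const e * fps_X ^ 4"
    by (simp add: fps_of_poly_pCons fps_of_poly_const algebra_simps power2_eq_square power3_eq_cube power4_eq_xxxx)
  then show ?thesis
    by (simp only: distrib_right mult.assoc fps_X_power_mult_nth fps_add_nth fps_mult_left_const_nth) simp
qed

lemma nat_cases_below_3:
  obtains "n = 0" | "n = 1" | "n = 2" | m where "n = m + (3::nat)"
  by (metis One_nat_def Suc_1 add.commute less_2_cases less_eqE less_antisym numeral_3_eq_3 not_less)

text \<open>
  With \<open>x\<close> the cube root of \<open>r\<close>, two of the three factors \<open>x\<^sup>n\<close> absorb the polynomial growth.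
\<close>

lemma summable_square_geometric:
  assumes "0 \<le> r" "r < (1::real)"
  shows "summable (\<lambda>n. (real n + 1)\<^sup>2 * r ^ n)"
proof -
  define x where "x = root 3 r"
  have x: "0 \<le> x" "x < 1" "x ^ 3 = r" using assms by (simp_all add: x_def real_root_pow_pos2)
  have 1: "(real n + 1) * x ^ n \<le> 1 / (1 - x)" for n
  proof -
    have "(real n + 1) * x ^ n = (\<Sum>k<Suc n. x ^ n)" by simp
    also have "\<dots> \<le> (\<Sum>k<Suc n. x ^ k)" using x by (intro sum_mono power_decreasing) auto
    also have "\<dots> = (1 - x ^ Suc n) / (1 - x)" using x by (simp add: sum_gp_strict del: sum.lessThan_Suc power_Suc)
    also have "\<dots> \<le> 1 / (1 - x)" using x by (intro divide_right_mono) auto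
    finally show ?thesis .
  qed
  show ?thesis
  proof (rule summable_comparison_test')
    show "summable (\<lambda>n. (1 / (1 - x))\<^sup>2 * x ^ n)" using x by (intro summable_mult summable_geometric) auto
    fix n :: nat
    have "(real n + 1)\<^sup>2 * r ^ n = ((real n + 1) * x ^ n)\<^sup>2 * x ^ n"
      unfolding x(3)[symmetric] by (simp add: power_mult_distrib power_mult[symmetric] power_add[symmetric] mult.commute)
    also have "\<dots> \<le> (1 / (1 - x))\<^sup>2 * x ^ n" using x 1 by (intro mult_right_mono power_mono) auto
    finally show "norm ((real n + 1)\<^sup>2 * r ^ n) \<le> (1 / (1 - x))\<^sup>2 * x ^ n" using assms by simp
  qed
qed

lemma one_minus_cis_sq: "(cmod (1 - of_real \<rho> * cis \<alpha>))\<^sup>2 = 1 - 2 * \<rho> * cos \<alpha> + \<rho>\<^sup>2"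
proof -
  have "(cmod (1 - of_real \<rho> * cis \<alpha>))\<^sup>2 = (1 - \<rho> * cos \<alpha>)\<^sup>2 + (\<rho> * sin \<alpha>)\<^sup>2"
    by (simp add: cmod_power2)
  also have "\<dots> = 1 - 2 * \<rho> * cos \<alpha> + \<rho>\<^sup>2 * ((sin \<alpha>)\<^sup>2 + (cos \<alpha>)\<^sup>2)" by algebra
  finally show ?thesis by simp
qed

text \<open>
  The quartic is the factor that the infinite products in the denominator of the Mehler kernel lose
  when their parameter passes from \<open>\<rho>\<close> to \<open>q \<rho>\<close>.
\<close>

lemma mehler_quartic:
  fixes \<theta> \<phi> :: real
  defines "x \<equiv> 2 * cos \<theta>" and "y \<equiv> 2 * cos \<phi>"
  shows "poly [:1, - (x * y), x\<^sup>2 + y\<^sup>2 - 2, - (x * y), 1:] \<rho> =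
    (cmod (1 - of_real \<rho> * cis (\<phi> + \<theta>)))\<^sup>2 * (cmod (1 - of_real \<rho> * cis (\<phi> - \<theta>)))\<^sup>2"
proof -
  have 1: "(sin \<theta>)\<^sup>2 = 1 - (cos \<theta>)\<^sup>2" "(sin \<phi>)\<^sup>2 = 1 - (cos \<phi>)\<^sup>2" by (simp_all add: sin_squared_eq)
  show ?thesis
    unfolding one_minus_cis_sq cos_add cos_diff x_def y_def poly_pCons poly_0 using 1 by algebra
qed

context
  fixes q :: real
  assumes q: "\<bar>q\<bar> < 1"
begin

text \<open>
  The functional equation of the Mehler series on the level of coefficients.  With the three-term
  recurrences, the five consecutive terms involved reduce to the values of the polynomials at two
  consecutive indices, and what remains is a polynomial identity.
\<close>

lemma mehler_fps_identity:
  fixes \<theta> \<phi> :: real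
  defines "x \<equiv> 2 * cos \<theta>" and "y \<equiv> 2 * cos \<phi>"
  shows "fps_of_poly [:1, 0, - (1 + q), 0, q:] * Abs_fps (\<lambda>n. q ^ n * mehler_term q \<theta> \<phi> n) =
    fps_of_poly [:1, - (x * y), x\<^sup>2 + y\<^sup>2 - 2, - (x * y), 1:] * Abs_fps (mehler_term q \<theta> \<phi>)"
proof (rule fps_ext)
  fix n
  define a b where "a n = q_trig q n \<theta>" and "b n = q_trig q n \<phi>" for n
  have k: "mehler_term q \<theta> \<phi> n = q_poch q n * a n * b n" for n
    by (simp add: mehler_term_def a_def b_def)
  have ra: "(1 - q ^ Suc (Suc n)) * a (Suc (Suc n)) = x * a (Suc n) - a n" for n
    unfolding a_def x_def by (rule q_trig_recurrence[OF q])
  have rb: "(1 - q ^ Suc (Suc n)) * b (Suc (Suc n)) = y * b (Suc n) - b n" for n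
    unfolding b_def y_def by (rule q_trig_recurrence[OF q])
  have ab0: "a 0 = 1" "b 0 = 1" by (simp_all add: a_def b_def q_trig_0[OF q])
  have xy: "x = (1 - q) * a 1" "y = (1 - q) * b 1"
    using q_trig_1[OF q] by (simp_all add: a_def b_def x_def y_def)
  show "fps_nth (fps_of_poly [:1, 0, - (1 + q), 0, q:] * Abs_fps (\<lambda>n. q ^ n * mehler_term q \<theta> \<phi> n)) n =
    fps_nth (fps_of_poly [:1, - (x * y), x\<^sup>2 + y\<^sup>2 - 2, - (x * y), 1:] * Abs_fps (mehler_term q \<theta> \<phi>)) n"
  proof (cases n rule: nat_cases_below_3)
    case 1
    then show ?thesis unfolding fps_nth_quartic_mult fps_nth_Abs_fps by simp
  next
    case 2
    have "(1 - q) * (q_poch q 1 * a 1 * b 1) = x * y" by (simp add: xy q_poch_Suc)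
    then show ?thesis unfolding fps_nth_quartic_mult fps_nth_Abs_fps
      using 2 ab0 unfolding k by (simp add: algebra_simps)
  next
    case 3
    have "(1 - q ^ 2) * (q_poch q 2 * a 2 * b 2) =
        (1 - q) * ((1 - q ^ Suc (Suc 0)) * a (Suc (Suc 0))) * ((1 - q ^ Suc (Suc 0)) * b (Suc (Suc 0)))"
      by (simp add: q_poch_Suc numeral_2_eq_2)
    also have "\<dots> = (1 - q) * (x * a 1 - 1) * (y * b 1 - 1)" unfolding ra rb ab0 by simp
    finally have "(1 - q ^ 2) * (q_poch q 2 * a 2 * b 2) - x * y * (q_poch q 1 * a 1 * b 1)
        + (x\<^sup>2 + y\<^sup>2 - 2) + (1 + q) = 0"
      by (simp add: xy q_poch_Suc power2_eq_square algebra_simps)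
    then show ?thesis unfolding fps_nth_quartic_mult fps_nth_Abs_fps
      using 3 ab0 unfolding k by (simp add: algebra_simps)
  next
    case (4 m)
    \<comment> \<open>All terms are expressed through the indices \<open>m + 1\<close> and \<open>m + 2\<close>; the denominators are avoided by
      combining each factor \<open>1 - q\<^sup>k\<close> of \<open>q_poch\<close> with a recurrence.\<close>
    define p s where "p = q_poch q m" and "s = q ^ Suc m"
    have p1: "q_poch q (m + 1) = p * (1 - s)" by (simp add: p_def s_def q_poch_Suc)
    have p2: "q_poch q (m + 2) = p * (1 - s) * (1 - q * s)" using p1 by (simp add: s_def q_poch_Suc)
    have p3: "q_poch q (m + 3) = p * (1 - s) * (1 - q * s) * (1 - q\<^sup>2 * s)"
      using p2 q_poch_Suc[of q "m + 2"] by (simp add: s_def power2_eq_square numeral_3_eq_3)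
    have a0: "a m = x * a (m + 1) - (1 - q * s) * a (m + 2)" and b0: "b m = y * b (m + 1) - (1 - q * s) * b (m + 2)"
      using ra[of m] rb[of m] by (simp_all add: s_def)
    have a3: "(1 - q\<^sup>2 * s) * a (m + 3) = x * a (m + 2) - a (m + 1)"
      and b3: "(1 - q\<^sup>2 * s) * b (m + 3) = y * b (m + 2) - b (m + 1)"
      using ra[of "m + 1"] rb[of "m + 1"] by (simp_all add: s_def power2_eq_square numeral_3_eq_3 mult.assoc)
    have k3: "(1 - q ^ (m + 3)) * mehler_term q \<theta> \<phi> (m + 3) =
        p * (1 - s) * (1 - q * s) * (x * a (m + 2) - a (m + 1)) * (y * b (m + 2) - b (m + 1))"
    proof -
      have "q ^ (m + 3) = q\<^sup>2 * s" by (simp add: s_def power2_eq_square power_add numeral_3_eq_3)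
      then have "(1 - q ^ (m + 3)) * mehler_term q \<theta> \<phi> (m + 3) =
        p * (1 - s) * (1 - q * s) * ((1 - q\<^sup>2 * s) * a (m + 3)) * ((1 - q\<^sup>2 * s) * b (m + 3))"
        unfolding k p3 by simp
      then show ?thesis unfolding a3 b3 .
    qed
    have km1: "(if m < 1 then 0 else (1 - q ^ m) * mehler_term q \<theta> \<phi> (m - 1)) =
        p * (x * a m - (1 - s) * a (m + 1)) * (y * b m - (1 - s) * b (m + 1))"
    proof (cases m)
      case 0
      then show ?thesis using xy ab0 by (simp add: s_def)
    next
      case (Suc l)
      have "x * a m - (1 - s) * a (m + 1) = a l" "y * b m - (1 - s) * b (m + 1) = b l"
        using ra[of l] rb[of l] Suc by (simp_all add: s_def)
      then show ?thesis using Suc unfolding k p_def by (simp add: q_poch_Suc)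
    qed
    have "(1 - q ^ (m + 3)) * mehler_term q \<theta> \<phi> (m + 3) - x * y * mehler_term q \<theta> \<phi> (m + 2)
      + (x\<^sup>2 + y\<^sup>2 - 2 + (1 + q) * s) * mehler_term q \<theta> \<phi> (m + 1) - x * y * mehler_term q \<theta> \<phi> m
      + (if m < 1 then 0 else (1 - q ^ m) * mehler_term q \<theta> \<phi> (m - 1)) = 0"
      unfolding k3 km1 unfolding k p1 p2 p_def[symmetric] a0 b0 by algebra
    moreover have "q ^ (m + 1) = s" "q * q ^ (m - 1) = q ^ m" if "m \<ge> 1" using that
      by (simp_all add: s_def power_eq_if)
    ultimately show ?thesis unfolding fps_nth_quartic_mult fps_nth_Abs_fps
      using 4 by (cases m) (simp_all add: s_def algebra_simps numeral_3_eq_3 numeral_2_eq_2)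
  qed
qed

lemma mehler_term_bound:
  obtains C where "C > 0" "\<And>n \<theta> \<phi>. \<bar>mehler_term q \<theta> \<phi> n\<bar> \<le> C * (real n + 1)\<^sup>2"
proof -
  obtain A where A: "A > 0" "\<And>n \<theta>. \<bar>q_trig q n \<theta>\<bar> \<le> A * (real n + 1)" using q_trig_bound[OF q] by blast
  obtain B where B: "B > 0" "\<And>n. q_poch q n \<le> B" using q_poch_bounded[OF q] by blast
  have "\<bar>mehler_term q \<theta> \<phi> n\<bar> \<le> B * (A * (real n + 1)) * (A * (real n + 1))" for n \<theta> \<phi>
    unfolding mehler_term_def abs_mult
    using A B q_poch_pos[OF q, of n] by (intro mult_mono) (auto intro: mult_nonneg_nonneg less_imp_le)
  then show ?thesis using A(1) B(1) by (intro that[of "B * A * A"]) (auto simp: power2_eq_square mult_ac)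
qed

lemma mehler_term_summable:
  assumes "\<bar>r\<bar> < 1"
  shows "summable (\<lambda>n. mehler_term q \<theta> \<phi> n * r ^ n)"
proof -
  obtain C where C: "C > 0" "\<And>n. \<bar>mehler_term q \<theta> \<phi> n\<bar> \<le> C * (real n + 1)\<^sup>2"
    using mehler_term_bound by metis
  show ?thesis
  proof (rule summable_comparison_test')
    show "summable (\<lambda>n. C * ((real n + 1)\<^sup>2 * \<bar>r\<bar> ^ n))"
      using assms by (intro summable_mult summable_square_geometric) auto
    show "norm (mehler_term q \<theta> \<phi> n * r ^ n) \<le> C * ((real n + 1)\<^sup>2 * \<bar>r\<bar> ^ n)" for n
      using mult_right_mono[OF C(2)[of n], of "\<bar>r\<bar> ^ n"] by (simp add: abs_mult power_abs mult_ac)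
  qed
qed

lemma mehler_conv_radius: "fps_conv_radius (Abs_fps (mehler_term q \<theta> \<phi>)) \<ge> 1"
  unfolding fps_conv_radius_def
  by (rule conv_radius_geI_ex') (auto intro!: mehler_term_summable)

lemma mehler_conv_radius': "fps_conv_radius (Abs_fps (\<lambda>n. q ^ n * mehler_term q \<theta> \<phi> n)) \<ge> 1"
  unfolding fps_conv_radius_def
proof (rule conv_radius_geI_ex')
  fix r assume "0 < r" "ereal r < 1"
  then have r: "0 < r" "r < 1" by auto
  have "\<bar>q * r\<bar> \<le> \<bar>q\<bar> * 1" unfolding abs_mult using r by (intro mult_left_mono) auto
  then have "summable (\<lambda>n. mehler_term q \<theta> \<phi> n * (q * r) ^ n)"
    using q by (intro mehler_term_summable) auto
  then show "summable (\<lambda>n. fps_nth (Abs_fps (\<lambda>n. q ^ n * mehler_term q \<theta> \<phi> n)) n * of_real r ^ n)"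
    by (simp add: power_mult_distrib mult_ac)
qed

lemma mehler_functional_equation:
  assumes r: "\<bar>\<rho>\<bar> < 1"
  shows "(1 - \<rho>\<^sup>2) * (1 - q * \<rho>\<^sup>2) * mehler_sum q \<theta> \<phi> (q * \<rho>) =
    (cmod (1 - of_real \<rho> * cis (\<phi> + \<theta>)))\<^sup>2 * (cmod (1 - of_real \<rho> * cis (\<phi> - \<theta>)))\<^sup>2 * mehler_sum q \<theta> \<phi> \<rho>"
proof -
  have r': "ereal (norm \<rho>) < 1" using r by simp
  have e: "eval_fps (Abs_fps (mehler_term q \<theta> \<phi>)) \<rho> = mehler_sum q \<theta> \<phi> \<rho>"
    "eval_fps (Abs_fps (\<lambda>n. q ^ n * mehler_term q \<theta> \<phi> n)) \<rho> = mehler_sum q \<theta> \<phi> (q * \<rho>)"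
    by (simp_all add: eval_fps_def mehler_sum_def power_mult_distrib mult_ac)
  have "eval_fps (fps_of_poly [:1, 0, - (1 + q), 0, q:] * Abs_fps (\<lambda>n. q ^ n * mehler_term q \<theta> \<phi> n)) \<rho> =
      poly [:1, 0, - (1 + q), 0, q:] \<rho> * mehler_sum q \<theta> \<phi> (q * \<rho>)"
    using less_le_trans[OF r' mehler_conv_radius'] by (subst eval_fps_mult) (simp_all only: eval_fps_of_poly fps_conv_radius_fps_of_poly e, simp_all)
  moreover have "eval_fps (fps_of_poly p * Abs_fps (mehler_term q \<theta> \<phi>)) \<rho> = poly p \<rho> * mehler_sum q \<theta> \<phi> \<rho>" for p
    using less_le_trans[OF r' mehler_conv_radius] by (subst eval_fps_mult) (simp_all only: eval_fps_of_poly fps_conv_radius_fps_of_poly e, simp_all)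
  moreover have "poly [:1, 0, - (1 + q), 0, q:] \<rho> = (1 - \<rho>\<^sup>2) * (1 - q * \<rho>\<^sup>2)"
    by (simp add: power2_eq_square algebra_simps)
  ultimately show ?thesis
    unfolding mehler_fps_identity by (simp only: mehler_quartic)
qed

text \<open>
  The functional equation applied \<open>N\<close> times, starting from \<open>\<rho> = q\<close>.
\<close>

lemma mehler_iterate:
  "mehler_sum q \<theta> \<phi> q * (\<Prod>i<N. (cmod (1 - of_real (q ^ Suc i) * cis (\<phi> + \<theta>)))\<^sup>2 * (cmod (1 - of_real (q ^ Suc i) * cis (\<phi> - \<theta>)))\<^sup>2) =
   mehler_sum q \<theta> \<phi> (q ^ Suc N) * (\<Prod>j<2 * N. 1 - q\<^sup>2 * q ^ j)"
proof (induction N)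
  case (Suc N)
  let ?Q = "\<lambda>i. (cmod (1 - of_real (q ^ Suc i) * cis (\<phi> + \<theta>)))\<^sup>2 * (cmod (1 - of_real (q ^ Suc i) * cis (\<phi> - \<theta>)))\<^sup>2"
  have "\<bar>q ^ Suc N\<bar> < 1" unfolding power_abs using q by (intro power_less_one_iff[THEN iffD2]) auto
  from mehler_functional_equation[OF this]
  have f: "?Q N * mehler_sum q \<theta> \<phi> (q ^ Suc N) =
     (1 - (q ^ Suc N)\<^sup>2) * (1 - q * (q ^ Suc N)\<^sup>2) * mehler_sum q \<theta> \<phi> (q ^ Suc (Suc N))" by simp
  have "(\<Prod>j<2 * Suc N. 1 - q\<^sup>2 * q ^ j) = (\<Prod>j<2 * N. 1 - q\<^sup>2 * q ^ j) * ((1 - (q ^ Suc N)\<^sup>2) * (1 - q * (q ^ Suc N)\<^sup>2))"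
    by (simp add: power2_eq_square power_add mult_2 mult_2_right mult_ac)
  note step = this
  have "mehler_sum q \<theta> \<phi> q * (\<Prod>i<Suc N. ?Q i) = (mehler_sum q \<theta> \<phi> q * (\<Prod>i<N. ?Q i)) * ?Q N"
    by (simp only: prod.lessThan_Suc mult.assoc)
  also have "\<dots> = (?Q N * mehler_sum q \<theta> \<phi> (q ^ Suc N)) * (\<Prod>j<2 * N. 1 - q\<^sup>2 * q ^ j)"
    unfolding Suc by (simp only: mult_ac)
  also have "\<dots> = mehler_sum q \<theta> \<phi> (q ^ Suc (Suc N)) * (\<Prod>j<2 * Suc N. 1 - q\<^sup>2 * q ^ j)"
    unfolding f step by (simp only: mult_ac)
  finally show ?case .
qed simp

lemma abs_qpoch_cis_LIMSEQ:
  "(\<lambda>N. \<Prod>i<N. (cmod (1 - of_real (q ^ Suc i) * cis \<alpha>))\<^sup>2) \<longlonglongrightarrow> (abs_qpoch_cis q \<alpha>)\<^sup>2"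
proof -
  have "(\<lambda>N. \<Prod>i<N. 1 - (of_real q * cis \<alpha>) * of_real q ^ i) \<longlonglongrightarrow> qpoch_inf (of_real q * cis \<alpha>) (of_real q)"
    using q by (intro qpoch_LIMSEQ) simp
  then have "(\<lambda>N. (cmod (\<Prod>i<N. 1 - (of_real q * cis \<alpha>) * of_real q ^ i))\<^sup>2) \<longlonglongrightarrow> (abs_qpoch_cis q \<alpha>)\<^sup>2"
    unfolding abs_qpoch_cis_def by (intro tendsto_intros)
  then show ?thesis by (simp add: prod_norm[symmetric] prod_power_distrib mult_ac)
qed

lemma abs_qpoch_cis_nonzero: "abs_qpoch_cis q \<alpha> \<noteq> 0"
  using qpoch_inf_nonzero[of "of_real q" "of_real q * cis \<alpha>"] q by (simp add: abs_qpoch_cis_def norm_mult)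

text \<open>
  In the iterated functional equation the remaining series is taken at \<open>q\<^bsup>N + 1\<^esup>\<close>, and it tends to its
  value \<open>1\<close> at \<open>0\<close>.
\<close>

theorem poisson_mehler:
  "mehler_sum q \<theta> \<phi> q = qpoch_inf (q\<^sup>2) q / (abs_qpoch_cis q (\<phi> + \<theta>) * abs_qpoch_cis q (\<phi> - \<theta>))\<^sup>2"
proof -
  have "isCont (eval_fps (Abs_fps (mehler_term q \<theta> \<phi>))) 0"
    using less_le_trans[OF _ mehler_conv_radius] by (intro continuous_eval_fps) simp
  moreover have "eval_fps (Abs_fps (mehler_term q \<theta> \<phi>)) = mehler_sum q \<theta> \<phi>"
    by (simp add: fun_eq_iff eval_fps_def mehler_sum_def)
  ultimately have c: "isCont (mehler_sum q \<theta> \<phi>) 0" by simp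
  have "(\<lambda>N. q ^ Suc N) \<longlonglongrightarrow> 0" using q by (intro LIMSEQ_Suc LIMSEQ_abs_realpow_zero2)
  then have 1: "(\<lambda>N. mehler_sum q \<theta> \<phi> (q ^ Suc N)) \<longlonglongrightarrow> mehler_sum q \<theta> \<phi> 0"
    using c by (rule isCont_tendsto_compose[rotated])
  have "mehler_sum q \<theta> \<phi> 0 = 1"
    unfolding mehler_sum_def powser_zero by (simp add: mehler_term_def q_trig_0[OF q])
  moreover have "(\<lambda>N. \<Prod>j<2 * N. 1 - q\<^sup>2 * q ^ j) \<longlonglongrightarrow> qpoch_inf (q\<^sup>2) q"
    using filterlim_compose[OF qpoch_LIMSEQ[of q "q\<^sup>2"] mult_nat_left_at_top[of 2]] q by simp
  ultimately have "(\<lambda>N. mehler_sum q \<theta> \<phi> (q ^ Suc N) * (\<Prod>j<2 * N. 1 - q\<^sup>2 * q ^ j)) \<longlonglongrightarrow> 1 * qpoch_inf (q\<^sup>2) q"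
    using 1 by (intro tendsto_mult) auto
  moreover have "(\<lambda>N. mehler_sum q \<theta> \<phi> q * (\<Prod>i<N. (cmod (1 - of_real (q ^ Suc i) * cis (\<phi> + \<theta>)))\<^sup>2 * (cmod (1 - of_real (q ^ Suc i) * cis (\<phi> - \<theta>)))\<^sup>2))
     \<longlonglongrightarrow> mehler_sum q \<theta> \<phi> q * ((abs_qpoch_cis q (\<phi> + \<theta>))\<^sup>2 * (abs_qpoch_cis q (\<phi> - \<theta>))\<^sup>2)"
    unfolding prod.distrib by (intro tendsto_mult tendsto_const abs_qpoch_cis_LIMSEQ)
  ultimately have "mehler_sum q \<theta> \<phi> q * ((abs_qpoch_cis q (\<phi> + \<theta>))\<^sup>2 * (abs_qpoch_cis q (\<phi> - \<theta>))\<^sup>2) = qpoch_inf (q\<^sup>2) q"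
    unfolding mehler_iterate using LIMSEQ_unique by fastforce
  then show ?thesis using abs_qpoch_cis_nonzero by (simp add: field_simps power_mult_distrib)
qed

end

section \<open>Orthogonality of the q-Hermite polynomials\<close>

text \<open>
  The functional equation of the theta series.  The powers of \<open>q\<close> stand on both sides, rather than as a
  quotient, in order to have natural exponents and to include \<open>q = 0\<close>.
\<close>

lemma theta_coeff_shift:
  assumes "int x - int y = i"
  shows "q ^ y * theta_coeff q (i + 1) = - (q ^ x * theta_coeff q i)"
proof -
  have nonneg: "j * (j - 1) div 2 \<ge> 0" for j :: int
  proof -
    have "j * (j - 1) \<ge> 0" by (cases "j \<ge> 1") (auto intro: mult_nonneg_nonneg mult_nonpos_nonpos)
    then show ?thesis by simp
  qed
  have "(i + 1) * (i + 1 - 1) = i * (i - 1) + i * 2" by (simp add: algebra_simps)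
  then have "(i + 1) * (i + 1 - 1) div 2 = i * (i - 1) div 2 + i" by simp
  then have "y + nat ((i + 1) * (i + 1 - 1) div 2) = x + nat (i * (i - 1) div 2)"
    using nonneg[of i] nonneg[of "i + 1"] assms by linarith
  then have "q ^ y * q ^ nat ((i + 1) * (i + 1 - 1) div 2) = q ^ x * q ^ nat (i * (i - 1) div 2)"
    by (simp only: power_add[symmetric])
  then show ?thesis by (simp add: theta_coeff_def)
qed

lemma theta_coeff_0 [simp]: "theta_coeff q 0 = 1" by (simp add: theta_coeff_def)

text \<open>
  \<open>u\<^sup>b\<close> times the finite theta product
  \<open>\<Prod>\<^sub>j\<^sub><\<^sub>a (1 - q\<^sup>j u) \<Prod>\<^sub>j\<^sub><\<^sub>b (1 - q\<^bsup>j + 1\<^esup> / u)\<close>; the factor clears the negative powers of \<open>u\<close>.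
\<close>

definition jacobi_poly :: "real \<Rightarrow> nat \<Rightarrow> nat \<Rightarrow> complex poly" where
  "jacobi_poly q a b = (\<Prod>j<a. [:1, - of_real (q ^ j):]) * (\<Prod>j<b. [:- of_real (q ^ Suc j), 1:])"

text \<open>
  The weight of the q-Hermite polynomials, with respect to the angle and before normalization.
\<close>

definition q_hermite_weight :: "real \<Rightarrow> real \<Rightarrow> real" where
  "q_hermite_weight q \<theta> = 4 * (sin \<theta>)\<^sup>2 * (abs_qpoch_cis q (2 * \<theta>))\<^sup>2"

definition q_hermite_weight_trunc :: "real \<Rightarrow> nat \<Rightarrow> real \<Rightarrow> real" where
  "q_hermite_weight_trunc q N \<theta> = 4 * (sin \<theta>)\<^sup>2 * (\<Prod>j<N. (cmod (1 - of_real (q ^ Suc j) * cis (2 * \<theta>)))\<^sup>2)"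

abbreviation half_circle :: "real measure" where "half_circle \<equiv> restrict_space lborel {0..pi}"

lemma half_circle_finite: "finite_measure half_circle"
  by (rule finite_measureI) (simp add: emeasure_restrict_space space_restrict_space)

lemma half_circle_measurable: "f \<in> borel_measurable borel \<Longrightarrow> f \<in> borel_measurable half_circle"
  by (rule measurable_restrict_space1) simp

lemma half_circle_integrable:
  fixes f :: "real \<Rightarrow> real"
  assumes "f \<in> borel_measurable borel" "\<And>\<theta>. \<bar>f \<theta>\<bar> \<le> B"
  shows "integrable half_circle f"
  using assms by (intro finite_measure.integrable_const_bound[OF half_circle_finite, of _ B] half_circle_measurable) auto

lemma integral_half_circle_cos: "(\<integral>\<theta>. cos (of_int m * \<theta>) \<partial>half_circle) = (if m = 0 then pi else 0)"
proof -
  have "(\<integral>\<theta>. cos (of_int m * \<theta>) \<partial>half_circle) = (\<integral>\<theta>. cos (of_int m * \<theta>) * indicator {0..pi} \<theta> \<partial>lborel)"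
    by (subst integral_restrict_space) (simp_all add: mult.commute)
  also have "\<dots> = (if m = 0 then pi else 0)"
  proof (cases "m = 0")
    case True
    then show ?thesis using integral_FTC_Icc_real[of 0 pi "\<lambda>x. x" "\<lambda>x. 1"] by simp
  next
    case False
    have "(\<integral>\<theta>. cos (of_int m * \<theta>) * indicator {0..pi} \<theta> \<partial>lborel) =
        sin (of_int m * pi) / of_int m - sin (of_int m * 0) / of_int m"
      using False by (intro integral_FTC_Icc_real) (auto intro!: derivative_eq_intros)
    then show ?thesis using False by (simp add: sin_times_pi_eq_0)
  qed
  finally show ?thesis .
qed

lemma integral_half_circle_cos_cos:
  "(\<integral>\<theta>. cos (of_int m * \<theta>) * (2 * cos (of_int l * \<theta>)) \<partial>half_circle) =
   pi * ((if m = l then 1 else 0) + (if m = - l then 1 else 0))"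
proof -
  have i: "integrable half_circle (\<lambda>\<theta>. cos (of_int k * \<theta>))" for k :: int
    by (rule half_circle_integrable[of _ 1]) (auto intro!: borel_measurable_continuous_onI continuous_on_mult continuous_on_cos continuous_on_const continuous_on_id)
  have "cos (of_int m * \<theta>) * (2 * cos (of_int l * \<theta>)) = cos (of_int (m - l) * \<theta>) + cos (of_int (m + l) * \<theta>)" for \<theta> :: real
    using cos_times_cos[of "of_int m * \<theta>" "of_int l * \<theta>"] by (simp add: algebra_simps)
  then show ?thesis using i by (simp add: integral_half_circle_cos add_eq_0_iff del: of_int_add of_int_diff)
qed

context
  fixes q :: real
  assumes q: "\<bar>q\<bar> < 1"
begin

lemma q_binom_0: "q_binom q n 0 = 1"
  using q_poch_nz[OF q] by (simp add: q_binom_def)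

lemma q_binom_pascal:
  shows "q_binom q (Suc n) (Suc k) = q_binom q n (Suc k) + q ^ (n - k) * q_binom q n k"
    and "q_binom q (Suc n) (Suc k) = q_binom q n k + q ^ Suc k * q_binom q n (Suc k)"
proof -
  note nz = q_poch_nz[OF q]
  consider "k > n" | "k = n" | l where "n = Suc (k + l)"
    by (metis less_imp_Suc_add linorder_neqE_nat add_Suc_right)
  then have "q_binom q (Suc n) (Suc k) = q_binom q n (Suc k) + q ^ (n - k) * q_binom q n k \<and>
     q_binom q (Suc n) (Suc k) = q_binom q n k + q ^ Suc k * q_binom q n (Suc k)"
  proof cases
    case (3 l)
    define P u v where "P = q_poch q n / (q_poch q (Suc k) * q_poch q (Suc l))"
      and "u = q ^ Suc k" and "v = q ^ Suc l"
    have nz': "1 - u \<noteq> 0" "1 - v \<noteq> 0" using one_minus_power_pos[OF q] unfolding u_def v_def by (metis less_irrefl)+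
    have 1: "q_binom q (Suc n) (Suc k) = P * (1 - u * v)"
    proof -
      have "q ^ Suc n = u * v" using 3 by (simp add: u_def v_def power_add)
      then have "q_poch q (Suc n) = q_poch q n * (1 - u * v)" by (simp only: q_poch_Suc)
      moreover have "Suc k \<le> Suc n" "Suc n - Suc k = Suc l" using 3 by auto
      ultimately show ?thesis unfolding q_binom_def P_def by simp
    qed
    have 2: "q_binom q n (Suc k) = P * (1 - v)"
      using 3 nz nz' by (simp add: q_binom_def P_def q_poch_Suc[of q l] v_def[symmetric] del: power_Suc)
    have 4: "q_binom q n k = P * (1 - u)"
      using 3 nz nz' by (simp add: q_binom_def P_def q_poch_Suc[of q k] u_def[symmetric] del: power_Suc)
    have 5: "q ^ (n - k) = v" using 3 by (simp add: v_def)
    show ?thesis unfolding 1 2 4 5 u_def[symmetric] by (simp add: algebra_simps)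
  qed (use nz in \<open>auto simp: q_binom_def\<close>)
  then show "q_binom q (Suc n) (Suc k) = q_binom q n (Suc k) + q ^ (n - k) * q_binom q n k"
    "q_binom q (Suc n) (Suc k) = q_binom q n k + q ^ Suc k * q_binom q n (Suc k)" by auto
qed

text \<open>
  The finite form of the Jacobi triple product.  Adding a factor to either product is a q-Pascal rule for the
  coefficients.
\<close>

lemma coeff_jacobi_poly:
  "coeff (jacobi_poly q a b) j = of_real (theta_coeff q (int j - int b) * q_binom q (a + b) j)"
proof (induction a arbitrary: j)
  case 0
  show ?case
  proof (induction b arbitrary: j)
    case 0
    show ?case using q_poch_nz[OF q] by (cases j) (simp_all add: jacobi_poly_def q_binom_def)
  next
    case (Suc b)
    have s: "jacobi_poly q 0 (Suc b) = pCons 0 (jacobi_poly q 0 b) - smult (of_real (q ^ Suc b)) (jacobi_poly q 0 b)"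
      by (simp add: jacobi_poly_def algebra_simps)
    show ?case
    proof (cases j)
      case 0
      have "q ^ Suc b * theta_coeff q (- int b) = - theta_coeff q (- 1 - int b)"
        using theta_coeff_shift[of 0 "Suc b" "- 1 - int b" q] by simp
      then show ?thesis using 0 unfolding s by (simp add: Suc q_binom_0 flip: of_real_mult of_real_power of_real_minus)
    next
      case (Suc k)
      have "q ^ Suc b * theta_coeff q (int k - int b + 1) = - (q ^ Suc k * theta_coeff q (int k - int b))"
        by (rule theta_coeff_shift) simp
      then have t: "q ^ Suc b * theta_coeff q (int (Suc k) - int b) = - (q ^ Suc k * theta_coeff q (int k - int b))"
        by (simp add: algebra_simps)
      have "coeff (jacobi_poly q 0 (Suc b)) j = of_real (theta_coeff q (int k - int b) * q_binom q b k
         - (q ^ Suc b * theta_coeff q (int (Suc k) - int b)) * q_binom q b (Suc k))"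
        unfolding s using Suc by (simp add: Suc.IH)
      then show ?thesis unfolding t Suc add_0 q_binom_pascal(2) by (simp add: algebra_simps)
    qed
  qed
next
  case (Suc a)
  have s: "jacobi_poly q (Suc a) b = jacobi_poly q a b - smult (of_real (q ^ a)) (pCons 0 (jacobi_poly q a b))"
    by (simp add: jacobi_poly_def algebra_simps)
  show ?case
  proof (cases j)
    case 0
    then show ?thesis unfolding s by (simp add: Suc q_binom_0)
  next
    case (Suc k)
    have t: "- (q ^ a * theta_coeff q (int k - int b) * q_binom q (a + b) k) =
        theta_coeff q (int (Suc k) - int b) * (q ^ (a + b - k) * q_binom q (a + b) k)"
    proof (cases "k \<le> a + b")
      case True
      have "q ^ (a + b - k) * theta_coeff q (int k - int b + 1) = - (q ^ a * theta_coeff q (int k - int b))"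
        using True by (intro theta_coeff_shift) simp
      then show ?thesis by (simp add: algebra_simps)
    qed (simp add: q_binom_def)
    have "coeff (jacobi_poly q (Suc a) b) j = of_real (theta_coeff q (int (Suc k) - int b) * q_binom q (a + b) (Suc k)
         + - (q ^ a * theta_coeff q (int k - int b) * q_binom q (a + b) k))"
      unfolding s using Suc by (simp add: Suc.IH)
    then show ?thesis unfolding t Suc add_Suc q_binom_pascal(1) by (simp add: algebra_simps)
  qed
qed

text \<open>
  At \<open>u = e\<^bsup>2i\<theta>\<^esup>\<close>, the theta product with \<open>N + 1\<close> factors of the first kind and \<open>N\<close> of the second is
  \<open>(1 - u) \<Prod>\<^sub>j\<^sub><\<^sub>N |1 - q\<^bsup>j + 1\<^esup> u|\<^sup>2\<close>, and the real part of \<open>1 - u\<close> is \<open>2 sin\<^sup>2 \<theta>\<close>.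
\<close>

lemma q_hermite_weight_trunc_fourier:
  "q_hermite_weight_trunc q N \<theta> = (\<Sum>j\<le>2 * N + 1. theta_coeff q (int j - int N) * q_binom q (2 * N + 1) j *
     (2 * cos (of_int (2 * (int j - int N)) * \<theta>)))"
proof -
  define u where "u = cis (2 * \<theta>)"
  have uu: "u * cnj u = 1" by (simp add: u_def cis_cnj cis_mult)
  let ?J = "jacobi_poly q (Suc N) N"
  let ?G = "\<Prod>j<N. (cmod (1 - of_real (q ^ Suc j) * u))\<^sup>2"
  have "poly ?J u * cnj u ^ N = (1 - u) * ((\<Prod>j<N. 1 - of_real (q ^ Suc j) * u) *
      (\<Prod>j<N. (u - of_real (q ^ Suc j)) * cnj u))"
    by (simp add: jacobi_poly_def poly_prod prod.lessThan_Suc_shift prod.distrib mult.assoc del: prod.lessThan_Suc)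
      (simp add: algebra_simps)
  also have "(\<Prod>j<N. (u - of_real (q ^ Suc j)) * cnj u) = (\<Prod>j<N. cnj (1 - of_real (q ^ Suc j) * u))"
    using uu by (intro prod.cong) (simp_all add: left_diff_distrib)
  also have "(\<Prod>j<N. 1 - of_real (q ^ Suc j) * u) * (\<Prod>j<N. cnj (1 - of_real (q ^ Suc j) * u)) = of_real ?G"
    unfolding prod.distrib[symmetric] complex_norm_square[symmetric] by simp
  finally have 1: "poly ?J u * cnj u ^ N = (1 - u) * of_real ?G" .
  have "degree ?J \<le> 2 * N + 1"
    by (rule degree_le) (auto simp: coeff_jacobi_poly q_binom_def)
  then have "poly ?J u = (\<Sum>j\<le>2 * N + 1. coeff ?J j * u ^ j)"
    unfolding poly_altdef by (intro sum.mono_neutral_left) (auto simp: coeff_eq_0)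
  then have "poly ?J u * cnj u ^ N = (\<Sum>j\<le>2 * N + 1. coeff ?J j * (u ^ j * cnj u ^ N))"
    by (simp only: sum_distrib_right mult.assoc)
  also have "\<dots> = (\<Sum>j\<le>2 * N + 1. of_real (theta_coeff q (int j - int N) * q_binom q (2 * N + 1) j) *
      cis (of_int (2 * (int j - int N)) * \<theta>))"
  proof (rule sum.cong[OF refl])
    fix j
    have "u ^ j * cnj u ^ N = cis (of_int (2 * (int j - int N)) * \<theta>)"
      by (simp add: u_def cis_cnj Complex.DeMoivre cis_mult algebra_simps)
    moreover have "Suc N + N = 2 * N + 1" by simp
    ultimately show "coeff ?J j * (u ^ j * cnj u ^ N) = of_real (theta_coeff q (int j - int N) * q_binom q (2 * N + 1) j) *
      cis (of_int (2 * (int j - int N)) * \<theta>)" by (simp only: coeff_jacobi_poly)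
  qed
  finally have "Re ((1 - u) * of_real ?G) = (\<Sum>j\<le>2 * N + 1. theta_coeff q (int j - int N) * q_binom q (2 * N + 1) j *
      cos (of_int (2 * (int j - int N)) * \<theta>))"
    unfolding 1 by (simp del: of_int_mult of_int_diff)
  moreover have "Re ((1 - u) * of_real g) = 2 * (sin \<theta>)\<^sup>2 * g" for g
    by (simp add: u_def cos_double_sin)
  note this[of ?G]
  ultimately have "2 * (2 * (sin \<theta>)\<^sup>2 * ?G) = 2 * (\<Sum>j\<le>2 * N + 1. theta_coeff q (int j - int N) * q_binom q (2 * N + 1) j *
      cos (of_int (2 * (int j - int N)) * \<theta>))" by simp
  then show ?thesis by (simp add: q_hermite_weight_trunc_def u_def sum_distrib_left mult_ac)
qed

lemma q_hermite_weight_trunc_LIMSEQ: "(\<lambda>N. q_hermite_weight_trunc q N \<theta>) \<longlonglongrightarrow> q_hermite_weight q \<theta>"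
  unfolding q_hermite_weight_trunc_def q_hermite_weight_def
  by (intro tendsto_intros abs_qpoch_cis_LIMSEQ[OF q])

lemma norm_prod_cis_bound:
  obtains C where "\<And>N \<alpha>. (\<Prod>j<N. cmod (1 - of_real (q ^ Suc j) * cis \<alpha>)) \<le> C"
proof -
  have "(\<lambda>N. \<Prod>i<N. 1 - (- \<bar>q\<bar>) * \<bar>q\<bar> ^ i) \<longlonglongrightarrow> qpoch_inf (- \<bar>q\<bar>) \<bar>q\<bar>"
    using q by (intro qpoch_LIMSEQ) simp
  then have "Bseq (\<lambda>N. \<Prod>i<N. 1 - (- \<bar>q\<bar>) * \<bar>q\<bar> ^ i)" by (rule convergent_imp_Bseq[OF convergentI])
  then obtain C where C: "\<forall>N. norm (\<Prod>i<N. 1 - (- \<bar>q\<bar>) * \<bar>q\<bar> ^ i) \<le> C" by (rule BseqE)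
  have "(\<Prod>j<N. cmod (1 - of_real (q ^ Suc j) * cis \<alpha>)) \<le> C" for N \<alpha>
  proof -
    have "(\<Prod>j<N. cmod (1 - of_real (q ^ Suc j) * cis \<alpha>)) \<le> (\<Prod>i<N. 1 - (- \<bar>q\<bar>) * \<bar>q\<bar> ^ i)"
    proof (intro prod_mono conjI)
      fix j
      have "cmod (1 - of_real (q ^ Suc j) * cis \<alpha>) \<le> cmod 1 + cmod (of_real (q ^ Suc j) * cis \<alpha>)"
        by (rule norm_triangle_ineq4)
      then show "cmod (1 - of_real (q ^ Suc j) * cis \<alpha>) \<le> 1 - (- \<bar>q\<bar>) * \<bar>q\<bar> ^ j"
        by (simp add: norm_mult norm_power)
    qed simp
    also have "\<dots> \<le> C" using C by (auto simp: abs_le_iff)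
    finally show ?thesis .
  qed
  then show ?thesis by (rule that)
qed

lemma abs_qpoch_cis_sq_bound: obtains C where "\<And>\<alpha>. (abs_qpoch_cis q \<alpha>)\<^sup>2 \<le> C"
proof -
  obtain C where C: "\<And>N \<alpha>. (\<Prod>j<N. cmod (1 - of_real (q ^ Suc j) * cis \<alpha>)) \<le> C"
    using norm_prod_cis_bound by blast
  have "(abs_qpoch_cis q \<alpha>)\<^sup>2 \<le> C\<^sup>2" for \<alpha>
  proof (rule LIMSEQ_le_const2[OF abs_qpoch_cis_LIMSEQ[OF q]])
    have "(\<Prod>j<N. cmod (1 - of_real (q ^ Suc j) * cis \<alpha>))\<^sup>2 \<le> C\<^sup>2" for N
      by (intro power_mono C prod_nonneg) simp
    then show "\<exists>N. \<forall>n\<ge>N. (\<Prod>i<n. (cmod (1 - of_real (q ^ Suc i) * cis \<alpha>))\<^sup>2) \<le> C\<^sup>2"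
      by (simp add: prod_power_distrib)
  qed
  then show ?thesis by (rule that)
qed

lemma abs_qpoch_cis_measurable: "abs_qpoch_cis q \<in> borel_measurable borel"
proof -
  have "(\<lambda>\<alpha>. (abs_qpoch_cis q \<alpha>)\<^sup>2) \<in> borel_measurable borel"
  proof (rule borel_measurable_LIMSEQ_real[OF abs_qpoch_cis_LIMSEQ[OF q]])
    show "(\<lambda>\<alpha>. \<Prod>i<N. (cmod (1 - of_real (q ^ Suc i) * cis \<alpha>))\<^sup>2) \<in> borel_measurable borel" for N
      unfolding cis_conv_exp by (intro borel_measurable_continuous_onI continuous_intros)
  qed
  then have "(\<lambda>\<alpha>. sqrt ((abs_qpoch_cis q \<alpha>)\<^sup>2)) \<in> borel_measurable borel" by measurable
  moreover have "sqrt ((abs_qpoch_cis q \<alpha>)\<^sup>2) = abs_qpoch_cis q \<alpha>" for \<alpha>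
    by (simp add: abs_qpoch_cis_def)
  ultimately show ?thesis by simp
qed

lemma q_hermite_weight_trunc_bound:
  obtains B where "\<And>N \<theta>. \<bar>q_hermite_weight_trunc q N \<theta>\<bar> \<le> B"
proof -
  obtain C where C: "\<And>N \<alpha>. (\<Prod>j<N. cmod (1 - of_real (q ^ Suc j) * cis \<alpha>)) \<le> C"
    using norm_prod_cis_bound by blast
  have "\<bar>q_hermite_weight_trunc q N \<theta>\<bar> \<le> 4 * C\<^sup>2" for N \<theta>
  proof -
    let ?G = "\<Prod>j<N. cmod (1 - of_real (q ^ Suc j) * cis (2 * \<theta>))"
    have "?G\<^sup>2 \<le> C\<^sup>2" by (intro power_mono C prod_nonneg) simp
    moreover have "(sin \<theta>)\<^sup>2 \<le> 1" by (simp add: sin_squared_eq)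
    ultimately have "(sin \<theta>)\<^sup>2 * ?G\<^sup>2 \<le> 1 * C\<^sup>2" by (intro mult_mono) auto
    moreover have "\<bar>q_hermite_weight_trunc q N \<theta>\<bar> = 4 * ((sin \<theta>)\<^sup>2 * ?G\<^sup>2)"
      unfolding q_hermite_weight_trunc_def prod_power_distrib[symmetric] abs_mult by simp
    ultimately show ?thesis by simp
  qed
  then show ?thesis by (rule that)
qed

lemma q_hermite_weight_trunc_measurable: "q_hermite_weight_trunc q N \<in> borel_measurable borel"
  unfolding q_hermite_weight_trunc_def cis_conv_exp by (intro borel_measurable_continuous_onI continuous_intros)

lemma q_hermite_weight_measurable: "q_hermite_weight q \<in> borel_measurable borel"
  by (rule borel_measurable_LIMSEQ_real[OF q_hermite_weight_trunc_LIMSEQ q_hermite_weight_trunc_measurable])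

lemma q_hermite_weight_bound: obtains B where "B > 0" "\<And>\<theta>. \<bar>q_hermite_weight q \<theta>\<bar> \<le> B"
proof -
  obtain B where B: "\<And>N \<theta>. \<bar>q_hermite_weight_trunc q N \<theta>\<bar> \<le> B" using q_hermite_weight_trunc_bound by metis
  have "\<bar>q_hermite_weight q \<theta>\<bar> \<le> B" for \<theta>
    using tendsto_rabs[OF q_hermite_weight_trunc_LIMSEQ[of \<theta>]] B by (intro LIMSEQ_le_const2) auto
  then have "\<bar>q_hermite_weight q \<theta>\<bar> \<le> max B 1" for \<theta> by (meson max.coboundedI1)
  then show ?thesis by (intro that[of "max B 1"]) auto
qed

lemma integral_cos_trunc:
  "(\<integral>\<theta>. cos (of_int m * \<theta>) * q_hermite_weight_trunc q N \<theta> \<partial>half_circle) =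
   (\<Sum>j\<le>2 * N + 1. theta_coeff q (int j - int N) * q_binom q (2 * N + 1) j *
     (pi * ((if m = 2 * (int j - int N) then 1 else 0) + (if m = - (2 * (int j - int N)) then 1 else 0))))"
proof -
  have i: "integrable half_circle (\<lambda>\<theta>. cos (of_int m * \<theta>) * (2 * cos (of_int l * \<theta>)))" for l
  proof (rule half_circle_integrable[of _ 2])
    fix \<theta> :: real
    have "\<bar>cos (of_int m * \<theta>)\<bar> * \<bar>cos (of_int l * \<theta>)\<bar> \<le> 1 * 1" by (intro mult_mono) auto
    then show "\<bar>cos (of_int m * \<theta>) * (2 * cos (of_int l * \<theta>))\<bar> \<le> 2" by (simp add: abs_mult)
  qed (auto intro!: borel_measurable_continuous_onI continuous_on_mult continuous_on_cos continuous_on_const continuous_on_id)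
  have "(\<integral>\<theta>. cos (of_int m * \<theta>) * q_hermite_weight_trunc q N \<theta> \<partial>half_circle) =
    (\<integral>\<theta>. (\<Sum>j\<le>2 * N + 1. theta_coeff q (int j - int N) * q_binom q (2 * N + 1) j *
     (cos (of_int m * \<theta>) * (2 * cos (of_int (2 * (int j - int N)) * \<theta>)))) \<partial>half_circle)"
    unfolding q_hermite_weight_trunc_fourier by (simp only: sum_distrib_left mult_ac)
  also have "\<dots> = (\<Sum>j\<le>2 * N + 1. theta_coeff q (int j - int N) * q_binom q (2 * N + 1) j *
     (\<integral>\<theta>. cos (of_int m * \<theta>) * (2 * cos (of_int (2 * (int j - int N)) * \<theta>)) \<partial>half_circle))"
    by (subst Bochner_Integration.integral_sum) (simp_all only: integrable_mult_right i integral_mult_right_zero)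
  finally show ?thesis unfolding integral_half_circle_cos_cos .
qed

lemma integral_cos_trunc_LIMSEQ:
  "(\<lambda>N. \<integral>\<theta>. cos (of_int m * \<theta>) * q_hermite_weight_trunc q N \<theta> \<partial>half_circle) \<longlonglongrightarrow> (\<integral>\<theta>. cos (of_int m * \<theta>) * q_hermite_weight q \<theta> \<partial>half_circle)"
proof -
  obtain B where B: "\<And>N \<theta>. \<bar>q_hermite_weight_trunc q N \<theta>\<bar> \<le> B" using q_hermite_weight_trunc_bound by metis
  have c: "(\<lambda>\<theta>::real. cos (of_int m * \<theta>)) \<in> borel_measurable borel"
    by (auto intro!: borel_measurable_continuous_onI continuous_on_mult continuous_on_cos continuous_on_const continuous_on_id)
  show ?thesis
  proof (rule integral_dominated_convergence[where w = "\<lambda>_. B"])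
    show "integrable half_circle (\<lambda>_. B)" by (rule half_circle_integrable[of _ "\<bar>B\<bar>"]) auto
    show "AE \<theta> in half_circle. (\<lambda>N. cos (of_int m * \<theta>) * q_hermite_weight_trunc q N \<theta>) \<longlonglongrightarrow> cos (of_int m * \<theta>) * q_hermite_weight q \<theta>"
      by (intro AE_I2 tendsto_mult tendsto_const q_hermite_weight_trunc_LIMSEQ)
    have "\<bar>cos (of_int m * \<theta>)\<bar> * \<bar>q_hermite_weight_trunc q N \<theta>\<bar> \<le> 1 * B" for N \<theta>
      using B by (intro mult_mono) auto
    then show "AE \<theta> in half_circle. norm (cos (of_int m * \<theta>) * q_hermite_weight_trunc q N \<theta>) \<le> B" for N
      by (simp add: abs_mult)
  qed (intro half_circle_measurable borel_measurable_times c q_hermite_weight_measurable q_hermite_weight_trunc_measurable)+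
qed

text \<open>
  The central q-binomial coefficients tend to the constant of the Jacobi triple product.
\<close>

lemma q_binom_middle_LIMSEQ:
  "(\<lambda>N. q_binom q (2 * N + 1) (nat (int N + l))) \<longlonglongrightarrow> 1 / qpoch_inf q q"
proof -
  have f: "filterlim (\<lambda>N. nat (int N + k)) at_top sequentially" for k
    unfolding filterlim_at_top
  proof
    fix Z :: nat
    show "\<forall>\<^sub>F N in sequentially. Z \<le> nat (int N + k)"
      by (rule eventually_sequentiallyI[of "nat (int Z + \<bar>k\<bar>)"]) linarith
  qed
  have p: "(\<lambda>N. q_poch q (nat (int N + k))) \<longlonglongrightarrow> qpoch_inf q q" for k
    by (rule filterlim_compose[OF q_poch_LIMSEQ[OF q] f])
  have f2: "filterlim (\<lambda>N::nat. 2 * N + 1) at_top sequentially"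
    unfolding filterlim_at_top
  proof
    fix Z :: nat
    show "\<forall>\<^sub>F N in sequentially. Z \<le> 2 * N + 1" by (rule eventually_sequentiallyI[of Z]) simp
  qed
  have p2: "(\<lambda>N. q_poch q (2 * N + 1)) \<longlonglongrightarrow> qpoch_inf q q"
    by (rule filterlim_compose[OF q_poch_LIMSEQ[OF q] f2])
  have "(\<lambda>N. q_poch q (2 * N + 1) / (q_poch q (nat (int N + l)) * q_poch q (nat (int N + (1 - l))))) \<longlonglongrightarrow>
     qpoch_inf q q / (qpoch_inf q q * qpoch_inf q q)"
    using qpoch_inf_qq_pos[OF q] by (intro tendsto_intros p p2) simp
  also have "qpoch_inf q q / (qpoch_inf q q * qpoch_inf q q) = 1 / qpoch_inf q q" by simp
  finally show ?thesis
  proof (rule Lim_transform_eventually)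
    show "\<forall>\<^sub>F N in sequentially. q_poch q (2 * N + 1) / (q_poch q (nat (int N + l)) * q_poch q (nat (int N + (1 - l)))) =
       q_binom q (2 * N + 1) (nat (int N + l))"
    proof (rule eventually_sequentiallyI[of "nat \<bar>l\<bar>"])
      fix N assume "nat \<bar>l\<bar> \<le> N"
      then have "nat (int N + l) \<le> 2 * N + 1" "2 * N + 1 - nat (int N + l) = nat (int N + (1 - l))" by linarith+
      then show "q_poch q (2 * N + 1) / (q_poch q (nat (int N + l)) * q_poch q (nat (int N + (1 - l)))) =
       q_binom q (2 * N + 1) (nat (int N + l))" by (simp add: q_binom_def)
    qed
  qed
qed

text \<open>
  The Fourier coefficients of the weight, as limits of those of the truncated weights.
\<close>

lemma integral_cos_even:
  "(\<integral>\<theta>. cos (of_int (2 * l) * \<theta>) * q_hermite_weight q \<theta> \<partial>half_circle) = pi * (theta_coeff q l + theta_coeff q (- l)) / qpoch_inf q q"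
proof (rule LIMSEQ_unique[OF integral_cos_trunc_LIMSEQ])
  let ?b = "\<lambda>N l. q_binom q (2 * N + 1) (nat (int N + l))"
  have "(\<lambda>N. pi * (theta_coeff q l * ?b N l + theta_coeff q (- l) * ?b N (- l))) \<longlonglongrightarrow>
      pi * (theta_coeff q l * (1 / qpoch_inf q q) + theta_coeff q (- l) * (1 / qpoch_inf q q))"
    by (intro tendsto_intros q_binom_middle_LIMSEQ)
  also have "pi * (theta_coeff q l * (1 / qpoch_inf q q) + theta_coeff q (- l) * (1 / qpoch_inf q q)) =
      pi * (theta_coeff q l + theta_coeff q (- l)) / qpoch_inf q q"
    by (simp add: add_divide_distrib distrib_left)
  finally show "(\<lambda>N. \<integral>\<theta>. cos (of_int (2 * l) * \<theta>) * q_hermite_weight_trunc q N \<theta> \<partial>half_circle) \<longlonglongrightarrow>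
     pi * (theta_coeff q l + theta_coeff q (- l)) / qpoch_inf q q"
  proof (rule Lim_transform_eventually)
    show "\<forall>\<^sub>F N in sequentially. pi * (theta_coeff q l * ?b N l + theta_coeff q (- l) * ?b N (- l)) =
       (\<integral>\<theta>. cos (of_int (2 * l) * \<theta>) * q_hermite_weight_trunc q N \<theta> \<partial>half_circle)"
    proof (rule eventually_sequentiallyI[of "nat \<bar>l\<bar>"])
      fix N assume N: "nat \<bar>l\<bar> \<le> N"
      let ?c = "\<lambda>j. theta_coeff q (int j - int N) * q_binom q (2 * N + 1) j"
      have e: "(\<Sum>j\<le>2 * N + 1. ?c j * (if k = int j - int N then 1 else 0)) = theta_coeff q k * ?b N k"
        if "\<bar>k\<bar> = \<bar>l\<bar>" for k
      proof -
        have "k = int j - int N \<longleftrightarrow> j = nat (int N + k)" for j using N that by linarith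
        moreover have "nat (int N + k) \<le> 2 * N + 1" "int (nat (int N + k)) - int N = k" using N that by linarith+
        ultimately show ?thesis by (simp add: if_distrib cong: if_cong)
      qed
      have "(\<integral>\<theta>. cos (of_int (2 * l) * \<theta>) * q_hermite_weight_trunc q N \<theta> \<partial>half_circle) =
         (\<Sum>j\<le>2 * N + 1. pi * (?c j * (if l = int j - int N then 1 else 0)) + pi * (?c j * (if - l = int j - int N then 1 else 0)))"
        unfolding integral_cos_trunc by (intro sum.cong) auto
      also have "\<dots> = pi * (theta_coeff q l * ?b N l) + pi * (theta_coeff q (- l) * ?b N (- l))"
        by (simp only: sum.distrib sum_distrib_left[symmetric] e abs_minus)
      finally show "pi * (theta_coeff q l * ?b N l + theta_coeff q (- l) * ?b N (- l)) =
         (\<integral>\<theta>. cos (of_int (2 * l) * \<theta>) * q_hermite_weight_trunc q N \<theta> \<partial>half_circle)" by (simp add: distrib_left)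
    qed
  qed
qed

lemma integral_cos_odd:
  assumes "odd m"
  shows "(\<integral>\<theta>. cos (of_int m * \<theta>) * q_hermite_weight q \<theta> \<partial>half_circle) = 0"
proof (rule LIMSEQ_unique[OF integral_cos_trunc_LIMSEQ])
  have "(if m = 2 * k then 1 else 0) + (if m = - (2 * k) then 1 else 0) = (0::real)" for k using assms by auto
  then have "(\<integral>\<theta>. cos (of_int m * \<theta>) * q_hermite_weight_trunc q N \<theta> \<partial>half_circle) = 0" for N
    unfolding integral_cos_trunc by (simp only: mult_zero_right sum.neutral_const)
  then show "(\<lambda>N. \<integral>\<theta>. cos (of_int m * \<theta>) * q_hermite_weight_trunc q N \<theta> \<partial>half_circle) \<longlonglongrightarrow> 0" by simp
qed

text \<open>
  Writing \<open>1 - q\<^sup>n = (1 - q\<^bsup>n - k\<^esup>) q\<^sup>k + (1 - q\<^sup>k)\<close> lowers \<open>n\<close>; the functional equation of the theta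
  coefficients then produces the factor \<open>1 - q\<^sup>m\<close>, which kills the sum when \<open>m\<close> has reached \<open>0\<close>.  (In
  closed form, for \<open>q \<noteq> 0\<close>, the sum is a multiple of \<open>(q\<^bsup>-m\<^esup>; q)\<^sub>n\<close>.)
\<close>

lemma theta_sum_zero:
  assumes "m < n"
  shows "(\<Sum>k\<le>n. theta_coeff q (int k - int m) / (q_poch q k * q_poch q (n - k))) = 0"
  using assms
proof (induction n arbitrary: m)
  case (Suc n)
  let ?e = "\<lambda>k. 1 / q_poch q k" and ?t = "\<lambda>k. theta_coeff q (int k - int m)"
  have e: "(1 - q ^ Suc k) * ?e (Suc k) = ?e k" for k
    using one_minus_power_pos[OF q, of k] by (simp add: q_poch_Suc del: power_Suc)
  have split: "(1 - q ^ Suc n) * (?t k * (?e k * ?e (Suc n - k))) =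
      q ^ k * ?t k * ?e k * ((1 - q ^ (Suc n - k)) * ?e (Suc n - k)) + ?t k * ((1 - q ^ k) * ?e k) * ?e (Suc n - k)"
    if "k \<le> Suc n" for k
  proof -
    have "q ^ Suc n = q ^ k * q ^ (Suc n - k)" using that by (simp only: power_add[symmetric] le_add_diff_inverse)
    then show ?thesis by (simp only: algebra_simps)
  qed
  have "(1 - q ^ Suc n) * (\<Sum>k\<le>Suc n. ?t k * (?e k * ?e (Suc n - k))) =
     (\<Sum>k\<le>Suc n. q ^ k * ?t k * ?e k * ((1 - q ^ (Suc n - k)) * ?e (Suc n - k))) +
     (\<Sum>k\<le>Suc n. ?t k * ((1 - q ^ k) * ?e k) * ?e (Suc n - k))"
    unfolding sum_distrib_left sum.distrib[symmetric] by (intro sum.cong refl split) simp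
  also have "(\<Sum>k\<le>Suc n. q ^ k * ?t k * ?e k * ((1 - q ^ (Suc n - k)) * ?e (Suc n - k))) =
      (\<Sum>k\<le>n. q ^ k * ?t k * ?e k * ?e (n - k))"
    unfolding sum.atMost_Suc using e by (simp add: Suc_diff_le del: power_Suc)
  also have "(\<Sum>k\<le>Suc n. ?t k * ((1 - q ^ k) * ?e k) * ?e (Suc n - k)) = (\<Sum>k\<le>n. ?t (Suc k) * ?e k * ?e (n - k))"
    unfolding sum.atMost_Suc_shift using e by (simp del: power_Suc)
  also have "(\<Sum>k\<le>n. q ^ k * ?t k * ?e k * ?e (n - k)) = (\<Sum>k\<le>n. - (q ^ m) * (?t (Suc k) * ?e k * ?e (n - k)))"
  proof (rule sum.cong[OF refl])
    fix k
    have "q ^ m * theta_coeff q (int k - int m + 1) = - (q ^ k * theta_coeff q (int k - int m))"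
      by (rule theta_coeff_shift) simp
    then have "q ^ k * ?t k = - (q ^ m) * ?t (Suc k)" by (simp add: algebra_simps)
    then show "q ^ k * ?t k * ?e k * ?e (n - k) = - (q ^ m) * (?t (Suc k) * ?e k * ?e (n - k))"
      by (simp only: mult.assoc)
  qed
  finally have "(1 - q ^ Suc n) * (\<Sum>k\<le>Suc n. ?t k * (?e k * ?e (Suc n - k))) =
     (1 - q ^ m) * (\<Sum>k\<le>n. ?t (Suc k) * ?e k * ?e (n - k))"
    by (simp only: sum_distrib_left[symmetric]) (simp add: algebra_simps)
  also have "\<dots> = 0"
  proof (cases m)
    case (Suc l)
    then show ?thesis using Suc.IH[of l] Suc.prems by (simp add: mult.assoc)
  qed simp
  finally show ?case using one_minus_power_pos[OF q, of n] by simp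
qed simp

lemma q_trig_measurable: "q_trig q n \<in> borel_measurable borel"
  unfolding q_trig_def by (intro borel_measurable_continuous_onI continuous_intros) (simp add: q_poch_nz[OF q])

lemma integrable_mult_q_hermite_weight:
  assumes "f \<in> borel_measurable borel" "\<And>\<theta>. \<bar>f \<theta>\<bar> \<le> C"
  shows "integrable half_circle (\<lambda>\<theta>. f \<theta> * q_hermite_weight q \<theta>)"
proof -
  obtain B where B: "B > 0" "\<And>\<theta>. \<bar>q_hermite_weight q \<theta>\<bar> \<le> B" using q_hermite_weight_bound by metis
  have "C \<ge> 0" using assms(2)[of 0] by linarith
  then have "\<bar>f \<theta> * q_hermite_weight q \<theta>\<bar> \<le> C * B" for \<theta>
    unfolding abs_mult using assms(2) B by (intro mult_mono) auto
  then show ?thesis using assms(1) q_hermite_weight_measurable by (intro half_circle_integrable) auto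
qed

text \<open>
  For odd \<open>n\<close> every Fourier coefficient involved vanishes.  For \<open>n = 2 m\<close> the two theta coefficients in
  \<open>integral_cos_even\<close> contribute equally, by the symmetry \<open>k \<mapsto> n - k\<close>, and \<open>theta_sum_zero\<close>
  applies unless \<open>n = 0\<close>.
\<close>

lemma integral_q_trig:
  "(\<integral>\<theta>. q_trig q n \<theta> * q_hermite_weight q \<theta> \<partial>half_circle) = (if n = 0 then 2 * pi / qpoch_inf q q else 0)"
proof -
  let ?d = "\<lambda>k. q_poch q k * q_poch q (n - k)"
  have i: "integrable half_circle (\<lambda>\<theta>. cos (of_int m * \<theta>) * q_hermite_weight q \<theta>)" for m
    by (rule integrable_mult_q_hermite_weight[of _ 1]) (auto intro!: borel_measurable_continuous_onI continuous_on_mult continuous_on_cos continuous_on_const continuous_on_id)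
  have "(\<integral>\<theta>. q_trig q n \<theta> * q_hermite_weight q \<theta> \<partial>half_circle) =
      (\<integral>\<theta>. (\<Sum>k\<le>n. 1 / ?d k * (cos (of_int (2 * int k - int n) * \<theta>) * q_hermite_weight q \<theta>)) \<partial>half_circle)"
    unfolding q_trig_def sum_distrib_right by simp
  also have "\<dots> = (\<Sum>k\<le>n. 1 / ?d k * (\<integral>\<theta>. cos (of_int (2 * int k - int n) * \<theta>) * q_hermite_weight q \<theta> \<partial>half_circle))"
    by (subst Bochner_Integration.integral_sum) (simp_all only: integrable_mult_right i integral_mult_right_zero)
  also have "\<dots> = (if n = 0 then 2 * pi / qpoch_inf q q else 0)"
  proof (cases "even n")
    case False
    then have "n \<noteq> 0" by (metis even_zero)
    have "(\<integral>\<theta>. cos (of_int (2 * int k - int n) * \<theta>) * q_hermite_weight q \<theta> \<partial>half_circle) = 0" for k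
      using False by (intro integral_cos_odd) simp
    then show ?thesis using \<open>n \<noteq> 0\<close> by (simp only: mult_zero_right sum.neutral_const if_False)
  next
    case True
    then obtain m where m: "n = 2 * m" by blast
    have "2 * int k - int n = 2 * (int k - int m)" for k by (simp add: m)
    then have "(\<Sum>k\<le>n. 1 / ?d k * (\<integral>\<theta>. cos (of_int (2 * int k - int n) * \<theta>) * q_hermite_weight q \<theta> \<partial>half_circle)) =
       (\<Sum>k\<le>n. 1 / ?d k * (pi * (theta_coeff q (int k - int m) + theta_coeff q (- (int k - int m))) / qpoch_inf q q))"
      by (simp only: integral_cos_even)
    also have "\<dots> = pi / qpoch_inf q q * ((\<Sum>k\<le>n. theta_coeff q (int k - int m) / ?d k) +
       (\<Sum>k\<le>n. theta_coeff q (- (int k - int m)) / ?d k))"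
      unfolding sum.distrib[symmetric] sum_distrib_left by (intro sum.cong) (simp_all add: add_divide_distrib algebra_simps)
    also have "(\<Sum>k\<le>n. theta_coeff q (- (int k - int m)) / ?d k) = (\<Sum>k\<le>n. theta_coeff q (int k - int m) / ?d k)"
      by (rule sum.reindex_bij_witness[of _ "\<lambda>k. n - k" "\<lambda>k. n - k"]) (auto simp: m of_nat_diff mult.commute)
    finally show ?thesis using theta_sum_zero[of m n] m by (cases "m = 0") (simp_all add: field_simps)
  qed
  finally show ?thesis .
qed

lemma integrable_q_trig2: "integrable half_circle (\<lambda>\<theta>. q_trig q m \<theta> * q_trig q n \<theta> * q_hermite_weight q \<theta>)"
proof -
  obtain A where A: "A > 0" "\<And>n \<theta>. \<bar>q_trig q n \<theta>\<bar> \<le> A * (real n + 1)" using q_trig_bound[OF q] by metis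
  have "\<bar>q_trig q m \<theta> * q_trig q n \<theta>\<bar> \<le> (A * (real m + 1)) * (A * (real n + 1))" for \<theta>
    unfolding abs_mult using A by (intro mult_mono) (auto intro: less_imp_le)
  then show ?thesis using q_trig_measurable by (intro integrable_mult_q_hermite_weight) auto
qed

text \<open>
  Multiplication by \<open>2 cos \<theta>\<close> is symmetric for the inner product, so that the recurrence determines all
  inner products from those with the constant polynomial.
\<close>

lemma q_trig_orthogonal:
  "(\<integral>\<theta>. q_trig q m \<theta> * q_trig q n \<theta> * q_hermite_weight q \<theta> \<partial>half_circle) =
   (if m = n then 2 * pi / (qpoch_inf q q * q_poch q n) else 0)"
proof -
  \<comment> \<open>Shifting the index by one, with \<open>0\<close> in front, makes the recurrence hold from the start.\<close>
  define A where "A n \<theta> = (if n = 0 then 0 else q_trig q (n - 1) \<theta>)" for n \<theta>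
  define M where "M m n = (\<integral>\<theta>. A m \<theta> * A n \<theta> * q_hermite_weight q \<theta> \<partial>half_circle)" for m n
  define c where "c = 2 * pi / qpoch_inf q q"
  have i: "integrable half_circle (\<lambda>\<theta>. A m \<theta> * A n \<theta> * q_hermite_weight q \<theta>)" for m n
    unfolding A_def using integrable_q_trig2[of "m - 1" "n - 1"] by (cases m; cases n) simp_all
  have rec: "2 * cos \<theta> * A (Suc n) \<theta> = (1 - q ^ Suc n) * A (Suc (Suc n)) \<theta> + A n \<theta>" for n \<theta>
  proof (cases n)
    case 0
    then show ?thesis using q_trig_1[OF q, of \<theta>] q_trig_0[OF q] by (simp add: A_def)
  next
    case (Suc k)
    then show ?thesis using q_trig_recurrence[OF q, of k \<theta>] by (simp add: A_def)
  qed
  have x: "(\<integral>\<theta>. (2 * cos \<theta> * A (Suc m) \<theta>) * A n \<theta> * q_hermite_weight q \<theta> \<partial>half_circle) =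
     (1 - q ^ Suc m) * M (Suc (Suc m)) n + M m n" for m n
  proof -
    have "(\<integral>\<theta>. (2 * cos \<theta> * A (Suc m) \<theta>) * A n \<theta> * q_hermite_weight q \<theta> \<partial>half_circle) =
      (\<integral>\<theta>. (1 - q ^ Suc m) * (A (Suc (Suc m)) \<theta> * A n \<theta> * q_hermite_weight q \<theta>) + A m \<theta> * A n \<theta> * q_hermite_weight q \<theta> \<partial>half_circle)"
      unfolding rec by (simp only: distrib_right mult.assoc)
    also have "\<dots> = (1 - q ^ Suc m) * M (Suc (Suc m)) n + M m n"
      unfolding M_def by (subst Bochner_Integration.integral_add) (simp_all only: integrable_mult_right i integral_mult_right_zero)
    finally show ?thesis .
  qed
  have sym: "M m n = M n m" for m n unfolding M_def by (simp only: mult_ac)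
  have swap: "(1 - q ^ Suc m) * M (Suc (Suc m)) (Suc n) + M m (Suc n) =
      (1 - q ^ Suc n) * M (Suc m) (Suc (Suc n)) + M (Suc m) n" for m n
    unfolding sym[of "Suc m"] x[symmetric] by (simp only: mult_ac)
  have M0: "M 0 n = 0" "M n 0 = 0" for n by (simp_all add: M_def A_def)
  have M: "M m n = (if m = n \<and> n > 0 then c / q_poch q (n - 1) else 0)" for m n
  proof (induction m arbitrary: n rule: induct_nat_012)
    case 1
    show ?case using integral_q_trig[of "n - 1"]
      by (cases n) (simp_all add: M_def A_def c_def q_trig_0[OF q])
  next
    case (ge2 m)
    show ?case
    proof (cases n)
      case (Suc k)
      have nz: "1 - q ^ Suc l \<noteq> 0" for l using one_minus_power_pos[OF q, of l] by simp
      have "(1 - q ^ Suc m) * M (Suc (Suc m)) (Suc k) =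
          (1 - q ^ Suc k) * M (Suc m) (Suc (Suc k)) + M (Suc m) k - M m (Suc k)"
        using swap[of m k] by simp
      also have "\<dots> = (if k = Suc m then c / q_poch q m else 0)"
        using nz[of k] q_poch_nz[OF q] by (auto simp: ge2 q_poch_Suc simp del: power_Suc)
      finally have "M (Suc (Suc m)) (Suc k) = (if k = Suc m then c / q_poch q m else 0) / (1 - q ^ Suc m)"
        using nz[of m] by (simp add: eq_divide_eq mult.commute del: power_Suc)
      then show ?thesis using Suc by (auto simp: q_poch_Suc simp del: power_Suc)
    qed (simp add: M0)
  qed (simp add: M0)
  show ?thesis using M[of "Suc m" "Suc n"] by (simp add: M_def A_def c_def)
qed

end

section \<open>The Poisson-Mehler measure\<close>

definition mehler_kernel :: "real \<Rightarrow> real \<Rightarrow> real \<Rightarrow> real" where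
  "mehler_kernel q \<phi> \<theta> = qpoch_inf (q\<^sup>2) q / (abs_qpoch_cis q (\<phi> + \<theta>) * abs_qpoch_cis q (\<phi> - \<theta>))\<^sup>2"

text \<open>
  Outside \<open>[-1, 1]\<close> the definite description defining \<open>arccos\<close> has the same empty predicate at every
  point; this is needed for the measurability of \<open>arccos\<close> on the whole line.
\<close>

lemma arccos_outside: "\<bar>y\<bar> > 1 \<Longrightarrow> arccos y = arccos 2"
proof -
  assume y: "\<bar>y\<bar> > 1"
  have "cos x \<noteq> y" "cos x \<noteq> 2" for x using y abs_cos_le_one[of x] by fastforce+
  then show ?thesis by (simp add: arccos_def)
qed

lemma arccos_measurable: "arccos \<in> borel_measurable borel"
proof -
  have c: "continuous_on UNIV (\<lambda>y. arccos (max (-1) (min 1 y)))"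
    by (rule continuous_on_compose2[OF continuous_on_arccos']) (auto intro!: continuous_intros)
  have "(\<lambda>y. if y \<in> {-1..1} then arccos (max (-1) (min 1 y)) else arccos 2) \<in> borel_measurable borel"
    by (intro measurable_If borel_measurable_continuous_onI c) auto
  moreover have "(\<lambda>y. if y \<in> {-1..1} then arccos (max (-1) (min 1 y)) else arccos 2) = arccos"
  proof
    fix y show "(if y \<in> {-1..1} then arccos (max (-1) (min 1 y)) else arccos 2) = arccos y"
      using arccos_outside[of y] by (auto simp: max_def min_def)
  qed
  ultimately show ?thesis by simp
qed

lemma cos_substitution:
  fixes F :: "real \<Rightarrow> real"
  assumes r: "r > 0" and F: "F \<in> borel_measurable borel" "\<And>\<theta>. \<bar>F \<theta>\<bar> \<le> B"
  shows "integrable lborel (\<lambda>y. indicator {-r..r} y * F (arccos (y / r)))"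
    and "(\<integral>y. indicator {-r..r} y * F (arccos (y / r)) \<partial>lborel) = (\<integral>\<theta>. r * sin \<theta> * F \<theta> \<partial>half_circle)"
proof -
  have m: "(\<lambda>y. F (arccos (y / r))) \<in> borel_measurable borel" "(\<lambda>y. F (arccos (- y / r))) \<in> borel_measurable borel"
    by (rule measurable_compose[OF _ F(1)], rule measurable_compose[OF _ arccos_measurable], measurable)+
  have int: "integrable lborel (\<lambda>y. indicator {-r..r} y *\<^sub>R G y)"
    if "G \<in> borel_measurable borel" "\<And>y. \<bar>G y\<bar> \<le> B" for G :: "real \<Rightarrow> real"
  proof (rule Bochner_Integration.integrable_bound)
    show "integrable lborel (\<lambda>y. indicator {-r..r} y *\<^sub>R B)"
      by (intro integrable_scaleR_left integrable_real_indicator) (use r in simp_all)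
    show "AE y in lborel. norm (indicator {-r..r} y *\<^sub>R G y) \<le> norm (indicator {-r..r} y *\<^sub>R B)"
    proof (rule AE_I2)
      fix y
      have "\<bar>G y\<bar> \<le> \<bar>B\<bar>" using that(2)[of y] by linarith
      then show "norm (indicator {-r..r} y *\<^sub>R G y) \<le> norm (indicator {-r..r} y *\<^sub>R B)"
        by (simp split: split_indicator)
    qed
    show "(\<lambda>y. indicator {-r..r} y *\<^sub>R G y) \<in> borel_measurable lborel" using that(1) by measurable
  qed
  show "integrable lborel (\<lambda>y. indicator {-r..r} y * F (arccos (y / r)))"
    using int[OF m(1)] F(2) by simp
  \<comment> \<open>The substitution rule wants an increasing function, so the line is reflected first.\<close>
  let ?f = "\<lambda>y. F (arccos (- y / r))" and ?g = "\<lambda>s. - r * cos s"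
  have "(\<integral>y. indicator {-r..r} y * F (arccos (y / r)) \<partial>lborel) = (\<integral>y. indicator {-r..r} (- y) * ?f y \<partial>lborel)"
    by (subst lborel_integral_real_affine[where c = "-1" and t = 0]) simp_all
  also have "\<dots> = (\<integral>y. ?f y * indicator {?g 0..?g pi} y \<partial>lborel)"
    by (intro Bochner_Integration.integral_cong) (auto split: split_indicator)
  also have "\<dots> = (\<integral>s. ?f (?g s) * (r * sin s) * indicator {0..pi} s \<partial>lborel)"
  proof (rule integral_substitution)
    show "set_integrable lborel {?g 0..?g pi} ?f"
      using int[OF m(2)] F(2) by (simp add: set_integrable_def)
    show "continuous_on {0..pi} (\<lambda>s. r * sin s)" by (intro continuous_intros)
    show "(?g has_real_derivative r * sin s) (at s)" for s by (auto intro!: derivative_eq_intros)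
    show "0 \<le> r * sin s" if "s \<in> {0..pi}" for s using that r sin_ge_zero by auto
  qed simp
  also have "\<dots> = (\<integral>s. indicator {0..pi} s *\<^sub>R (r * sin s * F s) \<partial>lborel)"
    using r by (intro Bochner_Integration.integral_cong) (auto split: split_indicator simp: arccos_cos)
  also have "\<dots> = (\<integral>\<theta>. r * sin \<theta> * F \<theta> \<partial>half_circle)" by (subst integral_restrict_space) simp_all
  finally show "(\<integral>y. indicator {-r..r} y * F (arccos (y / r)) \<partial>lborel) = (\<integral>\<theta>. r * sin \<theta> * F \<theta> \<partial>half_circle)" .
qed

context
  fixes q :: real
  assumes q: "\<bar>q\<bar> < 1"
begin

lemma mehler_kernel_sums: "(\<lambda>j. mehler_term q \<theta> \<phi> j * q ^ j) sums mehler_kernel q \<phi> \<theta>"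
  using summable_sums[OF mehler_term_summable[OF q q, of \<theta> \<phi>]] poisson_mehler[OF q, of \<theta> \<phi>]
  by (simp add: mehler_sum_def mehler_kernel_def)

lemma mehler_kernel_nonneg: "mehler_kernel q \<phi> \<theta> \<ge> 0"
proof -
  have "qpoch_inf (q\<^sup>2) q \<ge> 0"
  proof (rule LIMSEQ_le_const[OF qpoch_LIMSEQ])
    have "0 < 1 - q\<^sup>2 * q ^ i" for i
      using one_minus_power_pos[OF q, of "Suc i"] by (simp add: power2_eq_square mult.assoc)
    then have "0 \<le> (\<Prod>i<n. 1 - q\<^sup>2 * q ^ i)" for n by (intro prod_nonneg) (auto intro: less_imp_le)
    then show "\<exists>N. \<forall>n\<ge>N. 0 \<le> (\<Prod>i<n. 1 - q\<^sup>2 * q ^ i)" by blast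
  qed (use q in simp)
  then show ?thesis by (simp add: mehler_kernel_def)
qed

lemma mehler_kernel_measurable: "mehler_kernel q \<phi> \<in> borel_measurable borel"
proof -
  have [measurable]: "abs_qpoch_cis q \<in> borel_measurable borel" by (rule abs_qpoch_cis_measurable[OF q])
  show ?thesis unfolding mehler_kernel_def by measurable
qed

lemma mehler_kernel_bound: obtains B where "\<And>\<theta>. \<bar>mehler_kernel q \<phi> \<theta>\<bar> \<le> B"
proof -
  obtain C where C: "C > 0" "\<And>n \<theta> \<phi>. \<bar>mehler_term q \<theta> \<phi> n\<bar> \<le> C * (real n + 1)\<^sup>2"
    using mehler_term_bound[OF q] by metis
  have s: "summable (\<lambda>j. C * ((real j + 1)\<^sup>2 * \<bar>q\<bar> ^ j))"
    using q by (intro summable_mult summable_square_geometric) auto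
  have "\<bar>mehler_kernel q \<phi> \<theta>\<bar> \<le> (\<Sum>j. C * ((real j + 1)\<^sup>2 * \<bar>q\<bar> ^ j))" for \<theta>
  proof -
    have "norm (\<Sum>j. mehler_term q \<theta> \<phi> j * q ^ j) \<le> (\<Sum>j. C * ((real j + 1)\<^sup>2 * \<bar>q\<bar> ^ j))"
    proof (rule norm_suminf_le[OF _ s])
      fix j show "norm (mehler_term q \<theta> \<phi> j * q ^ j) \<le> C * ((real j + 1)\<^sup>2 * \<bar>q\<bar> ^ j)"
        using mult_right_mono[OF C(2)[of \<theta> \<phi> j], of "\<bar>q\<bar> ^ j"] by (simp add: abs_mult power_abs mult_ac)
    qed
    then show ?thesis using sums_unique[OF mehler_kernel_sums[of \<theta> \<phi>]] by simp
  qed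
  then show ?thesis by (rule that)
qed

text \<open>
  The Mehler series is integrated termwise; orthogonality leaves the single term of index \<open>n\<close>.
\<close>

theorem integral_q_trig_mehler_kernel:
  "(\<integral>\<theta>. q_trig q n \<theta> * mehler_kernel q \<phi> \<theta> * q_hermite_weight q \<theta> \<partial>half_circle) =
    2 * pi / qpoch_inf q q * (q ^ n * q_trig q n \<phi>)"
proof -
  define f where "f j \<theta> = q_trig q n \<theta> * (mehler_term q \<theta> \<phi> j * q ^ j) * q_hermite_weight q \<theta>" for j \<theta>
  have f: "f j = (\<lambda>\<theta>. (q_poch q j * q_trig q j \<phi> * q ^ j) * (q_trig q n \<theta> * q_trig q j \<theta> * q_hermite_weight q \<theta>))" for j
    by (simp add: f_def mehler_term_def fun_eq_iff mult_ac)
  have fint: "integrable half_circle (f j)" for j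
    unfolding f by (intro integrable_mult_right integrable_q_trig2[OF q])
  have fval: "(\<integral>\<theta>. f j \<theta> \<partial>half_circle) = (if j = n then 2 * pi / qpoch_inf q q * (q ^ n * q_trig q n \<phi>) else 0)" for j
    unfolding f integral_mult_right_zero q_trig_orthogonal[OF q] using q_poch_nz[OF q] by simp
  obtain A where A: "A > 0" "\<And>n \<theta>. \<bar>q_trig q n \<theta>\<bar> \<le> A * (real n + 1)" using q_trig_bound[OF q] by metis
  obtain C where C: "C > 0" "\<And>n \<theta> \<phi>. \<bar>mehler_term q \<theta> \<phi> n\<bar> \<le> C * (real n + 1)\<^sup>2"
    using mehler_term_bound[OF q] by metis
  obtain B where B: "B > 0" "\<And>\<theta>. \<bar>q_hermite_weight q \<theta>\<bar> \<le> B" using q_hermite_weight_bound[OF q] by metis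
  define D where "D = A * (real n + 1) * C * B"
  have fb: "\<bar>f j \<theta>\<bar> \<le> D * ((real j + 1)\<^sup>2 * \<bar>q\<bar> ^ j)" for j \<theta>
  proof -
    have "\<bar>f j \<theta>\<bar> \<le> (A * (real n + 1)) * (C * (real j + 1)\<^sup>2 * \<bar>q\<bar> ^ j) * B"
      unfolding f_def abs_mult power_abs using A B C by (intro mult_mono) (auto intro: less_imp_le)
    then show ?thesis by (simp add: D_def mult_ac)
  qed
  have s: "summable (\<lambda>j. D * ((real j + 1)\<^sup>2 * \<bar>q\<bar> ^ j))"
    using q by (intro summable_mult summable_square_geometric) auto
  have n1: "norm (\<integral>\<theta>. norm (f j \<theta>) \<partial>half_circle) \<le> pi * (D * ((real j + 1)\<^sup>2 * \<bar>q\<bar> ^ j))" for j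
  proof -
    have "(\<integral>\<theta>. norm (f j \<theta>) \<partial>half_circle) \<le> (\<integral>\<theta>. D * ((real j + 1)\<^sup>2 * \<bar>q\<bar> ^ j) * cos (of_int 0 * \<theta>) \<partial>half_circle)"
    proof (rule integral_mono)
      show "integrable half_circle (\<lambda>\<theta>. norm (f j \<theta>))" using fint by (rule integrable_norm)
      show "integrable half_circle (\<lambda>\<theta>. D * ((real j + 1)\<^sup>2 * \<bar>q\<bar> ^ j) * cos (of_int 0 * \<theta>))"
        by (rule half_circle_integrable[of _ "\<bar>D * ((real j + 1)\<^sup>2 * \<bar>q\<bar> ^ j)\<bar>"]) auto
      show "norm (f j \<theta>) \<le> D * ((real j + 1)\<^sup>2 * \<bar>q\<bar> ^ j) * cos (of_int 0 * \<theta>)" for \<theta>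
        using fb by simp
    qed
    also have "\<dots> = pi * (D * ((real j + 1)\<^sup>2 * \<bar>q\<bar> ^ j))"
      unfolding integral_mult_right_zero integral_half_circle_cos by simp
    finally show ?thesis by simp
  qed
  have "(\<lambda>j. \<integral>\<theta>. f j \<theta> \<partial>half_circle) sums (\<integral>\<theta>. (\<Sum>j. f j \<theta>) \<partial>half_circle)"
  proof (rule sums_integral[OF fint])
    show "AE \<theta> in half_circle. summable (\<lambda>j. norm (f j \<theta>))"
      using fb by (intro AE_I2 summable_comparison_test'[OF s]) auto
    show "summable (\<lambda>j. \<integral>\<theta>. norm (f j \<theta>) \<partial>half_circle)"
      using n1 by (intro summable_comparison_test'[OF summable_mult[OF s, of pi]]) auto
  qed
  moreover have "(\<Sum>j. f j \<theta>) = q_trig q n \<theta> * mehler_kernel q \<phi> \<theta> * q_hermite_weight q \<theta>" for \<theta>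
    unfolding f_def by (intro sums_unique[symmetric] sums_mult sums_mult2 mehler_kernel_sums)
  moreover have "(\<lambda>j. \<integral>\<theta>. f j \<theta> \<partial>half_circle) sums (2 * pi / qpoch_inf q q * (q ^ n * q_trig q n \<phi>))"
    unfolding fval using sums_single[of n "\<lambda>_. 2 * pi / qpoch_inf q q * (q ^ n * q_trig q n \<phi>)"] by simp
  ultimately show ?thesis using sums_unique2 by fastforce
qed

end

lemma poly_measurable [measurable]: "poly (p :: real poly) \<in> borel_measurable borel"
  by (intro borel_measurable_continuous_onI continuous_intros)

text \<open>
  The density of \<open>gamma_q\<close> in \<open>y\<close>, as a function of the angle.
\<close>

definition gamma_density :: "real \<Rightarrow> real \<Rightarrow> real \<Rightarrow> real" where
  "gamma_density q t \<theta> = sqrt (1 - q) / (pi * sqrt t) * sin \<theta> * qpoch_inf q q * (abs_qpoch_cis q (2 * \<theta>))\<^sup>2"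

text \<open>
  The candidate for the kernel \<open>\<Gamma>\<^bsub>t;q\<^esub>(x, \<cdot>)\<close> at \<open>x = radius q t * cos \<phi>\<close>.
\<close>

definition mehler_measure :: "real \<Rightarrow> real \<Rightarrow> real \<Rightarrow> real measure" where
  "mehler_measure q t \<phi> = density lborel (\<lambda>y. ennreal
     (indicator {- radius q t .. radius q t} y * (gamma_density q t (angle q t y) * mehler_kernel q \<phi> (angle q t y))))"

context
  fixes q t :: real
  assumes q: "\<bar>q\<bar> < 1" and t: "t > 0"
begin

lemma radius_pos: "radius q t > 0" using q t by (simp add: radius_def)

lemma angle_measurable: "angle q t \<in> borel_measurable borel"
  unfolding angle_def by (rule measurable_compose[OF _ arccos_measurable]) measurable

lemma angle_range: "y \<in> {- radius q t .. radius q t} \<Longrightarrow> angle q t y \<in> {0..pi}"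
  using radius_pos arccos_lbound[of "y / radius q t"] arccos_ubound[of "y / radius q t"]
  by (auto simp: angle_def divide_simps)

lemma radius_cos_angle: "y \<in> {- radius q t .. radius q t} \<Longrightarrow> radius q t * cos (angle q t y) = y"
  using radius_pos by (auto simp: angle_def divide_simps)

lemma gamma_density_measurable: "gamma_density q t \<in> borel_measurable borel"
proof -
  have [measurable]: "abs_qpoch_cis q \<in> borel_measurable borel" by (rule abs_qpoch_cis_measurable[OF q])
  show ?thesis unfolding gamma_density_def by measurable
qed

lemma gamma_density_bound: obtains B where "B > 0" "\<And>\<theta>. \<bar>gamma_density q t \<theta>\<bar> \<le> B"
proof -
  obtain C where C: "\<And>\<alpha>. (abs_qpoch_cis q \<alpha>)\<^sup>2 \<le> C" using abs_qpoch_cis_sq_bound[OF q] by metis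
  let ?c = "\<bar>sqrt (1 - q) / (pi * sqrt t)\<bar>"
  have "\<bar>gamma_density q t \<theta>\<bar> \<le> ?c * 1 * \<bar>qpoch_inf q q\<bar> * C" for \<theta>
    unfolding gamma_density_def abs_mult using C by (intro mult_mono) auto
  then have "\<bar>gamma_density q t \<theta>\<bar> \<le> max 1 (?c * 1 * \<bar>qpoch_inf q q\<bar> * C)" for \<theta>
    by (meson max.coboundedI2)
  then show ?thesis by (intro that[of "max 1 (?c * 1 * \<bar>qpoch_inf q q\<bar> * C)"]) auto
qed

lemma gamma_density_nonneg: "\<theta> \<in> {0..pi} \<Longrightarrow> gamma_density q t \<theta> \<ge> 0"
  using sin_ge_zero[of \<theta>] qpoch_inf_qq_pos[OF q] t q by (simp add: gamma_density_def)

lemma radius_sin_gamma_density: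
  "radius q t * sin \<theta> * gamma_density q t \<theta> = qpoch_inf q q / (2 * pi) * q_hermite_weight q \<theta>"
  using t q by (simp add: radius_def gamma_density_def q_hermite_weight_def power2_eq_square field_simps)

lemma mehler_measure_density_nonneg:
  "indicator {- radius q t .. radius q t} y * (gamma_density q t (angle q t y) * mehler_kernel q \<phi> (angle q t y)) \<ge> (0::real)"
  using gamma_density_nonneg[OF angle_range] mehler_kernel_nonneg[OF q] by (auto split: split_indicator)

lemma mehler_measure_density_measurable:
  "(\<lambda>y. indicator {- radius q t .. radius q t} y * (gamma_density q t (angle q t y) * mehler_kernel q \<phi> (angle q t y))) \<in> borel_measurable borel"
proof -
  have [measurable]: "gamma_density q t \<in> borel_measurable borel" "angle q t \<in> borel_measurable borel"
    "mehler_kernel q \<phi> \<in> borel_measurable borel"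
    by (rule gamma_density_measurable angle_measurable mehler_kernel_measurable[OF q])+
  show ?thesis by measurable
qed

lemma
  shows mehler_measure_integrable_poly: "integrable (mehler_measure q t \<phi>) (poly p)"
    and mehler_measure_integral_poly: "(\<integral>y. poly p y \<partial>mehler_measure q t \<phi>) =
      qpoch_inf q q / (2 * pi) * (\<integral>\<theta>. poly p (radius q t * cos \<theta>) * mehler_kernel q \<phi> \<theta> * q_hermite_weight q \<theta> \<partial>half_circle)"
proof -
  let ?r = "radius q t"
  define F where "F \<theta> = gamma_density q t \<theta> * mehler_kernel q \<phi> \<theta> * poly p (?r * cos \<theta>)" for \<theta>
  have [measurable]: "gamma_density q t \<in> borel_measurable borel" "mehler_kernel q \<phi> \<in> borel_measurable borel"
    by (rule gamma_density_measurable mehler_kernel_measurable[OF q])+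
  have Fm: "F \<in> borel_measurable borel" unfolding F_def by measurable
  obtain B1 where B1: "B1 > 0" "\<And>\<theta>. \<bar>gamma_density q t \<theta>\<bar> \<le> B1" using gamma_density_bound by metis
  obtain B2 where B2: "\<And>\<theta>. \<bar>mehler_kernel q \<phi> \<theta>\<bar> \<le> B2" using mehler_kernel_bound[OF q] by metis
  have "compact (poly p ` {-?r..?r})" by (intro compact_continuous_image continuous_intros compact_Icc)
  then have "bounded (poly p ` {-?r..?r})" by (rule compact_imp_bounded)
  then obtain B3 where "\<forall>z\<in>poly p ` {-?r..?r}. norm z \<le> B3" unfolding bounded_iff by blast
  then have B3: "\<bar>poly p y\<bar> \<le> B3" if "y \<in> {-?r..?r}" for y using that by simp
  have rc: "?r * cos \<theta> \<in> {-?r..?r}" for \<theta>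
    using radius_pos mult_left_mono[OF cos_le_one[of \<theta>], of ?r] mult_left_mono[OF cos_ge_minus_one[of \<theta>], of ?r] by auto
  have B2p: "B2 \<ge> 0" using B2[of 0] by linarith
  have Fb: "\<bar>F \<theta>\<bar> \<le> B1 * B2 * B3" for \<theta>
    unfolding F_def abs_mult using B1 B2 B3[OF rc] B2p by (intro mult_mono) auto
  have eq: "(indicator {-?r..?r} y * (gamma_density q t (angle q t y) * mehler_kernel q \<phi> (angle q t y))) * poly p y
      = indicator {-?r..?r} y * F (arccos (y / ?r))" for y
    using radius_cos_angle[of y] by (auto simp: F_def angle_def split: split_indicator)
  show "integrable (mehler_measure q t \<phi>) (poly p)"
    unfolding mehler_measure_def using cos_substitution(1)[OF radius_pos Fm Fb] mehler_measure_density_measurable mehler_measure_density_nonneg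
    by (subst integrable_density) (auto simp: eq)
  have "(\<integral>y. poly p y \<partial>mehler_measure q t \<phi>) = (\<integral>y. indicator {-?r..?r} y * F (arccos (y / ?r)) \<partial>lborel)"
    unfolding mehler_measure_def using mehler_measure_density_measurable mehler_measure_density_nonneg
    by (subst integral_density) (auto simp: eq)
  also have "\<dots> = (\<integral>\<theta>. ?r * sin \<theta> * F \<theta> \<partial>half_circle)" by (rule cos_substitution(2)[OF radius_pos Fm Fb])
  also have "\<dots> = (\<integral>\<theta>. qpoch_inf q q / (2 * pi) * (poly p (?r * cos \<theta>) * mehler_kernel q \<phi> \<theta> * q_hermite_weight q \<theta>) \<partial>half_circle)"
  proof (rule Bochner_Integration.integral_cong[OF refl])
    fix \<theta>
    have "?r * sin \<theta> * F \<theta> = (?r * sin \<theta> * gamma_density q t \<theta>) * (mehler_kernel q \<phi> \<theta> * poly p (?r * cos \<theta>))"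
      by (simp add: F_def)
    then show "?r * sin \<theta> * F \<theta> = qpoch_inf q q / (2 * pi) * (poly p (?r * cos \<theta>) * mehler_kernel q \<phi> \<theta> * q_hermite_weight q \<theta>)"
      unfolding radius_sin_gamma_density by simp
  qed
  finally show "(\<integral>y. poly p y \<partial>mehler_measure q t \<phi>) =
      qpoch_inf q q / (2 * pi) * (\<integral>\<theta>. poly p (?r * cos \<theta>) * mehler_kernel q \<phi> \<theta> * q_hermite_weight q \<theta> \<partial>half_circle)"
    by simp
qed

theorem is_Gamma_mehler_measure: "is_Gamma q t (radius q t * cos \<phi>) (mehler_measure q t \<phi>)"
  unfolding is_Gamma_def
proof (intro conjI allI)
  let ?I = "{- radius q t .. radius q t}"
  show "sets (mehler_measure q t \<phi>) = sets borel" by (simp add: mehler_measure_def)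
  have "emeasure (mehler_measure q t \<phi>) (- ?I) =
    (\<integral>\<^sup>+y. ennreal (indicator ?I y * (gamma_density q t (angle q t y) * mehler_kernel q \<phi> (angle q t y))) * indicator (- ?I) y \<partial>lborel)"
    unfolding mehler_measure_def using mehler_measure_density_measurable by (intro emeasure_density) auto
  also have "\<dots> = (\<integral>\<^sup>+(y::real). 0 \<partial>lborel)" by (intro nn_integral_cong) (auto split: split_indicator)
  finally show "emeasure (mehler_measure q t \<phi>) (- ?I) = 0" by simp
next
  fix n
  show "integrable (mehler_measure q t \<phi>) (poly (q_hermite q t n))" by (rule mehler_measure_integrable_poly)
  let ?c = "sqrt (t / (1 - q)) ^ n * q_poch q n"
  have "(\<integral>y. poly (q_hermite q t n) y \<partial>mehler_measure q t \<phi>) = qpoch_inf q q / (2 * pi) *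
     (\<integral>\<theta>. ?c * (q_trig q n \<theta> * mehler_kernel q \<phi> \<theta> * q_hermite_weight q \<theta>) \<partial>half_circle)"
    unfolding mehler_measure_integral_poly q_hermite_eq_q_trig[OF q t] by (simp only: mult.assoc)
  also have "\<dots> = q ^ n * (?c * q_trig q n \<phi>)"
    unfolding integral_mult_right_zero integral_q_trig_mehler_kernel[OF q] using qpoch_inf_qq_pos[OF q] by simp
  finally show "(\<integral>y. poly (q_hermite q t n) y \<partial>mehler_measure q t \<phi>) = q ^ n * poly (q_hermite q t n) (radius q t * cos \<phi>)"
    unfolding q_hermite_eq_q_trig[OF q t] by simp
qed

lemma integral_gamma_q:
  assumes g: "g \<in> borel_measurable borel"
  shows "(\<integral>y. g y * mehler_kernel q \<phi> (angle q t y) \<partial>gamma_q q t) = (\<integral>y. g y \<partial>mehler_measure q t \<phi>)"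
proof -
  let ?i = "indicator {- radius q t .. radius q t} :: real \<Rightarrow> real"
  have [measurable]: "gamma_density q t \<in> borel_measurable borel" "angle q t \<in> borel_measurable borel"
    "mehler_kernel q \<phi> \<in> borel_measurable borel" "g \<in> borel_measurable borel"
    by (rule gamma_density_measurable angle_measurable mehler_kernel_measurable[OF q] g)+
  have gq: "gamma_q q t = density lborel (\<lambda>y. ennreal (?i y * gamma_density q t (angle q t y)))"
    by (simp add: gamma_q_def gamma_density_def)
  have nn: "0 \<le> ?i y * gamma_density q t (angle q t y)" for y
    using gamma_density_nonneg[OF angle_range] by (auto split: split_indicator)
  have "(\<integral>y. g y * mehler_kernel q \<phi> (angle q t y) \<partial>gamma_q q t) =
      (\<integral>y. (?i y * gamma_density q t (angle q t y)) *\<^sub>R (g y * mehler_kernel q \<phi> (angle q t y)) \<partial>lborel)"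
    unfolding gq using nn by (intro integral_density) auto
  also have "\<dots> = (\<integral>y. (?i y * (gamma_density q t (angle q t y) * mehler_kernel q \<phi> (angle q t y))) *\<^sub>R g y \<partial>lborel)"
    by (simp add: mult_ac)
  also have "\<dots> = (\<integral>y. g y \<partial>mehler_measure q t \<phi>)"
    unfolding mehler_measure_def using g mehler_measure_density_nonneg by (intro integral_density[symmetric]) auto
  finally show ?thesis .
qed

text \<open>
  After the dilation \<open>u = \<surd>(1 - q) y\<close> the semicircle density becomes
  \<open>\<surd>(1 - q) / (\<pi> \<surd>t) sin \<theta>\<close>, the elementary factor in the density of \<open>gamma_q\<close>.
\<close>

lemma integral_semicircle_scaled:
  assumes g: "g \<in> borel_measurable borel"
  shows "(\<integral>y. g y * (qpoch_inf q q * (abs_qpoch_cis q (2 * angle q t y))\<^sup>2) \<partial>semicircle_scaled q t) =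
    (\<integral>y. g y \<partial>gamma_q q t)"
proof -
  let ?r = "radius q t"
  let ?i = "indicator {- ?r .. ?r} :: real \<Rightarrow> real"
  let ?s = "\<lambda>u. indicator {- 2 * sqrt t .. 2 * sqrt t} u * (sqrt (4 * t - u\<^sup>2) / (2 * pi * t))"
  let ?G = "\<lambda>y. g y * (qpoch_inf q q * (abs_qpoch_cis q (2 * angle q t y))\<^sup>2)"
  define c where "c = sqrt (1 - q)"
  have c: "c > 0" "c * c = 1 - q" using q by (simp_all add: c_def)
  have rc: "?r * c = 2 * sqrt t" using c by (simp add: radius_def c_def[symmetric])
  have [measurable]: "abs_qpoch_cis q \<in> borel_measurable borel" "angle q t \<in> borel_measurable borel"
     "g \<in> borel_measurable borel" "gamma_density q t \<in> borel_measurable borel"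
    by (rule abs_qpoch_cis_measurable[OF q] angle_measurable g gamma_density_measurable)+
  have s0: "0 \<le> ?s u" for u
  proof (cases "u \<in> {- 2 * sqrt t .. 2 * sqrt t}")
    case True
    then have "\<bar>u\<bar> \<le> 2 * sqrt t" by auto
    then have "u\<^sup>2 \<le> (2 * sqrt t)\<^sup>2" by (metis abs_ge_zero power2_abs power_mono)
    then show ?thesis using t by (simp add: power_mult_distrib split: split_indicator)
  qed simp
  have s: "c * ?s (c * y) = ?i y * (c / (pi * sqrt t) * sin (angle q t y))" for y
  proof (cases "y \<in> {-?r..?r}")
    case True
    have 1: "c * y \<in> {- 2 * sqrt t .. 2 * sqrt t}"
    proof -
      have "c * y \<le> c * ?r" using True c(1) by (intro mult_left_mono) auto
      moreover have "c * (- ?r) \<le> c * y" by (rule mult_left_mono) (use True c(1) in auto)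
      ultimately show ?thesis using rc by (auto simp: mult.commute)
    qed
    have "- 1 \<le> y / ?r" "y / ?r \<le> 1" using True radius_pos by (auto simp: divide_simps)
    then have "sin (angle q t y) = sqrt (1 - (y / ?r)\<^sup>2)"
      unfolding angle_def by (intro sin_arccos) auto
    moreover have "4 * t - (c * y)\<^sup>2 = (2 * sqrt t)\<^sup>2 * (1 - (y / ?r)\<^sup>2)"
    proof -
      have "(2 * sqrt t)\<^sup>2 * (y / ?r)\<^sup>2 = (c * y)\<^sup>2"
        unfolding rc[symmetric] using radius_pos by (simp add: power2_eq_square)
      then show ?thesis using t by (simp add: right_diff_distrib power_mult_distrib)
    qed
    ultimately have "sqrt (4 * t - (c * y)\<^sup>2) = 2 * sqrt t * sin (angle q t y)"
      using t by (simp add: real_sqrt_mult)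
    then have "c * ?s (c * y) = c * (2 * sqrt t * sin (angle q t y) / (2 * pi * (sqrt t * sqrt t)))"
      using 1 t by simp
    also have "\<dots> = c / (pi * sqrt t) * sin (angle q t y)" using t by (simp add: divide_simps)
    finally show ?thesis using True by simp
  next
    case False
    have "c * y \<notin> {- 2 * sqrt t .. 2 * sqrt t}"
    proof
      assume "c * y \<in> {- 2 * sqrt t .. 2 * sqrt t}"
      then have "c * y \<le> c * ?r" "c * (- ?r) \<le> c * y" using rc by (auto simp: mult.commute)
      then have "y \<le> ?r" "- ?r \<le> y" using c(1) mult_le_cancel_left_pos by blast+
      then show False using False by auto
    qed
    then show ?thesis using False by simp
  qed
  have "(\<integral>y. ?G y \<partial>semicircle_scaled q t) = (\<integral>u. ?G (u / c) \<partial>semicircle t)"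
    unfolding semicircle_scaled_def c_def by (intro integral_distr) (auto simp: semicircle_def)
  also have "\<dots> = (\<integral>u. ?s u *\<^sub>R ?G (u / c) \<partial>lborel)"
    unfolding semicircle_def using s0 by (intro integral_density) auto
  also have "\<dots> = \<bar>c\<bar> *\<^sub>R (\<integral>y. ?s (0 + c * y) *\<^sub>R ?G ((0 + c * y) / c) \<partial>lborel)"
    using c(1) by (intro lborel_integral_real_affine) simp
  also have "\<dots> = (\<integral>y. \<bar>c\<bar> * (?s (0 + c * y) *\<^sub>R ?G ((0 + c * y) / c)) \<partial>lborel)"
    by (simp only: real_scaleR_def integral_mult_right_zero)
  also have "\<dots> = (\<integral>y. (c * ?s (c * y)) *\<^sub>R ?G y \<partial>lborel)"
    using c(1) by (intro Bochner_Integration.integral_cong) simp_all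
  also have "\<dots> = (\<integral>y. (?i y * gamma_density q t (angle q t y)) *\<^sub>R g y \<partial>lborel)"
    unfolding s by (simp add: gamma_density_def c_def mult_ac)
  also have "\<dots> = (\<integral>y. g y \<partial>density lborel (\<lambda>y. ennreal (?i y * gamma_density q t (angle q t y))))"
    using gamma_density_nonneg[OF angle_range] by (intro integral_density[symmetric]) (auto split: split_indicator)
  also have "\<dots> = (\<integral>y. g y \<partial>gamma_q q t)" by (simp add: gamma_q_def gamma_density_def)
  finally show ?thesis .
qed

end

section \<open>The generators of the q-Brownian motion\<close>

theorem corollary22:
  fixes scaleC :: "complex \<Rightarrow> 'a::{real_normed_algebra_1, banach} \<Rightarrow> 'a"
    and star :: "'a \<Rightarrow> 'a"
    and E :: "'a \<Rightarrow> complex"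
    and X :: "real \<Rightarrow> 'a"
    and q t :: real
    and f :: "real poly"
  assumes "-1 < q" and "q < 1"
    and "q_brownian_motion scaleC star E q X"
    and "t > 0"
  shows "is_generator_value scaleC star E q X t f (Delta_op q t (poly f)) \<and>
    (\<forall>\<phi>\<in>{0..pi}. \<forall>x. x = radius q t * cos \<phi> \<longrightarrow>
       Delta_op q t (poly f) x =
         (\<integral>y. deriv_diff_quot (poly f) x y *
              (qpoch_inf (q\<^sup>2) q /
               (abs_qpoch_cis q (\<phi> + angle q t y) * abs_qpoch_cis q (\<phi> - angle q t y))\<^sup>2)
            \<partial>gamma_q q t) \<and>
       Delta_op q t (poly f) x =
         (\<integral>y. deriv_diff_quot (poly f) x y *
              (qpoch_inf (q\<^sup>2) q * qpoch_inf q q *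
               ((abs_qpoch_cis q (2 * angle q t y))\<^sup>2 /
                (abs_qpoch_cis q (\<phi> + angle q t y) * abs_qpoch_cis q (\<phi> - angle q t y))\<^sup>2))
            \<partial>semicircle_scaled q t))"
proof (intro conjI ballI allI impI)
  have q: "\<bar>q\<bar> < 1" using assms(1,2) by auto
  note t = assms(4)
  interpret q_brownian_motion_nondegenerate scaleC star E q X
    by (rule q_brownian_motion_nondegenerate.intro[OF assms(3)]) (unfold_locales, fact assms(1), fact assms(2))
  obtain c where c: "f = (\<Sum>k\<le>degree f. smult (c k) (q_hermite q t k))"
    by (rule q_hermite_expansion[of f "degree f" q t]) auto
  define g where "g = (\<Sum>k\<le>degree f. smult (c k) (q_hermite_neg_dt q t k))"
  have G: "(\<integral>y. deriv_diff_quot (poly f) x y \<partial>\<mu>) = poly g x" if "is_Gamma q t x \<mu>" for x \<mu>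
    using is_Gamma_integral_deriv_diff_quot[OF that, where n = "degree f" and c = c] c by (simp add: g_def)
  \<comment> \<open>\<open>Gamma_kernel\<close> is an unspecified choice, but any two choices give polynomials the same integrals.\<close>
  have D: "Delta_op q t (poly f) (radius q t * cos \<phi>) = poly g (radius q t * cos \<phi>)" for \<phi>
    unfolding Delta_op_def Gamma_kernel_def by (rule G[OF someI[of "is_Gamma q t _", OF is_Gamma_mehler_measure[OF q t]]])
  have "is_generator_value scaleC star E q X t f (poly g)"
    using generator_value_hermite_expansion[OF t, where n = "degree f" and c = c] c by (simp add: g_def)
  moreover have "Delta_op q t (poly f) x = poly g x" if "x \<in> {- radius q t .. radius q t}" for x
    using D[of "angle q t x"] radius_cos_angle[OF q t that] by simp
  ultimately show "is_generator_value scaleC star E q X t f (Delta_op q t (poly f))"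
    unfolding is_generator_value_def by (subst uniform_limit_cong') auto
  fix \<phi> x assume x: "x = radius q t * cos \<phi>"
  obtain p where "\<forall>y. poly (pderiv (synthetic_div f y)) x = poly p y"
    using pderiv_synthetic_div_is_poly by blast
  then have m: "deriv_diff_quot (poly f) x \<in> borel_measurable borel"
    by (simp add: deriv_diff_quot_poly borel_measurable_continuous_onI continuous_on_poly continuous_on_id cong: measurable_cong)
  have "(\<integral>y. deriv_diff_quot (poly f) x y * mehler_kernel q \<phi> (angle q t y) \<partial>gamma_q q t) = poly g x"
    unfolding integral_gamma_q[OF q t m] using G[OF is_Gamma_mehler_measure[OF q t, of \<phi>]] x by simp
  then have 1: "Delta_op q t (poly f) x =
     (\<integral>y. deriv_diff_quot (poly f) x y * mehler_kernel q \<phi> (angle q t y) \<partial>gamma_q q t)"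
    unfolding x D by simp
  then show "Delta_op q t (poly f) x =
         (\<integral>y. deriv_diff_quot (poly f) x y *
              (qpoch_inf (q\<^sup>2) q /
               (abs_qpoch_cis q (\<phi> + angle q t y) * abs_qpoch_cis q (\<phi> - angle q t y))\<^sup>2)
            \<partial>gamma_q q t)" unfolding mehler_kernel_def .
  have [measurable]: "deriv_diff_quot (poly f) x \<in> borel_measurable borel" "mehler_kernel q \<phi> \<in> borel_measurable borel"
    "angle q t \<in> borel_measurable borel"
    by (rule m mehler_kernel_measurable[OF q] angle_measurable[OF q t])+
  have "(\<lambda>y. deriv_diff_quot (poly f) x y * mehler_kernel q \<phi> (angle q t y)) \<in> borel_measurable borel" by measurable
  from integral_semicircle_scaled[OF q t this] 1
  show "Delta_op q t (poly f) x =
         (\<integral>y. deriv_diff_quot (poly f) x y *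
              (qpoch_inf (q\<^sup>2) q * qpoch_inf q q *
               ((abs_qpoch_cis q (2 * angle q t y))\<^sup>2 /
                (abs_qpoch_cis q (\<phi> + angle q t y) * abs_qpoch_cis q (\<phi> - angle q t y))\<^sup>2))
            \<partial>semicircle_scaled q t)"
    by (simp add: mehler_kernel_def mult_ac)
qed

end
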